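(* Let $M$ be a closed oriented smooth $4$-manifold with a Riemannian metric $g$ and a compatible almost-complex structure $J$, with the induced $Spin^{\mathbb{C}}$-structure. For a self-dual spinor field $\varphi$ and a unitary connection $A$ on $K^*$ let $(\mathcal{B}^{A}\varphi)_XY=Y\bullet\overline\nabla^{A}_X\varphi$, and vary $A$. For every nowhere-zero self-dual spinor field $\varphi\in\Gamma(\mathcal{W}^{+})$ there is a unique unitary connection $A_0$ on $K^*$ and a unique $1$-form $\xi\in\Gamma(T_M^* )$ such that: - $A=A_0$ is the unique minimum point of $\mathcal{B}^{A}\varphi$; - $A=A_0-3i\,\xi$ is the unique minimum point of $\mathrm{Sym}\,\mathcal{B}^{A}\varphi$; - $A=A_0+5i\,\xi$ is the unique minimum point of $\mathrm{Alt}\,\mathcal{B}^{A}\varphi$; - $A=A_0+15i\,\xi$ is the unique vanishing point of $\mathcal{D}^{A}\varphi=\mathrm{tr}(\mathcal{B}^{A}\varphi)$. All these minimizing connections lie on a same affine line in the affine space of unitary connections on $K^*$. If any two of them happen to coincide, then all of them must coincide.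
   Context: Compatible means $J$ is $g$-orthogonal and induces the orientation. $\nabla$ is the Levi-Civita connection of $g$ and $K^*=\det_{\mathbb{C}}(T_M,J)$. The unitary connections on $K^*$ form an affine space modelled on $i\,\Gamma(T_M^* )$. For the $Spin^{\mathbb{C}}$-structure induced by $J$, one identifies $\mathcal{W}^-=(T_M,J)$ and $\mathcal{W}^+=PSO^+(T_M)\subset\mathrm{Hom}(T_M,T_M)$, the rank-$4$ real bundle of fiber maps which, under an orientation-preserving isometry $T_M|_x\cong\mathbb{H}$ (oriented by $1,i,j,k$), are left multiplications by quaternions; complex structure $i\varphi=J\circ\varphi$; metric normalized by $g(\varphi v,\varphi w)=\|\varphi\|^2g(v,w)$. Clifford multiplication is $v\bullet\varphi=\varphi(v)$. Spinorial connections. In a U(2)-chart (local isometric orientation-preserving trivialization $T_M|_U\cong U\times\mathbb{H}$ in which $J$ is left multiplication by $i$; it also trivializes $K^*$ by the frame $1\wedge_{\mathbb{C}}j$), write $\nabla v=\partial v+\mathfrak{a}_+v-v\,\mathfrak{a}_-$ with $\mathfrak{a}_\pm$ $\mathrm{Im}\,\mathbb{H}$-valued $1$-forms, and a unitary connection $A$ on $K^*$ as $Az=\partial z+2i\alpha z$ with $\alpha$ a real $1$-form. Then $\widetilde\nabla^{A}w=\partial w+i\alpha w-w\,\mathfrak{a}_-$ is the induced connection on $\mathcal{W}^-=T_M$, and the induced connection on $\mathcal{W}^+$ is $(\overline\nabla^{A}_X\varphi)(Y)=\widetilde\nabla^{A}_X(\varphi Y)-\varphi(\nabla_XY)$. So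 $(\mathcal{B}^{A}\varphi)_XY=(\overline\nabla^{A}_X\varphi)(Y)$ is a section of $T_M^*\otimes T_M^*\otimes T_M$; $(\mathrm{Alt}\,\mathcal{B}^A\varphi)_XY=\frac12((\mathcal{B}^A\varphi)_XY-(\mathcal{B}^A\varphi)_YX)$, $(\mathrm{Sym}\,\mathcal{B}^A\varphi)_XY=\frac12((\mathcal{B}^A\varphi)_XY+(\mathcal{B}^A\varphi)_YX)$, and $\mathcal{D}^A\varphi=\sum_k e_k\bullet\overline\nabla^A_{e_k}\varphi=\sum_k(\mathcal{B}^A\varphi)_{e_k}e_k$ ($g$-orthonormal frame) is the Dirac operator. A minimum point is a unitary connection $A$ such that at every $x\in M$ the norm of the tensor at $x$ is minimal over all unitary connections on $K^*$; the norm on $T_M^*\otimes T_M^*\otimes T_M|_x$ comes from $\langle T_1,T_2\rangle=\sum_{j,k}g(T_1(e_j,e_k),T_2(e_j,e_k))$. *)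

theory Defs
  imports "HOL-Analysis.Analysis"
begin

section \<open>Smooth maps between Euclidean spaces\<close>

text \<open>\<open>Ck_on k S f\<close> is meant for open \<open>S\<close>: all iterated directional derivatives of order up to
  \<open>k\<close> exist and are continuous on \<open>S\<close>.\<close>

fun Ck_on :: "nat \<Rightarrow> 'a::real_normed_vector set \<Rightarrow> ('a \<Rightarrow> 'b::real_normed_vector) \<Rightarrow> bool" where
  "Ck_on 0 S f \<longleftrightarrow> continuous_on S f"
| "Ck_on (Suc k) S f \<longleftrightarrow> (\<forall>x\<in>S. f differentiable (at x)) \<and>
     (\<forall>v. Ck_on k S (\<lambda>x. frechet_derivative f (at x) v))"

definition smooth_on :: "'a::real_normed_vector set \<Rightarrow> ('a \<Rightarrow> 'b::real_normed_vector) \<Rightarrow> bool" where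
  "smooth_on S f \<longleftrightarrow> (\<forall>k. Ck_on k S f)"


section \<open>Closed oriented smooth 4-manifolds\<close>

text \<open>A chart is a pair of its domain and its coordinate map (whose values off the domain are
  irrelevant).\<close>

type_synonym 'a chart = "'a set \<times> ('a \<Rightarrow> real^4)"

definition chart_inv :: "'a chart \<Rightarrow> real^4 \<Rightarrow> 'a" where
  "chart_inv c = inv_into (fst c) (snd c)"

definition transition :: "'a chart \<Rightarrow> 'a chart \<Rightarrow> real^4 \<Rightarrow> real^4" where
  "transition c d = snd d \<circ> chart_inv c"

text \<open>The manifold is the whole type \<open>'a\<close> with its (Hausdorff) topology; second
  countability follows from compactness. The atlas need not be maximal. It carries the orientation:
  its transition maps have positive Jacobian determinant.\<close>

definition closed_oriented_4manifold :: "'a::t2_space chart set \<Rightarrow> bool" where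
  "closed_oriented_4manifold \<A> \<longleftrightarrow>
     compact (UNIV :: 'a set) \<and>
     (\<Union>c\<in>\<A>. fst c) = UNIV \<and>
     (\<forall>c\<in>\<A>. open (fst c) \<and> open (snd c ` fst c) \<and>
        homeomorphism (fst c) (snd c ` fst c) (snd c) (chart_inv c)) \<and>
     (\<forall>c\<in>\<A>. \<forall>d\<in>\<A>. smooth_on (snd c ` (fst c \<inter> fst d)) (transition c d)) \<and>
     (\<forall>c\<in>\<A>. \<forall>d\<in>\<A>. \<forall>p \<in> snd c ` (fst c \<inter> fst d).
        det (matrix (frechet_derivative (transition c d) (at p))) > 0)"

text \<open>Each point \<open>x\<close> gets a preferred chart of the atlas around it. A tangent vector at \<open>x\<close> is
  represented by its components in that chart, so every tangent space is \<open>real^4\<close>, positively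
  oriented by the standard basis. \<open>in_chart \<A> c x v\<close> are the components of the tangent vector
  \<open>v\<close> at \<open>x\<close> in another chart \<open>c\<close> around \<open>x\<close>.\<close>

definition chart_at :: "'a chart set \<Rightarrow> 'a \<Rightarrow> 'a chart" where
  "chart_at \<A> x = (SOME c. c \<in> \<A> \<and> x \<in> fst c)"

definition in_chart :: "'a chart set \<Rightarrow> 'a chart \<Rightarrow> 'a \<Rightarrow> real^4 \<Rightarrow> real^4" where
  "in_chart \<A> c x v =
     frechet_derivative (transition (chart_at \<A> x) c) (at (snd (chart_at \<A> x) x)) v"

text \<open>The derivative at \<open>x\<close> of a vector valued function along the tangent vector \<open>v\<close> at \<open>x\<close>.\<close>

definition dirderiv ::
  "'a chart set \<Rightarrow> ('a \<Rightarrow> 'b::real_normed_vector) \<Rightarrow> 'a \<Rightarrow> real^4 \<Rightarrow> 'b" where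
  "dirderiv \<A> f x v =
     frechet_derivative (f \<circ> chart_inv (chart_at \<A> x)) (at (snd (chart_at \<A> x) x)) v"

definition smooth_fun ::
  "'a::topological_space chart set \<Rightarrow> 'a set \<Rightarrow> ('a \<Rightarrow> 'b::real_normed_vector) \<Rightarrow> bool" where
  "smooth_fun \<A> U f \<longleftrightarrow> open U \<and>
     (\<forall>c\<in>\<A>. smooth_on (snd c ` (U \<inter> fst c)) (f \<circ> chart_inv c))"

type_synonym 'a vfield = "'a \<Rightarrow> real^4"

definition smooth_vf :: "'a::topological_space chart set \<Rightarrow> 'a set \<Rightarrow> 'a vfield \<Rightarrow> bool" where
  "smooth_vf \<A> U X \<longleftrightarrow> open U \<and>
     (\<forall>c\<in>\<A>. smooth_on (snd c ` (U \<inter> fst c))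
        ((\<lambda>y. in_chart \<A> c y (X y)) \<circ> chart_inv c))"

text \<open>Smoothness of a (locally defined) section in some neighbourhood of a point.\<close>

definition near :: "('a::topological_space set \<Rightarrow> bool) \<Rightarrow> 'a \<Rightarrow> bool" where
  "near P x \<longleftrightarrow> (\<exists>U. open U \<and> x \<in> U \<and> P U)"

text \<open>Tensor fields are smooth if they take smooth local sections to smooth local sections.\<close>

definition one_form :: "'a::topological_space chart set \<Rightarrow> ('a \<Rightarrow> real^4 \<Rightarrow> real) \<Rightarrow> bool" where
  "one_form \<A> \<xi> \<longleftrightarrow> (\<forall>x. linear (\<xi> x)) \<and>
     (\<forall>U X. smooth_vf \<A> U X \<longrightarrow> smooth_fun \<A> U (\<lambda>x. \<xi> x (X x)))"

definition endo_field ::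
  "'a::topological_space chart set \<Rightarrow> ('a \<Rightarrow> real^4 \<Rightarrow> real^4) \<Rightarrow> bool" where
  "endo_field \<A> F \<longleftrightarrow> (\<forall>x. linear (F x)) \<and>
     (\<forall>U X. smooth_vf \<A> U X \<longrightarrow> smooth_vf \<A> U (\<lambda>x. F x (X x)))"

type_synonym 'a metric = "'a \<Rightarrow> real^4 \<Rightarrow> real^4 \<Rightarrow> real"

definition riemannian_metric :: "'a::topological_space chart set \<Rightarrow> 'a metric \<Rightarrow> bool" where
  "riemannian_metric \<A> g \<longleftrightarrow>
     (\<forall>x. bilinear (g x) \<and> (\<forall>v w. g x v w = g x w v) \<and> (\<forall>v. v \<noteq> 0 \<longrightarrow> g x v v > 0)) \<and>
     (\<forall>U X Y. smooth_vf \<A> U X \<and> smooth_vf \<A> U Y \<longrightarrow> smooth_fun \<A> U (\<lambda>x. g x (X x) (Y x)))"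

type_synonym 'a acs = "'a \<Rightarrow> real^4 \<Rightarrow> real^4"

definition almost_complex_structure :: "'a::topological_space chart set \<Rightarrow> 'a acs \<Rightarrow> bool" where
  "almost_complex_structure \<A> J \<longleftrightarrow> endo_field \<A> J \<and> (\<forall>x v. J x (J x v) = - v)"

text \<open>Orthogonality, and positivity of every basis of the form \<open>(v, J v, w, J w)\<close>.\<close>

definition compatible :: "'a metric \<Rightarrow> 'a acs \<Rightarrow> bool" where
  "compatible g J \<longleftrightarrow>
     (\<forall>x v w. g x (J x v) (J x w) = g x v w) \<and>
     (\<forall>x v w. let d = det (vector [v, J x v, w, J x w] :: real^4^4) in d \<noteq> 0 \<longrightarrow> d > 0)"


section \<open>The Levi-Civita connection\<close>

text \<open>A connection acts on local smooth sections: \<open>D x v Y\<close> is the covariant derivative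
  at \<open>x\<close>, along \<open>v\<close>, of a vector field \<open>Y\<close> that is smooth near \<open>x\<close>. The Leibniz rule for functions
  that are smooth near \<open>x\<close> (e.g. indicator functions of neighbourhoods of \<open>x\<close>) makes this depend on
  the germ of \<open>Y\<close> only.\<close>

type_synonym 'a tconn = "'a \<Rightarrow> real^4 \<Rightarrow> 'a vfield \<Rightarrow> real^4"

definition affine_connection :: "'a::topological_space chart set \<Rightarrow> 'a tconn \<Rightarrow> bool" where
  "affine_connection \<A> D \<longleftrightarrow>
     (\<forall>x Y. near (\<lambda>U. smooth_vf \<A> U Y) x \<longrightarrow> linear (\<lambda>v. D x v Y)) \<and>
     (\<forall>x v Y Z. near (\<lambda>U. smooth_vf \<A> U Y) x \<and> near (\<lambda>U. smooth_vf \<A> U Z) x \<longrightarrow>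
        D x v (\<lambda>y. Y y + Z y) = D x v Y + D x v Z) \<and>
     (\<forall>x v f Y. near (\<lambda>U. smooth_fun \<A> U f) x \<and> near (\<lambda>U. smooth_vf \<A> U Y) x \<longrightarrow>
        D x v (\<lambda>y. f y *\<^sub>R Y y) = dirderiv \<A> f x v *\<^sub>R Y x + f x *\<^sub>R D x v Y) \<and>
     (\<forall>U X Y. smooth_vf \<A> U X \<and> smooth_vf \<A> U Y \<longrightarrow> smooth_vf \<A> U (\<lambda>x. D x (X x) Y))"

definition torsion_free :: "'a::topological_space chart set \<Rightarrow> 'a tconn \<Rightarrow> bool" where
  "torsion_free \<A> D \<longleftrightarrow>
     (\<forall>x X Y. \<forall>f::'a \<Rightarrow> real. near (\<lambda>U. smooth_vf \<A> U X) x \<and> near (\<lambda>U. smooth_vf \<A> U Y) x \<and>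
        near (\<lambda>U. smooth_fun \<A> U f) x \<longrightarrow>
        dirderiv \<A> f x (D x (X x) Y - D x (Y x) X) =
          dirderiv \<A> (\<lambda>y. dirderiv \<A> f y (Y y)) x (X x) -
          dirderiv \<A> (\<lambda>y. dirderiv \<A> f y (X y)) x (Y x))"

definition metric_connection ::
  "'a::topological_space chart set \<Rightarrow> 'a metric \<Rightarrow> 'a tconn \<Rightarrow> bool" where
  "metric_connection \<A> g D \<longleftrightarrow>
     (\<forall>x v Y Z. near (\<lambda>U. smooth_vf \<A> U Y) x \<and> near (\<lambda>U. smooth_vf \<A> U Z) x \<longrightarrow>
        dirderiv \<A> (\<lambda>y. g y (Y y) (Z y)) x v = g x (D x v Y) (Z x) + g x (Y x) (D x v Z))"

definition levi_civita :: "'a::topological_space chart set \<Rightarrow> 'a metric \<Rightarrow> 'a tconn \<Rightarrow> bool" where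
  "levi_civita \<A> g D \<longleftrightarrow>
     affine_connection \<A> D \<and> torsion_free \<A> D \<and> metric_connection \<A> g D"


section \<open>Quaternions\<close>

text \<open>The quaternion \<open>a + b i + c j + d k\<close> is \<open>vector [a, b, c, d]\<close>; its inner product and
  orientation (by \<open>1, i, j, k\<close>) are the standard ones of \<open>real^4\<close>.\<close>

type_synonym quat = "real^4"

definition q1 :: quat where "q1 = vector [1, 0, 0, 0]"
definition qi :: quat where "qi = vector [0, 1, 0, 0]"
definition qj :: quat where "qj = vector [0, 0, 1, 0]"

definition qmul :: "quat \<Rightarrow> quat \<Rightarrow> quat" (infixl \<open>\<odot>\<close> 70) where
  "p \<odot> q = vector
    [p$1 * q$1 - p$2 * q$2 - p$3 * q$3 - p$4 * q$4,
     p$1 * q$2 + p$2 * q$1 + p$3 * q$4 - p$4 * q$3,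
     p$1 * q$3 - p$2 * q$4 + p$3 * q$1 + p$4 * q$2,
     p$1 * q$4 + p$2 * q$3 - p$3 * q$2 + p$4 * q$1]"

definition ImH :: "quat set" where "ImH = {q. q $ 1 = 0}"

definition oriented_isometry :: "(real^4 \<Rightarrow> real^4 \<Rightarrow> real) \<Rightarrow> (real^4 \<Rightarrow> quat) \<Rightarrow> bool" where
  "oriented_isometry gx L \<longleftrightarrow> linear L \<and> (\<forall>v w. L v \<bullet> L w = gx v w) \<and> det (matrix L) > 0"

text \<open>The fiber of \<open>PSO\<^sup>+(T\<^sub>M)\<close>. The choice of \<open>L\<close> is immaterial.\<close>

definition Wplus :: "(real^4 \<Rightarrow> real^4 \<Rightarrow> real) \<Rightarrow> (real^4 \<Rightarrow> real^4) set" where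
  "Wplus gx = {\<phi>. \<exists>L p. oriented_isometry gx L \<and> (\<forall>v. L (\<phi> v) = p \<odot> L v)}"

definition selfdual_spinor_field ::
  "'a::topological_space chart set \<Rightarrow> 'a metric \<Rightarrow> ('a \<Rightarrow> real^4 \<Rightarrow> real^4) \<Rightarrow> bool" where
  "selfdual_spinor_field \<A> g \<phi> \<longleftrightarrow> endo_field \<A> \<phi> \<and> (\<forall>x. \<phi> x \<in> Wplus (g x))"


section \<open>The determinant line bundle and its unitary connections\<close>

text \<open>For a complex structure \<open>j\<close> on \<open>real^4\<close>, \<open>K_fiber j\<close> is the complex line of alternating
  \<open>j\<close>-complex-bilinear forms. The second complex exterior power of \<open>(real^4, j)\<close> is taken to be the
  complex dual of \<open>K_fiber j\<close>, whose elements are extended by \<open>0\<close> outside \<open>K_fiber j\<close>.\<close>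

type_synonym cform = "real^4 \<Rightarrow> real^4 \<Rightarrow> complex"
type_synonym cbivector = "cform \<Rightarrow> complex"

definition K_fiber :: "(real^4 \<Rightarrow> real^4) \<Rightarrow> cform set" where
  "K_fiber j = {\<omega>. bilinear \<omega> \<and> (\<forall>v. \<omega> v v = 0) \<and>
     (\<forall>v w. \<omega> (j v) w = \<i> * \<omega> v w \<and> \<omega> v (j w) = \<i> * \<omega> v w)}"

definition Kstar_fiber :: "(real^4 \<Rightarrow> real^4) \<Rightarrow> cbivector set" where
  "Kstar_fiber j = {z. (\<forall>\<omega>\<in>K_fiber j. \<forall>\<eta>\<in>K_fiber j. \<forall>a b.
       z (\<lambda>v w. a * \<omega> v w + b * \<eta> v w) = a * z \<omega> + b * z \<eta>) \<and>
     (\<forall>\<omega>. \<omega> \<notin> K_fiber j \<longrightarrow> z \<omega> = 0)}"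

definition cwedge :: "(real^4 \<Rightarrow> real^4) \<Rightarrow> real^4 \<Rightarrow> real^4 \<Rightarrow> cbivector" where
  "cwedge j v w = (\<lambda>\<omega>. if \<omega> \<in> K_fiber j then \<omega> v w else 0)"

text \<open>The Hermitian metric of \<open>(T\<^sub>M, J, g)\<close>, complex linear in the first argument, and the induced
  one on the determinant line, where every element is decomposable.\<close>

definition herm :: "(real^4 \<Rightarrow> real^4 \<Rightarrow> real) \<Rightarrow> (real^4 \<Rightarrow> real^4) \<Rightarrow> real^4 \<Rightarrow> real^4 \<Rightarrow> complex" where
  "herm gx j v w = Complex (gx v w) (- gx (j v) w)"

definition Kstar_herm ::
  "(real^4 \<Rightarrow> real^4 \<Rightarrow> real) \<Rightarrow> (real^4 \<Rightarrow> real^4) \<Rightarrow> cbivector \<Rightarrow> cbivector \<Rightarrow> complex" where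
  "Kstar_herm gx j z z' = (THE c. \<exists>v1 v2 w1 w2. z = cwedge j v1 v2 \<and> z' = cwedge j w1 w2 \<and>
     c = herm gx j v1 w1 * herm gx j v2 w2 - herm gx j v1 w2 * herm gx j v2 w1)"

definition smooth_Kform ::
  "'a::topological_space chart set \<Rightarrow> 'a acs \<Rightarrow> 'a set \<Rightarrow> ('a \<Rightarrow> cform) \<Rightarrow> bool" where
  "smooth_Kform \<A> J U \<omega> \<longleftrightarrow> open U \<and> (\<forall>x\<in>U. \<omega> x \<in> K_fiber (J x)) \<and>
     (\<forall>V X Y. V \<subseteq> U \<and> smooth_vf \<A> V X \<and> smooth_vf \<A> V Y \<longrightarrow>
        smooth_fun \<A> V (\<lambda>x. \<omega> x (X x) (Y x)))"

definition smooth_Ksec ::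
  "'a::topological_space chart set \<Rightarrow> 'a acs \<Rightarrow> 'a set \<Rightarrow> ('a \<Rightarrow> cbivector) \<Rightarrow> bool" where
  "smooth_Ksec \<A> J U s \<longleftrightarrow> open U \<and> (\<forall>x\<in>U. s x \<in> Kstar_fiber (J x)) \<and>
     (\<forall>V \<omega>. V \<subseteq> U \<and> smooth_Kform \<A> J V \<omega> \<longrightarrow> smooth_fun \<A> V (\<lambda>x. s x (\<omega> x)))"

text \<open>As for \<open>tconn\<close>, a connection differentiates sections that are smooth near the point. The last
  clause fixes its value on all other sections, so that equality of connections is equality in
  HOL.\<close>

type_synonym 'a kconn = "'a \<Rightarrow> real^4 \<Rightarrow> ('a \<Rightarrow> cbivector) \<Rightarrow> cbivector"

definition unitary_connection ::
  "'a::topological_space chart set \<Rightarrow> 'a metric \<Rightarrow> 'a acs \<Rightarrow> 'a kconn \<Rightarrow> bool" where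
  "unitary_connection \<A> g J A \<longleftrightarrow>
     (\<forall>x s. near (\<lambda>U. smooth_Ksec \<A> J U s) x \<longrightarrow>
        (\<forall>v. A x v s \<in> Kstar_fiber (J x)) \<and> (\<forall>\<omega>. linear (\<lambda>v. A x v s \<omega>))) \<and>
     (\<forall>x v s t. near (\<lambda>U. smooth_Ksec \<A> J U s) x \<and> near (\<lambda>U. smooth_Ksec \<A> J U t) x \<longrightarrow>
        A x v (\<lambda>y \<omega>. s y \<omega> + t y \<omega>) = (\<lambda>\<omega>. A x v s \<omega> + A x v t \<omega>)) \<and>
     (\<forall>x v s. \<forall>f::'a \<Rightarrow> complex.
        near (\<lambda>U. smooth_fun \<A> U f) x \<and> near (\<lambda>U. smooth_Ksec \<A> J U s) x \<longrightarrow>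
        A x v (\<lambda>y \<omega>. f y * s y \<omega>) = (\<lambda>\<omega>. dirderiv \<A> f x v * s x \<omega> + f x * A x v s \<omega>)) \<and>
     (\<forall>U X s. smooth_vf \<A> U X \<and> smooth_Ksec \<A> J U s \<longrightarrow>
        smooth_Ksec \<A> J U (\<lambda>x. A x (X x) s)) \<and>
     (\<forall>x v s t. near (\<lambda>U. smooth_Ksec \<A> J U s) x \<and> near (\<lambda>U. smooth_Ksec \<A> J U t) x \<longrightarrow>
        dirderiv \<A> (\<lambda>y. Kstar_herm (g y) (J y) (s y) (t y)) x v =
          Kstar_herm (g x) (J x) (A x v s) (t x) + Kstar_herm (g x) (J x) (s x) (A x v t)) \<and>
     (\<forall>x v s. \<not> near (\<lambda>U. smooth_Ksec \<A> J U s) x \<longrightarrow> A x v s = undefined)"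

text \<open>The affine action of \<open>i \<Gamma>(T\<^sub>M\<^sup>*)\<close>: the connection \<open>A + i \<beta>\<close>.\<close>

definition add_i ::
  "'a::topological_space chart set \<Rightarrow> 'a acs \<Rightarrow> 'a kconn \<Rightarrow> ('a \<Rightarrow> real^4 \<Rightarrow> real) \<Rightarrow> 'a kconn" where
  "add_i \<A> J A \<beta> = (\<lambda>x v s. if near (\<lambda>U. smooth_Ksec \<A> J U s) x
     then (\<lambda>\<omega>. A x v s \<omega> + \<i> * complex_of_real (\<beta> x v) * s x \<omega>) else undefined)"

definition is_affine_line ::
  "'a::topological_space chart set \<Rightarrow> 'a metric \<Rightarrow> 'a acs \<Rightarrow> 'a kconn set \<Rightarrow> bool" where
  "is_affine_line \<A> g J \<L> \<longleftrightarrow> (\<exists>B \<eta>. unitary_connection \<A> g J B \<and> one_form \<A> \<eta> \<and>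
     (\<exists>x v. \<eta> x v \<noteq> 0) \<and> \<L> = range (\<lambda>t::real. add_i \<A> J B (\<lambda>x v. t * \<eta> x v)))"


section \<open>Spinorial connections\<close>

definition U2_chart ::
  "'a::topological_space chart set \<Rightarrow> 'a metric \<Rightarrow> 'a acs \<Rightarrow> 'a set \<Rightarrow> ('a \<Rightarrow> real^4 \<Rightarrow> quat) \<Rightarrow> bool" where
  "U2_chart \<A> g J U E \<longleftrightarrow> open U \<and>
     (\<forall>x\<in>U. oriented_isometry (g x) (E x) \<and> (\<forall>v. E x (J x v) = qi \<odot> E x v)) \<and>
     (\<forall>V X. V \<subseteq> U \<and> smooth_vf \<A> V X \<longrightarrow> smooth_fun \<A> V (\<lambda>x. E x (X x)))"

text \<open>\<open>\<nabla>v = \<partial>v + a\<^sub>+ v - v a\<^sub>-\<close> in the U(2)-chart.\<close>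

definition LC_forms ::
  "'a::topological_space chart set \<Rightarrow> 'a tconn \<Rightarrow> 'a set \<Rightarrow> ('a \<Rightarrow> real^4 \<Rightarrow> quat) \<Rightarrow>
     ('a \<Rightarrow> real^4 \<Rightarrow> quat) \<Rightarrow> ('a \<Rightarrow> real^4 \<Rightarrow> quat) \<Rightarrow> bool" where
  "LC_forms \<A> D U E ap am \<longleftrightarrow>
     (\<forall>x\<in>U. \<forall>u. ap x u \<in> ImH \<and> am x u \<in> ImH \<and>
       (\<forall>Y. near (\<lambda>V. smooth_vf \<A> V Y) x \<longrightarrow>
         E x (D x u Y) = dirderiv \<A> (\<lambda>y. E y (Y y)) x u + ap x u \<odot> E x (Y x) - E x (Y x) \<odot> am x u))"

text \<open>\<open>Az = \<partial>z + 2 i \<alpha> z\<close> with respect to the frame \<open>1 \<and> j\<close> of the determinant line.\<close>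

definition K_frame :: "'a acs \<Rightarrow> ('a \<Rightarrow> real^4 \<Rightarrow> quat) \<Rightarrow> 'a \<Rightarrow> cbivector" where
  "K_frame J E x = cwedge (J x) (inv (E x) q1) (inv (E x) qj)"

definition K_form ::
  "'a::topological_space chart set \<Rightarrow> 'a acs \<Rightarrow> 'a kconn \<Rightarrow> 'a set \<Rightarrow> ('a \<Rightarrow> real^4 \<Rightarrow> quat) \<Rightarrow>
     ('a \<Rightarrow> real^4 \<Rightarrow> real) \<Rightarrow> bool" where
  "K_form \<A> J A U E \<alpha> \<longleftrightarrow>
     (\<forall>x\<in>U. \<forall>u. \<forall>z::'a \<Rightarrow> complex. near (\<lambda>V. smooth_fun \<A> V z) x \<longrightarrow>
       A x u (\<lambda>y \<omega>. z y * K_frame J E y \<omega>) =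
         (\<lambda>\<omega>. (dirderiv \<A> z x u + 2 * \<i> * complex_of_real (\<alpha> x u) * z x) * K_frame J E x \<omega>))"

text \<open>The connection \<open>\<partial>w + i \<alpha> w - w a\<^sub>-\<close> on \<open>W\<^sup>-\<close>, computed in any U(2)-chart around \<open>x\<close>.\<close>

definition nabla_minus ::
  "'a::topological_space chart set \<Rightarrow> 'a metric \<Rightarrow> 'a acs \<Rightarrow> 'a tconn \<Rightarrow> 'a kconn \<Rightarrow>
     'a \<Rightarrow> real^4 \<Rightarrow> 'a vfield \<Rightarrow> real^4" where
  "nabla_minus \<A> g J D A x u Y = (THE w. \<exists>U E ap am \<alpha>.
     U2_chart \<A> g J U E \<and> x \<in> U \<and> LC_forms \<A> D U E ap am \<and> K_form \<A> J A U E \<alpha> \<and>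
     E x w = dirderiv \<A> (\<lambda>y. E y (Y y)) x u + (\<alpha> x u *\<^sub>R qi) \<odot> E x (Y x) - E x (Y x) \<odot> am x u)"

text \<open>The connection on \<open>W\<^sup>+\<close>: its value on a tangent vector \<open>v\<close> at \<open>x\<close> is computed with any
  smooth extension \<open>Y\<close> of \<open>v\<close>.\<close>

definition nabla_plus ::
  "'a::topological_space chart set \<Rightarrow> 'a metric \<Rightarrow> 'a acs \<Rightarrow> 'a tconn \<Rightarrow> 'a kconn \<Rightarrow>
     'a \<Rightarrow> real^4 \<Rightarrow> ('a \<Rightarrow> real^4 \<Rightarrow> real^4) \<Rightarrow> real^4 \<Rightarrow> real^4" where
  "nabla_plus \<A> g J D A x u \<phi> v = (THE w. \<exists>Y. near (\<lambda>U. smooth_vf \<A> U Y) x \<and> Y x = v \<and>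
     w = nabla_minus \<A> g J D A x u (\<lambda>y. \<phi> y (Y y)) - \<phi> x (D x u Y))"

definition clifford :: "real^4 \<Rightarrow> (real^4 \<Rightarrow> real^4) \<Rightarrow> real^4" (infixr \<open>\<bullet>\<^sub>c\<close> 70) where
  "v \<bullet>\<^sub>c \<phi> = \<phi> v"

type_synonym tensor = "real^4 \<Rightarrow> real^4 \<Rightarrow> real^4"

definition spinB ::
  "'a::topological_space chart set \<Rightarrow> 'a metric \<Rightarrow> 'a acs \<Rightarrow> 'a tconn \<Rightarrow>
     ('a \<Rightarrow> real^4 \<Rightarrow> real^4) \<Rightarrow> 'a kconn \<Rightarrow> 'a \<Rightarrow> tensor" where
  "spinB \<A> g J D \<phi> A x = (\<lambda>u v. v \<bullet>\<^sub>c nabla_plus \<A> g J D A x u \<phi>)"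

definition Sym :: "tensor \<Rightarrow> tensor" where
  "Sym T = (\<lambda>u v. (1/2) *\<^sub>R (T u v + T v u))"

definition Alt :: "tensor \<Rightarrow> tensor" where
  "Alt T = (\<lambda>u v. (1/2) *\<^sub>R (T u v - T v u))"

text \<open>Some orthonormal frame at a point; the quantities below do not depend on it.\<close>

definition onframe :: "(real^4 \<Rightarrow> real^4 \<Rightarrow> real) \<Rightarrow> 4 \<Rightarrow> real^4" where
  "onframe gx = (SOME e. \<forall>j k. gx (e j) (e k) = (if j = k then 1 else 0))"

definition tensor_norm :: "(real^4 \<Rightarrow> real^4 \<Rightarrow> real) \<Rightarrow> tensor \<Rightarrow> real" where
  "tensor_norm gx T = (let e = onframe gx in
     sqrt (\<Sum>j\<in>UNIV. \<Sum>k\<in>UNIV. gx (T (e j) (e k)) (T (e j) (e k))))"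

definition tensor_tr :: "(real^4 \<Rightarrow> real^4 \<Rightarrow> real) \<Rightarrow> tensor \<Rightarrow> real^4" where
  "tensor_tr gx T = (let e = onframe gx in \<Sum>k\<in>UNIV. T (e k) (e k))"

definition dirac ::
  "'a::topological_space chart set \<Rightarrow> 'a metric \<Rightarrow> 'a acs \<Rightarrow> 'a tconn \<Rightarrow>
     ('a \<Rightarrow> real^4 \<Rightarrow> real^4) \<Rightarrow> 'a kconn \<Rightarrow> 'a \<Rightarrow> real^4" where
  "dirac \<A> g J D \<phi> A x = tensor_tr (g x) (spinB \<A> g J D \<phi> A x)"


section \<open>Minimum points and vanishing points\<close>

definition minimum_point ::
  "'a::topological_space chart set \<Rightarrow> 'a metric \<Rightarrow> 'a acs \<Rightarrow> ('a kconn \<Rightarrow> 'a \<Rightarrow> tensor) \<Rightarrow>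
     'a kconn \<Rightarrow> bool" where
  "minimum_point \<A> g J T A \<longleftrightarrow> unitary_connection \<A> g J A \<and>
     (\<forall>x A'. unitary_connection \<A> g J A' \<longrightarrow>
        tensor_norm (g x) (T A x) \<le> tensor_norm (g x) (T A' x))"

definition vanishing_point ::
  "'a::topological_space chart set \<Rightarrow> 'a metric \<Rightarrow> 'a acs \<Rightarrow> ('a kconn \<Rightarrow> 'a vfield) \<Rightarrow>
     'a kconn \<Rightarrow> bool" where
  "vanishing_point \<A> g J F A \<longleftrightarrow> unitary_connection \<A> g J A \<and> (\<forall>x. F A x = 0)"

definition is_unique :: "('b \<Rightarrow> bool) \<Rightarrow> 'b \<Rightarrow> bool" where
  "is_unique P a \<longleftrightarrow> P a \<and> (\<forall>b. P b \<longrightarrow> b = a)"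

end

theory Submission
  imports Defs "HOL-Real_Asymp.Real_Asymp"
begin

text \<open>The unitary connections are compared at a point, but the objects to be minimized are
  described through arbitrary U(2)-charts, arbitrary connection forms and arbitrary extensions of
  tangent vectors. The remedy is a chart-free formula: the induced connection on the negative
  spinors is the part of the Levi-Civita connection that commutes with \<open>J\<close>, plus a real
  multiple of \<open>J\<close> that measures how far \<open>A\<close> is from a base connection on
  the determinant line. Every description turns out to compute this expression.

  The determinant line sees the scalar \<open>i \<alpha>\<close> twice, once for each factor of a
  wedge, and this is where the factor 2 between \<open>A\<close> and \<open>t\<close> originates.

  The second issue is global. A pointwise minimizer must come from a smooth connection. The
  one-forms \<open>t\<close> of the candidates are therefore written as quotients of inner products
  whose values do not depend on the test vector or the orthonormal frame, so that they can be
  evaluated in smooth local frames. Each candidate is then a single connection that is optimal at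
  all points at once, and uniqueness follows by comparing any rival with it.\<close>

text \<open>In a U(2)-chart \<open>\<phi>\<close> is left multiplication by a quaternion function \<open>p\<close>, and \<open>\<B>\<^sup>A\<^sub>X \<phi>\<close> is left multiplication
  by \<open>b(X) + t(X) i p\<close>, where \<open>b\<close> does not depend on \<open>A\<close> and the real 1-form \<open>t\<close> parametrizes the unitary
  connections. Normalize \<open>b\<close> to be pointwise orthogonal to \<open>n = i p\<close>. Since
  \<open>\<langle>n r, b s\<rangle> + \<langle>n s, b r\<rangle> = 2 \<langle>n, b\<rangle> \<langle>r, s\<rangle>\<close>, the mixed terms of the squared norms of the symmetric and
  antisymmetric parts involve \<open>b\<close> only through \<open>\<Sum>\<^sub>k b(e\<^sub>k) e\<^sub>k\<close>, that is through the Dirac operator. With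
  \<open>\<sigma>(v) = - \<langle>n v, \<Sum>\<^sub>k b(e\<^sub>k) e\<^sub>k\<rangle> / |n|\<^sup>2\<close> the squared norms are, up to additive constants,
  \<open>4 |n|\<^sup>2 |t|\<^sup>2\<close>, \<open>5/2 |n|\<^sup>2 |t + \<sigma>/5|\<^sup>2\<close> and \<open>3/2 |n|\<^sup>2 |t - \<sigma>/3|\<^sup>2\<close>, and the Dirac operator vanishes iff
  \<open>t = \<sigma>\<close>. As \<open>A\<close> moves by \<open>2 i t\<close>, this gives \<open>\<xi> = 2 \<sigma> / 15\<close>.\<close>

section \<open>Calculus of smooth maps\<close>

lemma Ck_on_mono: "Ck_on k S f \<Longrightarrow> T \<subseteq> S \<Longrightarrow> Ck_on k T f"
proof (induction k arbitrary: f)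
  case 0
  then show ?case by (auto intro: continuous_on_subset)
next
  case (Suc k)
  then show ?case by (auto simp: subset_iff)
qed

text \<open>No differentiability is assumed: both functions have the same set of derivatives at the
  point, so the choice operator behind \<open>frechet_derivative\<close> returns the same
  map.\<close>

lemma frechet_derivative_cong_open:
  assumes "open S" "x \<in> S" "\<And>y. y \<in> S \<Longrightarrow> f y = g y"
  shows "frechet_derivative f (at x) = frechet_derivative g (at x)"
proof -
  have "(f has_derivative f') (at x) \<longleftrightarrow> (g has_derivative f') (at x)" for f'
    using has_derivative_transform_within_open[of f f' x UNIV S g]
      has_derivative_transform_within_open[of g f' x UNIV S f] assms by (auto simp: eq_commute)
  then show ?thesis unfolding frechet_derivative_def by simp
qed

lemma differentiable_cong_open:
  assumes "open S" "x \<in> S" "\<And>y. y \<in> S \<Longrightarrow> f y = g y"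
  shows "f differentiable (at x) \<longleftrightarrow> g differentiable (at x)"
proof -
  have "(f has_derivative f') (at x) \<longleftrightarrow> (g has_derivative f') (at x)" for f'
    using has_derivative_transform_within_open[of f f' x UNIV S g]
      has_derivative_transform_within_open[of g f' x UNIV S f] assms by (auto simp: eq_commute)
  then show ?thesis unfolding differentiable_def by simp
qed

lemma Ck_on_cong_imp:
  assumes "open S" "\<And>y. y \<in> S \<Longrightarrow> f y = g y" "Ck_on k S f"
  shows "Ck_on k S g"
  using assms(2,3)
proof (induction k arbitrary: f g)
  case 0
  then show ?case by (auto cong: continuous_on_cong_simp)
next
  case (Suc k)
  have "Ck_on k S (\<lambda>x. frechet_derivative g (at x) v)" for v
  proof (rule Suc.IH)
    show "Ck_on k S (\<lambda>x. frechet_derivative f (at x) v)" using Suc by auto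
    show "frechet_derivative f (at y) v = frechet_derivative g (at y) v" if "y \<in> S" for y
      using frechet_derivative_cong_open[OF assms(1) that, of f g] Suc by auto
  qed
  moreover have "g differentiable (at x)" if "x \<in> S" for x
    using differentiable_cong_open[OF assms(1) that, of f g] Suc that by auto
  ultimately show ?case by auto
qed

lemma Ck_on_cong:
  assumes "open S" "\<And>y. y \<in> S \<Longrightarrow> f y = g y"
  shows "Ck_on k S f \<longleftrightarrow> Ck_on k S g"
  using Ck_on_cong_imp[OF assms(1), of f g] Ck_on_cong_imp[OF assms(1), of g f] assms(2) by auto

lemma Ck_on_local:
  assumes "\<And>x. x \<in> S \<Longrightarrow> \<exists>T. open T \<and> x \<in> T \<and> Ck_on k T f"
  shows "Ck_on k S f"
  using assms
proof (induction k arbitrary: f)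
  case 0
  have "isCont f x" if x: "x \<in> S" for x
  proof -
    obtain T where "open T" "x \<in> T" "continuous_on T f" using 0 x by auto
    then show ?thesis by (simp add: continuous_on_eq_continuous_at)
  qed
  then show ?case by (simp add: continuous_at_imp_continuous_on)
next
  case (Suc k)
  have "Ck_on k S (\<lambda>x. frechet_derivative f (at x) v)" for v
    by (rule Suc.IH) (use Suc.prems in fastforce)
  then show ?case using Suc.prems by fastforce
qed

lemma Ck_on_differentiable: "Ck_on (Suc k) S f \<Longrightarrow> x \<in> S \<Longrightarrow> f differentiable (at x)"
  by simp

text \<open>The recursion for \<open>Suc k\<close> speaks of derivatives only and does not literally
  contain order \<open>k\<close>; the base case is that differentiability implies
  continuity.\<close>

lemma Ck_on_decr: "open S \<Longrightarrow> Ck_on (Suc k) S f \<Longrightarrow> Ck_on k S f"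
proof (induction k arbitrary: f)
  case 0
  then have "isCont f x" if "x \<in> S" for x
    using that by (auto intro: differentiable_imp_continuous_within)
  then show ?case by (simp add: continuous_at_imp_continuous_on)
next
  case (Suc k)
  then show ?case
    by (metis Ck_on.simps(2))
qed

lemma Ck_on_const: "Ck_on k S (\<lambda>x. c)"
  by (induction k arbitrary: c) (auto simp: continuous_on_const)

lemma frechet_derivative_eqI: "(f has_derivative f') (at x) \<Longrightarrow> frechet_derivative f (at x) = f'"
  using frechet_derivative_at by fastforce

lemma has_frechet: "f differentiable (at x) \<Longrightarrow> (f has_derivative frechet_derivative f (at x)) (at x)"
  by (simp add: frechet_derivative_works)

lemma Ck_on_blinear: "bounded_linear L \<Longrightarrow> open S \<Longrightarrow> Ck_on k S f \<Longrightarrow> Ck_on k S (\<lambda>x. L (f x))"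
proof (induction k arbitrary: f)
  case 0
  then show ?case by (auto intro: bounded_linear.continuous_on)
next
  case (Suc k)
  have d: "((\<lambda>x. L (f x)) has_derivative (\<lambda>v. L (frechet_derivative f (at x) v))) (at x)" if "x \<in> S" for x
    by (rule bounded_linear.has_derivative[OF Suc(2)]) (use Suc.prems that in \<open>auto intro: has_frechet\<close>)
  have "Ck_on k S (\<lambda>x. frechet_derivative (\<lambda>x. L (f x)) (at x) v)" for v
    by (rule Ck_on_cong_imp[OF \<open>open S\<close> _ Suc.IH, of "\<lambda>x. frechet_derivative f (at x) v"])
      (use Suc.prems frechet_derivative_eqI[OF d] in auto)
  moreover have "(\<lambda>x. L (f x)) differentiable (at x)" if "x \<in> S" for x
    using d[OF that] differentiable_def by blast
  ultimately show ?case by simp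
qed

lemma Ck_on_add: "open S \<Longrightarrow> Ck_on k S f \<Longrightarrow> Ck_on k S g \<Longrightarrow> Ck_on k S (\<lambda>x. f x + g x)"
proof (induction k arbitrary: f g)
  case 0
  then show ?case by (auto intro: continuous_on_add)
next
  case (Suc k)
  have d: "((\<lambda>x. f x + g x) has_derivative
    (\<lambda>v. frechet_derivative f (at x) v + frechet_derivative g (at x) v)) (at x)" if "x \<in> S" for x
    by (rule has_derivative_add) (use Suc.prems that in \<open>auto intro: has_frechet\<close>)
  have "Ck_on k S (\<lambda>x. frechet_derivative (\<lambda>x. f x + g x) (at x) v)" for v
    by (rule Ck_on_cong_imp[OF \<open>open S\<close> _ Suc.IH, of "\<lambda>x. frechet_derivative f (at x) v"
        "\<lambda>x. frechet_derivative g (at x) v"])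
      (use Suc.prems frechet_derivative_eqI[OF d] in auto)
  moreover have "(\<lambda>x. f x + g x) differentiable (at x)" if "x \<in> S" for x
    using d[OF that] differentiable_def by blast
  ultimately show ?case by simp
qed

lemma Ck_on_sum: "open S \<Longrightarrow> (\<And>i. i \<in> I \<Longrightarrow> Ck_on k S (f i)) \<Longrightarrow> Ck_on k S (\<lambda>x. \<Sum>i\<in>I. f i x)"
  by (induction I rule: infinite_finite_induct) (auto intro: Ck_on_const Ck_on_add)

lemma Ck_on_bilinear:
  "bounded_bilinear p \<Longrightarrow> open S \<Longrightarrow> Ck_on k S f \<Longrightarrow> Ck_on k S g \<Longrightarrow> Ck_on k S (\<lambda>x. p (f x) (g x))"
proof (induction k arbitrary: f g)
  case 0
  then show ?case by (auto intro: bounded_bilinear.continuous_on)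
next
  case (Suc k)
  have d: "((\<lambda>x. p (f x) (g x)) has_derivative
    (\<lambda>v. p (f x) (frechet_derivative g (at x) v) + p (frechet_derivative f (at x) v) (g x))) (at x)" if "x \<in> S" for x
    by (rule bounded_bilinear.FDERIV[OF Suc(2)]) (use Suc.prems that in \<open>auto intro: has_frechet\<close>)
  have "Ck_on k S (\<lambda>x. frechet_derivative (\<lambda>x. p (f x) (g x)) (at x) v)" for v
  proof (rule Ck_on_cong_imp[OF \<open>open S\<close>])
    show "Ck_on k S (\<lambda>x. p (f x) (frechet_derivative g (at x) v) + p (frechet_derivative f (at x) v) (g x))"
      by (intro Ck_on_add Suc.IH) (use Suc.prems Ck_on_decr in auto)
  qed (use frechet_derivative_eqI[OF d] in auto)
  moreover have "(\<lambda>x. p (f x) (g x)) differentiable (at x)" if "x \<in> S" for x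
    using d[OF that] differentiable_def by blast
  ultimately show ?case by simp
qed

text \<open>In the chain rule the derivative of \<open>g\<close> is taken in the moving direction
  \<open>?Df x v\<close>. Expanding this direction in the fixed basis leaves derivatives of
  \<open>g\<close> along constant vectors, to which the induction hypothesis applies because it is
  general in \<open>g\<close>.\<close>

lemma Ck_on_compose:
  fixes f :: "'a::real_normed_vector \<Rightarrow> 'b::euclidean_space" and g :: "'b \<Rightarrow> 'c::real_normed_vector"
  shows "open S \<Longrightarrow> open T \<Longrightarrow> f ` S \<subseteq> T \<Longrightarrow> Ck_on k S f \<Longrightarrow> Ck_on k T g \<Longrightarrow> Ck_on k S (\<lambda>x. g (f x))"
proof (induction k arbitrary: g)
  case 0
  then show ?case by (auto intro: continuous_on_compose2)
next
  case (Suc k)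
  let ?Df = "\<lambda>x. frechet_derivative f (at x)" and ?Dg = "\<lambda>x. frechet_derivative g (at x)"
  have d: "((\<lambda>x. g (f x)) has_derivative (\<lambda>v. ?Dg (f x) (?Df x v))) (at x)" if "x \<in> S" for x
    by (rule has_derivative_compose[OF has_frechet has_frechet])
      (use Suc.prems that in \<open>auto simp: image_subset_iff\<close>)
  have lin: "?Dg (f x) w = (\<Sum>b\<in>Basis. (w \<bullet> b) *\<^sub>R ?Dg (f x) b)" if "x \<in> S" for x w
  proof -
    have l: "linear (?Dg (f x))"
      by (rule linear_frechet_derivative) (use Suc.prems that in auto)
    show ?thesis
      by (subst euclidean_representation[symmetric, of w])
        (simp only: linear_sum[OF l] linear_scale[OF l])
  qed
  have "Ck_on k S (\<lambda>x. frechet_derivative (\<lambda>x. g (f x)) (at x) v)" for v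
  proof (rule Ck_on_cong_imp[OF \<open>open S\<close>])
    show "Ck_on k S (\<lambda>x. \<Sum>b\<in>Basis. (?Df x v \<bullet> b) *\<^sub>R ?Dg (f x) b)"
    proof (rule Ck_on_sum[OF \<open>open S\<close>])
      fix b :: 'b
      show "Ck_on k S (\<lambda>x. (?Df x v \<bullet> b) *\<^sub>R ?Dg (f x) b)"
        by (intro Ck_on_bilinear[OF bounded_bilinear_scaleR] Ck_on_blinear[OF bounded_linear_inner_left]
            Suc.IH[of "\<lambda>y. ?Dg y b"])
          (use Suc.prems Ck_on_decr[of S k f] in auto)
    qed
  qed (use frechet_derivative_eqI[OF d] lin in auto)
  moreover have "(\<lambda>x. g (f x)) differentiable (at x)" if "x \<in> S" for x
    using d[OF that] differentiable_def by blast
  ultimately show ?case by simp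
qed

lemma Ck_on_inverse: "Ck_on k (-{0}) (inverse :: 'b::{real_normed_field} \<Rightarrow> 'b)"
proof (induction k)
  case 0
  then show ?case by (auto intro: continuous_intros)
next
  case (Suc k)
  have d: "(inverse has_derivative (\<lambda>v. - (inverse x * v * inverse x))) (at x)" if "x \<noteq> 0" for x :: 'b
    by (rule has_derivative_inverse'[OF that])
  have "Ck_on k (-{0}) (\<lambda>x::'b. frechet_derivative inverse (at x) v)" for v
  proof (rule Ck_on_cong_imp)
    show "Ck_on k (-{0}) (\<lambda>x::'b. - ((inverse x * v) * inverse x))"
      by (intro Ck_on_blinear[OF bounded_linear_minus[OF bounded_linear_ident]] Ck_on_bilinear[OF bounded_bilinear_mult] Ck_on_const Suc)
        (auto simp: open_Compl)
  qed (use frechet_derivative_eqI[OF d] in auto)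
  moreover have "inverse differentiable (at x)" if "x \<noteq> 0" for x :: 'b
    using d[OF that] differentiable_def by blast
  ultimately show ?case by simp
qed

lemma Ck_on_sqrt: "Ck_on k {0<..} sqrt"
proof (induction k)
  case 0
  then show ?case by (auto intro: continuous_intros)
next
  case (Suc k)
  have d: "(sqrt has_derivative (\<lambda>v. v * (inverse (sqrt x) / 2))) (at x)" if "x > 0" for x
    using DERIV_real_sqrt[OF that] unfolding has_field_derivative_def
    by (rule has_derivative_eq_rhs) (simp add: fun_eq_iff)
  have "Ck_on k {0<..} (\<lambda>x. frechet_derivative sqrt (at x) v)" for v
  proof (rule Ck_on_cong_imp)
    have "Ck_on k {0<..} (\<lambda>x. inverse (sqrt x))"
      by (rule Ck_on_compose[OF _ _ _ Suc Ck_on_inverse]) auto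
    then show "Ck_on k {0<..} (\<lambda>x. v * (inverse (sqrt x) / 2))"
      by (intro Ck_on_bilinear[OF bounded_bilinear_mult] Ck_on_const Ck_on_blinear[OF bounded_linear_divide]) auto
  qed (use frechet_derivative_eqI[OF d] in auto)
  moreover have "sqrt differentiable (at x)" if "x > 0" for x
    using d[OF that] differentiable_def by blast
  ultimately show ?case by simp
qed

text \<open>Derivatives of members of this family are linear combinations of members, which reduces smoothness to
  differentiability.\<close>

definition flat_fun :: "nat \<Rightarrow> real \<Rightarrow> real" where
  "flat_fun n t = (if t > 0 then exp (- 1 / t) / t ^ n else 0)"

lemma flat_fun_deriv:
  "(flat_fun n has_real_derivative flat_fun (n + 2) t - of_nat n * flat_fun (n + 1) t) (at t)"
proof -
  consider "t > 0" | "t < 0" | "t = 0" by linarith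
  then show ?thesis
  proof cases
    case 1
    have "((\<lambda>t. exp (- 1 / t) / t ^ n) has_real_derivative flat_fun (n + 2) t - of_nat n * flat_fun (n + 1) t) (at t)"
    proof (rule DERIV_cong)
      show "((\<lambda>t. exp (- 1 / t) / t ^ n) has_real_derivative
          (exp (- 1 / t) * (1 / t\<^sup>2) * t ^ n - exp (- 1 / t) * (of_nat n * t ^ (n - 1))) / (t ^ n * t ^ n)) (at t)"
        using 1 by (auto intro!: derivative_eq_intros simp: power2_eq_square)
      have "of_nat n * t ^ (n - 1) = of_nat n * t ^ n / t"
        using 1 by (cases n) auto
      then show "(exp (- 1 / t) * (1 / t\<^sup>2) * t ^ n - exp (- 1 / t) * (of_nat n * t ^ (n - 1))) / (t ^ n * t ^ n) =
          flat_fun (n + 2) t - of_nat n * flat_fun (n + 1) t"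
        using 1 by (simp add: flat_fun_def divide_simps power2_eq_square) (auto simp: algebra_simps)
    qed
    moreover have "eventually (\<lambda>x. x \<in> {0<..}) (nhds t)"
      using 1 eventually_nhds_in_open[of "{0<..}" t] by auto
    ultimately show ?thesis
      by (subst DERIV_cong_ev[OF refl _ refl, where g = "\<lambda>t. exp (- 1 / t) / t ^ n"])
        (auto simp: flat_fun_def elim: eventually_mono)
  next
    case 2
    have "eventually (\<lambda>x. x \<in> {..<0}) (nhds t)"
      using 2 eventually_nhds_in_open[of "{..<0}" t] by auto
    then show ?thesis using 2
      by (subst DERIV_cong_ev[OF refl _ refl, where g = "\<lambda>t. 0"])
        (auto simp: flat_fun_def elim!: eventually_mono)
  next
    case 3
    \<comment> \<open>At 0 the difference quotient of the member \<open>n\<close> is the member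
      \<open>n + 1\<close>, so a single limit settles differentiability there for every
      \<open>n\<close>.\<close>
    have "((\<lambda>h. flat_fun (n + 1) h) \<longlongrightarrow> 0) (at 0)"
    proof (rule filterlim_split_at)
      have "((\<lambda>h::real. exp (- 1 / h) / h ^ (n + 1)) \<longlongrightarrow> 0) (at_right 0)"
        by real_asymp
      then show "((\<lambda>h. flat_fun (n + 1) h) \<longlongrightarrow> 0) (at_right 0)"
        by (rule Lim_transform_eventually)
          (auto simp: flat_fun_def eventually_at_filter)
      show "((\<lambda>h. flat_fun (n + 1) h) \<longlongrightarrow> 0) (at_left 0)"
        by (rule Lim_transform_eventually[OF tendsto_const])
          (auto simp: flat_fun_def eventually_at_filter)
    qed
    moreover have "(flat_fun n (0 + h) - flat_fun n 0) / h = flat_fun (n + 1) h" for h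
      by (simp add: flat_fun_def)
    ultimately show ?thesis using 3 by (simp add: DERIV_def) (simp add: flat_fun_def)
  qed
qed

lemma Ck_on_flat_fun: "Ck_on k UNIV (flat_fun n)"
proof (induction k arbitrary: n)
  case 0
  then show ?case
    by (auto intro!: continuous_at_imp_continuous_on DERIV_isCont flat_fun_deriv)
next
  case (Suc k)
  have d: "(flat_fun n has_derivative (\<lambda>v. (flat_fun (n + 2) x - of_nat n * flat_fun (n + 1) x) * v)) (at x)" for x
    using flat_fun_deriv[of n x] by (simp add: has_field_derivative_def)
  have "Ck_on k UNIV (\<lambda>x. (flat_fun (n + 2) x + (- of_nat n) * flat_fun (n + 1) x) * v)" for v
    by (intro Ck_on_bilinear[OF bounded_bilinear_mult] Ck_on_const Ck_on_add Suc) auto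
  then have "Ck_on k UNIV (\<lambda>x. frechet_derivative (flat_fun n) (at x) v)" for v
    using frechet_derivative_eqI[OF d] by simp
  moreover have "flat_fun n differentiable (at x)" for x
    using d differentiable_def by blast
  ultimately show ?case by simp
qed

section \<open>From finite order to smooth maps\<close>

lemma smooth_on_subset: "smooth_on S f \<Longrightarrow> T \<subseteq> S \<Longrightarrow> smooth_on T f"
  unfolding smooth_on_def using Ck_on_mono by blast

lemma smooth_on_cong: "open S \<Longrightarrow> (\<And>y. y \<in> S \<Longrightarrow> f y = g y) \<Longrightarrow> smooth_on S f \<longleftrightarrow> smooth_on S g"
  unfolding smooth_on_def using Ck_on_cong[of S f g] by simp

lemma smooth_on_local:
  "(\<And>x. x \<in> S \<Longrightarrow> \<exists>T. open T \<and> x \<in> T \<and> smooth_on T f) \<Longrightarrow> smooth_on S f"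
  unfolding smooth_on_def by (meson Ck_on_local)

lemma smooth_on_const: "smooth_on S (\<lambda>x. c)"
  unfolding smooth_on_def by (simp add: Ck_on_const)

lemma smooth_on_add: "open S \<Longrightarrow> smooth_on S f \<Longrightarrow> smooth_on S g \<Longrightarrow> smooth_on S (\<lambda>x. f x + g x)"
  unfolding smooth_on_def by (simp add: Ck_on_add)

lemma smooth_on_sum:
  "open S \<Longrightarrow> (\<And>i. i \<in> I \<Longrightarrow> smooth_on S (f i)) \<Longrightarrow> smooth_on S (\<lambda>x. \<Sum>i\<in>I. f i x)"
  unfolding smooth_on_def by (simp add: Ck_on_sum)

lemma smooth_on_blinear: "bounded_linear L \<Longrightarrow> open S \<Longrightarrow> smooth_on S f \<Longrightarrow> smooth_on S (\<lambda>x. L (f x))"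
  unfolding smooth_on_def by (simp add: Ck_on_blinear)

lemma smooth_on_bilinear:
  "bounded_bilinear p \<Longrightarrow> open S \<Longrightarrow> smooth_on S f \<Longrightarrow> smooth_on S g \<Longrightarrow> smooth_on S (\<lambda>x. p (f x) (g x))"
  unfolding smooth_on_def by (simp add: Ck_on_bilinear)

lemma smooth_on_compose:
  fixes f :: "'a::real_normed_vector \<Rightarrow> 'b::euclidean_space" and g :: "'b \<Rightarrow> 'c::real_normed_vector"
  shows "open S \<Longrightarrow> open T \<Longrightarrow> f ` S \<subseteq> T \<Longrightarrow> smooth_on S f \<Longrightarrow> smooth_on T g \<Longrightarrow> smooth_on S (\<lambda>x. g (f x))"
  unfolding smooth_on_def using Ck_on_compose by blast

lemma smooth_on_inverse: "smooth_on (-{0}) (inverse :: 'b::{real_normed_field} \<Rightarrow> 'b)"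
  unfolding smooth_on_def by (simp add: Ck_on_inverse)

lemma smooth_on_sqrt: "smooth_on {0<..} sqrt"
  unfolding smooth_on_def by (simp add: Ck_on_sqrt)

lemma smooth_on_flat_fun: "smooth_on UNIV (flat_fun n)"
  unfolding smooth_on_def by (simp add: Ck_on_flat_fun)

lemma smooth_on_differentiable: "smooth_on S f \<Longrightarrow> x \<in> S \<Longrightarrow> f differentiable (at x)"
  unfolding smooth_on_def using Ck_on_differentiable by blast

lemma smooth_on_frechet: "smooth_on S f \<Longrightarrow> smooth_on S (\<lambda>x. frechet_derivative f (at x) v)"
  unfolding smooth_on_def using Ck_on.simps(2) by blast

lemma smooth_on_ident: "smooth_on S (\<lambda>x. x)"
  unfolding smooth_on_def
proof
  fix k show "Ck_on k S (\<lambda>x. x)"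
    by (cases k) (auto simp: Ck_on_const continuous_on_id)
qed

section \<open>Smooth functions and vector fields on the manifold\<close>

locale oriented_4manifold =
  fixes \<A> :: "'a::t2_space chart set"
  assumes manifold: "closed_oriented_4manifold \<A>"
begin

lemma chart_at: "chart_at \<A> x \<in> \<A>" "x \<in> fst (chart_at \<A> x)"
proof -
  have "\<exists>c. c \<in> \<A> \<and> x \<in> fst c"
    using manifold unfolding closed_oriented_4manifold_def by (metis UNIV_I UN_E)
  from someI_ex[OF this] show "chart_at \<A> x \<in> \<A>" "x \<in> fst (chart_at \<A> x)"
    unfolding chart_at_def by auto
qed

context
  fixes c assumes c: "c \<in> \<A>"
begin

lemma open_chart: "open (fst c)" "open (snd c ` fst c)"
  and homeomorphism_chart: "homeomorphism (fst c) (snd c ` fst c) (snd c) (chart_inv c)"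
  using manifold c unfolding closed_oriented_4manifold_def by auto

lemma chart_inv_left [simp]: "x \<in> fst c \<Longrightarrow> chart_inv c (snd c x) = x"
  using homeomorphism_apply1[OF homeomorphism_chart] .

lemma open_chart_image:
  assumes "open U"
  shows "open (snd c ` (U \<inter> fst c))"
proof -
  have "openin (top_of_set (snd c ` fst c)) (snd c ` (U \<inter> fst c))"
    by (rule homeomorphism_imp_open_map[OF homeomorphism_chart])
      (use assms in \<open>auto simp: openin_open\<close>)
  then show ?thesis using open_chart(2) openin_open_trans by blast
qed

lemma continuous_on_chart_inv: "continuous_on (snd c ` fst c) (chart_inv c)"
  using homeomorphism_chart homeomorphism_cont2 by blast

end

lemma smooth_transition:
  "c \<in> \<A> \<Longrightarrow> d \<in> \<A> \<Longrightarrow> smooth_on (snd c ` (fst c \<inter> fst d)) (transition c d)"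
  using manifold unfolding closed_oriented_4manifold_def by blast

lemma differentiable_transition:
  assumes "c \<in> \<A>" "d \<in> \<A>" "x \<in> fst c" "x \<in> fst d"
  shows "transition c d differentiable (at (snd c x))"
  using smooth_on_differentiable[OF smooth_transition[OF assms(1,2)]] assms(3,4) by blast

lemma transition_apply [simp]: "c \<in> \<A> \<Longrightarrow> x \<in> fst c \<Longrightarrow> transition c d (snd c x) = snd d x"
  by (simp add: transition_def)

lemma linear_in_chart: "c \<in> \<A> \<Longrightarrow> x \<in> fst c \<Longrightarrow> linear (in_chart \<A> c x)"
  unfolding in_chart_def
  by (intro linear_frechet_derivative differentiable_transition chart_at)

lemma frechet_transition_compose:
  assumes "a \<in> \<A>" "c \<in> \<A>" "d \<in> \<A>" "x \<in> fst a" "x \<in> fst c" "x \<in> fst d"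
  shows "frechet_derivative (transition a d) (at (snd a x)) v =
    frechet_derivative (transition c d) (at (snd c x))
      (frechet_derivative (transition a c) (at (snd a x)) v)"
proof -
  let ?S = "snd a ` (fst c \<inter> fst a)"
  have S: "open ?S" "snd a x \<in> ?S" using open_chart_image open_chart assms by auto
  have "frechet_derivative (transition a d) (at (snd a x)) =
      frechet_derivative (\<lambda>p. transition c d (transition a c p)) (at (snd a x))"
    by (rule frechet_derivative_cong_open[OF S]) (use assms in auto)
  also have "\<dots> = (\<lambda>v. frechet_derivative (transition c d) (at (snd c x))
      (frechet_derivative (transition a c) (at (snd a x)) v))"
  proof -
    have 1: "transition a c differentiable (at (snd a x))"
      by (intro differentiable_transition assms)
    have 2: "transition c d differentiable (at (transition a c (snd a x)))"
      using assms by (simp add: differentiable_transition)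
    show ?thesis
      using frechet_derivative_eqI[OF has_derivative_compose[OF has_frechet[OF 1] has_frechet[OF 2]]] assms by simp
  qed

  finally show ?thesis by simp
qed

lemma frechet_transition_self:
  assumes "c \<in> \<A>" "x \<in> fst c"
  shows "frechet_derivative (transition c c) (at (snd c x)) = (\<lambda>v. v)"
proof -
  have "frechet_derivative (transition c c) (at (snd c x)) = frechet_derivative (\<lambda>p. p) (at (snd c x))"
    by (rule frechet_derivative_cong_open[of "snd c ` fst c"]) (use assms open_chart in auto)
  then show ?thesis by simp
qed

lemma in_chart_change:
  assumes "c \<in> \<A>" "d \<in> \<A>" "x \<in> fst c" "x \<in> fst d"
  shows "in_chart \<A> d x v = frechet_derivative (transition c d) (at (snd c x)) (in_chart \<A> c x v)"
  unfolding in_chart_def by (rule frechet_transition_compose) (use assms chart_at in auto)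

lemma in_chart_at: "in_chart \<A> (chart_at \<A> x) x v = v"
  unfolding in_chart_def by (simp add: frechet_transition_self chart_at)

lemma smooth_fun_open: "smooth_fun \<A> U f \<Longrightarrow> open U"
  by (simp add: smooth_fun_def)

lemma smooth_vf_open: "smooth_vf \<A> U f \<Longrightarrow> open U"
  by (simp add: smooth_vf_def)

section \<open>Restriction, gluing and testing of smoothness in a single chart\<close>

lemma smooth_fun_subset: "smooth_fun \<A> U f \<Longrightarrow> open V \<Longrightarrow> V \<subseteq> U \<Longrightarrow> smooth_fun \<A> V f"
  unfolding smooth_fun_def by (meson Int_mono image_mono order_refl smooth_on_subset)

lemma smooth_vf_subset: "smooth_vf \<A> U f \<Longrightarrow> open V \<Longrightarrow> V \<subseteq> U \<Longrightarrow> smooth_vf \<A> V f"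
  unfolding smooth_vf_def by (meson Int_mono image_mono order_refl smooth_on_subset)

lemma smooth_on_charts_local:
  assumes "c \<in> \<A>" "\<And>x. x \<in> U \<Longrightarrow> \<exists>V. open V \<and> x \<in> V \<and> smooth_on (snd c ` (V \<inter> fst c)) F"
  shows "smooth_on (snd c ` (U \<inter> fst c)) F"
proof (rule smooth_on_local)
  fix p assume "p \<in> snd c ` (U \<inter> fst c)"
  then obtain x where x: "x \<in> U" "x \<in> fst c" "p = snd c x" by auto
  then obtain V where "open V" "x \<in> V" "smooth_on (snd c ` (V \<inter> fst c)) F" using assms(2) by blast
  then show "\<exists>T. open T \<and> p \<in> T \<and> smooth_on T F"
    using open_chart_image[OF assms(1)] x by (intro exI[of _ "snd c ` (V \<inter> fst c)"]) auto
qed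

lemma smooth_fun_local:
  assumes "open U" "\<And>x. x \<in> U \<Longrightarrow> \<exists>V. x \<in> V \<and> smooth_fun \<A> V f"
  shows "smooth_fun \<A> U f"
  unfolding smooth_fun_def
proof (intro conjI ballI smooth_on_charts_local)
  fix c x assume "c \<in> \<A>" "x \<in> U"
  then show "\<exists>V. open V \<and> x \<in> V \<and> smooth_on (snd c ` (V \<inter> fst c)) (f \<circ> chart_inv c)"
    using assms(2)[OF \<open>x \<in> U\<close>] unfolding smooth_fun_def by blast
qed (use assms in auto)

lemma smooth_vf_local:
  assumes "open U" "\<And>x. x \<in> U \<Longrightarrow> \<exists>V. x \<in> V \<and> smooth_vf \<A> V X"
  shows "smooth_vf \<A> U X"
  unfolding smooth_vf_def
proof (intro conjI ballI smooth_on_charts_local)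
  fix c x assume "c \<in> \<A>" "x \<in> U"
  then show "\<exists>V. open V \<and> x \<in> V \<and>
      smooth_on (snd c ` (V \<inter> fst c)) ((\<lambda>y. in_chart \<A> c y (X y)) \<circ> chart_inv c)"
    using assms(2)[OF \<open>x \<in> U\<close>] unfolding smooth_vf_def by blast
qed (use assms in auto)

lemma smooth_fun_cong:
  assumes "smooth_fun \<A> U f" "\<And>x. x \<in> U \<Longrightarrow> f x = h x"
  shows "smooth_fun \<A> U h"
proof -
  have U: "open U" using assms(1) smooth_fun_open by blast
  have "smooth_on (snd c ` (U \<inter> fst c)) (h \<circ> chart_inv c)" if c: "c \<in> \<A>" for c
  proof -
    have "smooth_on (snd c ` (U \<inter> fst c)) (f \<circ> chart_inv c)"
      using assms(1) c by (simp add: smooth_fun_def)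
    then show ?thesis
      by (subst smooth_on_cong[OF open_chart_image[OF c U], of _ "f \<circ> chart_inv c"]) (use assms(2) c in auto)
  qed
  then show ?thesis using U by (simp add: smooth_fun_def)
qed

lemma smooth_vf_cong:
  assumes "smooth_vf \<A> U X" "\<And>x. x \<in> U \<Longrightarrow> X x = Y x"
  shows "smooth_vf \<A> U Y"
proof -
  have U: "open U" using assms(1) smooth_vf_open by blast
  have "smooth_on (snd c ` (U \<inter> fst c)) ((\<lambda>y. in_chart \<A> c y (Y y)) \<circ> chart_inv c)" if c: "c \<in> \<A>" for c
  proof -
    have "smooth_on (snd c ` (U \<inter> fst c)) ((\<lambda>y. in_chart \<A> c y (X y)) \<circ> chart_inv c)"
      using assms(1) c by (simp add: smooth_vf_def)
    then show ?thesis
      by (subst smooth_on_cong[OF open_chart_image[OF c U], of _ "(\<lambda>y. in_chart \<A> c y (X y)) \<circ> chart_inv c"])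
        (use assms(2) c in auto)
  qed
  then show ?thesis using U by (simp add: smooth_vf_def)
qed

text \<open>Only derivatives along fixed vectors are smooth by definition, so the moving direction
  is expanded in a basis.\<close>

lemma smooth_on_frechet_apply:
  fixes F :: "real^4 \<Rightarrow> 'b::real_normed_vector"
  assumes "open S" "smooth_on S F" "smooth_on S V"
  shows "smooth_on S (\<lambda>p. frechet_derivative F (at p) (V p))"
proof -
  have "smooth_on S (\<lambda>p. \<Sum>b\<in>Basis. (V p \<bullet> b) *\<^sub>R frechet_derivative F (at p) b)"
    by (intro smooth_on_sum smooth_on_bilinear[OF bounded_bilinear_scaleR]
        smooth_on_blinear[OF bounded_linear_inner_left] smooth_on_frechet assms)
  moreover have "(\<Sum>b\<in>Basis. (V p \<bullet> b) *\<^sub>R frechet_derivative F (at p) b) = frechet_derivative F (at p) (V p)"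
    if "p \<in> S" for p
  proof -
    have l: "linear (frechet_derivative F (at p))"
      by (rule linear_frechet_derivative) (use assms that smooth_on_differentiable in blast)
    have "frechet_derivative F (at p) (\<Sum>b\<in>Basis. (V p \<bullet> b) *\<^sub>R b) =
        (\<Sum>b\<in>Basis. (V p \<bullet> b) *\<^sub>R frechet_derivative F (at p) b)"
      by (simp only: linear_sum[OF l] linear_scale[OF l])
    then show ?thesis by (simp only: euclidean_representation)
  qed
  ultimately show ?thesis using smooth_on_cong[OF assms(1)] by (metis (no_types, lifting))
qed

lemma smooth_transition_pullback:
  fixes F :: "real^4 \<Rightarrow> 'b::real_normed_vector"
  assumes "c \<in> \<A>" "d \<in> \<A>" "open U" "U \<subseteq> fst c" "smooth_on (snd c ` U) F"
  shows "smooth_on (snd d ` (U \<inter> fst d)) (\<lambda>p. F (transition d c p))"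
proof (rule smooth_on_compose[OF _ _ _ _ assms(5)])
  show "open (snd d ` (U \<inter> fst d))" using open_chart_image assms by blast
  show "open (snd c ` U)" using open_chart_image[of c U] assms by (simp add: Int_absorb2)
  show "transition d c ` snd d ` (U \<inter> fst d) \<subseteq> snd c ` U" using assms by auto
  show "smooth_on (snd d ` (U \<inter> fst d)) (transition d c)"
    by (rule smooth_on_subset[OF smooth_transition]) (use assms in auto)
qed

lemma smooth_fun_chart:
  assumes "c \<in> \<A>" "open U" "U \<subseteq> fst c" "smooth_on (snd c ` U) (f \<circ> chart_inv c)"
  shows "smooth_fun \<A> U f"
  unfolding smooth_fun_def
proof (intro conjI ballI)
  fix d assume d: "d \<in> \<A>"
  show "smooth_on (snd d ` (U \<inter> fst d)) (f \<circ> chart_inv d)"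
    by (subst smooth_on_cong[OF open_chart_image[OF d assms(2)], of _ "\<lambda>p. (f \<circ> chart_inv c) (transition d c p)"])
      (use smooth_transition_pullback[OF assms(1) d assms(2-4)] assms d in auto)
qed (use assms in auto)

text \<open>Compared with functions, the components in another chart are also multiplied by the
  Jacobian of the transition map, evaluated at a moving point and on a moving vector.\<close>

lemma smooth_vf_chart:
  assumes "c \<in> \<A>" "open U" "U \<subseteq> fst c"
    "smooth_on (snd c ` U) ((\<lambda>y. in_chart \<A> c y (X y)) \<circ> chart_inv c)"
  shows "smooth_vf \<A> U X"
  unfolding smooth_vf_def
proof (intro conjI ballI)
  fix d assume d: "d \<in> \<A>"
  let ?V = "(\<lambda>y. in_chart \<A> c y (X y)) \<circ> chart_inv c"
  have c: "open (snd c ` (U \<inter> fst d))"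
  proof -
    have "U \<inter> fst d = (U \<inter> fst d) \<inter> fst c" using assms(3) by blast
    then show ?thesis
      using open_chart_image[OF assms(1) open_Int[OF assms(2) open_chart(1)[OF d]]] by simp
  qed
  have "smooth_on (snd c ` (U \<inter> fst d)) (\<lambda>p. frechet_derivative (transition c d) (at p) (?V p))"
    by (rule smooth_on_frechet_apply[OF c])
      (use assms(3) in \<open>blast intro: smooth_on_subset[OF smooth_transition[OF assms(1) d]] smooth_on_subset[OF assms(4)]\<close>)+
  then have "smooth_on (snd d ` ((U \<inter> fst d) \<inter> fst d))
      (\<lambda>p. frechet_derivative (transition c d) (at (transition d c p)) (?V (transition d c p)))"
    by (intro smooth_transition_pullback[OF assms(1) d])
      (use assms open_Int[OF assms(2) open_chart(1)[OF d]] in auto)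
  then have *: "smooth_on (snd d ` (U \<inter> fst d))
      (\<lambda>p. frechet_derivative (transition c d) (at (transition d c p)) (?V (transition d c p)))"
    by (simp add: Int_assoc)
  show "smooth_on (snd d ` (U \<inter> fst d)) ((\<lambda>y. in_chart \<A> d y (X y)) \<circ> chart_inv d)"
    by (subst smooth_on_cong[OF open_chart_image[OF d assms(2)], of _
          "\<lambda>p. frechet_derivative (transition c d) (at (transition d c p)) (?V (transition d c p))"])
      (use * assms d in \<open>auto simp: in_chart_change[of c d] subset_iff\<close>)
qed (use assms in auto)

lemma smooth_fun_in_chart:
  "smooth_fun \<A> U f \<Longrightarrow> c \<in> \<A> \<Longrightarrow> smooth_on (snd c ` (U \<inter> fst c)) (f \<circ> chart_inv c)"
  by (simp add: smooth_fun_def)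

section \<open>Algebra of smooth functions and vector fields\<close>

lemma smooth_fun_const: "open U \<Longrightarrow> smooth_fun \<A> U (\<lambda>x. k)"
  unfolding smooth_fun_def by (simp add: comp_def smooth_on_const)

lemma smooth_fun_add:
  assumes "smooth_fun \<A> U f" "smooth_fun \<A> U h"
  shows "smooth_fun \<A> U (\<lambda>x. f x + h x)"
  using assms open_chart_image smooth_on_add unfolding smooth_fun_def comp_def by blast

lemma smooth_fun_blinear:
  assumes "bounded_linear L" "smooth_fun \<A> U f"
  shows "smooth_fun \<A> U (\<lambda>x. L (f x))"
  unfolding smooth_fun_def comp_def
proof (intro conjI ballI)
  fix c assume c: "c \<in> \<A>"
  show "smooth_on (snd c ` (U \<inter> fst c)) (\<lambda>x. L (f (chart_inv c x)))"
    by (rule smooth_on_blinear[OF assms(1) open_chart_image[OF c smooth_fun_open[OF assms(2)]]])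
      (use assms(2) c in \<open>simp add: smooth_fun_def comp_def\<close>)
qed (rule smooth_fun_open[OF assms(2)])

lemma smooth_fun_bilinear:
  assumes "bounded_bilinear p" "smooth_fun \<A> U f" "smooth_fun \<A> U h"
  shows "smooth_fun \<A> U (\<lambda>x. p (f x) (h x))"
  unfolding smooth_fun_def comp_def
proof (intro conjI ballI)
  fix c assume c: "c \<in> \<A>"
  show "smooth_on (snd c ` (U \<inter> fst c)) (\<lambda>x. p (f (chart_inv c x)) (h (chart_inv c x)))"
    by (rule smooth_on_bilinear[OF assms(1) open_chart_image[OF c smooth_fun_open[OF assms(2)]]])
      (use assms(2,3) c in \<open>simp_all add: smooth_fun_def comp_def\<close>)
qed (rule smooth_fun_open[OF assms(2)])

lemmas smooth_fun_minus = smooth_fun_blinear[OF bounded_linear_minus[OF bounded_linear_ident]]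
lemmas smooth_fun_scaleR = smooth_fun_bilinear[OF bounded_bilinear_scaleR]
lemmas smooth_fun_mult = smooth_fun_bilinear[OF bounded_bilinear_mult]

lemma smooth_fun_sum:
  "open U \<Longrightarrow> (\<And>i. i \<in> I \<Longrightarrow> smooth_fun \<A> U (f i)) \<Longrightarrow> smooth_fun \<A> U (\<lambda>x. \<Sum>i\<in>I. f i x)"
  by (induction I rule: infinite_finite_induct) (simp_all add: smooth_fun_const smooth_fun_add)

lemma smooth_fun_compose:
  fixes h :: "'b::euclidean_space \<Rightarrow> 'c::real_normed_vector"
  assumes "smooth_fun \<A> U f" "open T" "f ` U \<subseteq> T" "smooth_on T h"
  shows "smooth_fun \<A> U (\<lambda>x. h (f x))"
  unfolding smooth_fun_def
proof (intro conjI ballI)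
  fix c assume c: "c \<in> \<A>"
  show "smooth_on (snd c ` (U \<inter> fst c)) ((\<lambda>x. h (f x)) \<circ> chart_inv c)"
    unfolding comp_def
    by (rule smooth_on_compose[of _ T "\<lambda>p. f (chart_inv c p)" h])
      (use assms c open_chart_image[OF c] in \<open>auto simp: smooth_fun_def comp_def image_subset_iff\<close>)
qed (rule smooth_fun_open[OF assms(1)])

lemma smooth_fun_inverse:
  fixes f :: "'a \<Rightarrow> real"
  shows "smooth_fun \<A> U f \<Longrightarrow> (\<And>x. x \<in> U \<Longrightarrow> f x \<noteq> 0) \<Longrightarrow> smooth_fun \<A> U (\<lambda>x. inverse (f x))"
  by (rule smooth_fun_compose[of U f "- {0}" inverse]) (auto simp: smooth_on_inverse open_Compl)

lemma smooth_fun_divide: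
  fixes f h :: "'a \<Rightarrow> real"
  shows "smooth_fun \<A> U f \<Longrightarrow> smooth_fun \<A> U h \<Longrightarrow> (\<And>x. x \<in> U \<Longrightarrow> h x \<noteq> 0) \<Longrightarrow>
    smooth_fun \<A> U (\<lambda>x. f x / h x)"
  unfolding divide_inverse by (intro smooth_fun_mult smooth_fun_inverse)

lemma smooth_fun_sqrt:
  "smooth_fun \<A> U f \<Longrightarrow> (\<And>x. x \<in> U \<Longrightarrow> f x > 0) \<Longrightarrow> smooth_fun \<A> U (\<lambda>x. sqrt (f x))"
  by (rule smooth_fun_compose[of U f "{0<..}" sqrt]) (auto simp: smooth_on_sqrt)

lemma smooth_vf_zero: "open U \<Longrightarrow> smooth_vf \<A> U (\<lambda>x. 0)"
proof -
  assume U: "open U"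
  have "smooth_on (snd c ` (U \<inter> fst c)) ((\<lambda>y. in_chart \<A> c y 0) \<circ> chart_inv c)" if c: "c \<in> \<A>" for c
    by (subst smooth_on_cong[OF open_chart_image[OF c U], of _ "\<lambda>p. 0"])
      (use c linear_0[OF linear_in_chart[OF c]] smooth_on_const in auto)
  then show ?thesis using U by (simp add: smooth_vf_def)
qed

lemma smooth_vf_add:
  assumes "smooth_vf \<A> U X" "smooth_vf \<A> U Y"
  shows "smooth_vf \<A> U (\<lambda>x. X x + Y x)"
proof -
  have U: "open U" using assms smooth_vf_open by blast
  have "smooth_on (snd c ` (U \<inter> fst c)) ((\<lambda>y. in_chart \<A> c y (X y + Y y)) \<circ> chart_inv c)" if c: "c \<in> \<A>" for c
    by (subst smooth_on_cong[OF open_chart_image[OF c U], of _ "\<lambda>p.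
          ((\<lambda>y. in_chart \<A> c y (X y)) \<circ> chart_inv c) p + ((\<lambda>y. in_chart \<A> c y (Y y)) \<circ> chart_inv c) p"])
      (use c linear_add[OF linear_in_chart[OF c]] assms open_chart_image[OF c U] in
        \<open>auto simp: smooth_vf_def comp_def intro!: smooth_on_add\<close>)
  then show ?thesis using U by (simp add: smooth_vf_def)
qed

lemma smooth_vf_scaleR:
  assumes "smooth_fun \<A> U f" "smooth_vf \<A> U X"
  shows "smooth_vf \<A> U (\<lambda>x. f x *\<^sub>R X x)"
proof -
  have U: "open U" using assms smooth_vf_open by blast
  have "smooth_on (snd c ` (U \<inter> fst c)) ((\<lambda>y. in_chart \<A> c y (f y *\<^sub>R X y)) \<circ> chart_inv c)" if c: "c \<in> \<A>" for c
    by (subst smooth_on_cong[OF open_chart_image[OF c U], of _ "\<lambda>p.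
          (f \<circ> chart_inv c) p *\<^sub>R ((\<lambda>y. in_chart \<A> c y (X y)) \<circ> chart_inv c) p"])
      (use c linear_scale[OF linear_in_chart[OF c]] assms open_chart_image[OF c U] in
        \<open>auto simp: smooth_vf_def smooth_fun_def comp_def intro!: smooth_on_bilinear[OF bounded_bilinear_scaleR]\<close>)
  then show ?thesis using U by (simp add: smooth_vf_def)
qed

lemma smooth_vf_minus:
  assumes "smooth_vf \<A> U X"
  shows "smooth_vf \<A> U (\<lambda>x. - X x)"
  using smooth_vf_scaleR[OF smooth_fun_const[OF smooth_vf_open[OF assms]] assms, of "-1"] by simp

lemma smooth_vf_diff:
  "smooth_vf \<A> U X \<Longrightarrow> smooth_vf \<A> U Y \<Longrightarrow> smooth_vf \<A> U (\<lambda>x. X x - Y x)"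
  using smooth_vf_add[of U X "\<lambda>x. - Y x"] smooth_vf_minus[of U Y] by simp

lemma smooth_vf_sum:
  "open U \<Longrightarrow> (\<And>i. i \<in> I \<Longrightarrow> smooth_vf \<A> U (f i)) \<Longrightarrow> smooth_vf \<A> U (\<lambda>x. \<Sum>i\<in>I. f i x)"
  by (induction I rule: infinite_finite_induct) (simp_all add: smooth_vf_zero smooth_vf_add)

text \<open>The vector field with constant components \<open>v\<close> in the chart
  \<open>c\<close>. Tangent vectors are stored in the preferred chart of their base point, so the
  raw values may jump where that chart changes although the field is smooth.\<close>

definition coord_vf :: "'a chart \<Rightarrow> real^4 \<Rightarrow> 'a vfield" where
  "coord_vf c v y = frechet_derivative (transition c (chart_at \<A> y)) (at (snd c y)) v"

lemma in_chart_coord_vf: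
  assumes "c \<in> \<A>" "y \<in> fst c"
  shows "in_chart \<A> c y (coord_vf c v y) = v"
  unfolding in_chart_def coord_vf_def
  by (subst frechet_transition_compose[symmetric]) (use assms chart_at in \<open>auto simp: frechet_transition_self\<close>)

lemma coord_vf_in_chart:
  assumes "c \<in> \<A>" "y \<in> fst c"
  shows "coord_vf c (in_chart \<A> c y v) y = v"
  unfolding in_chart_def coord_vf_def
  by (subst frechet_transition_compose[symmetric]) (use assms chart_at in \<open>auto simp: frechet_transition_self\<close>)

lemma smooth_coord_vf:
  assumes c: "c \<in> \<A>"
  shows "smooth_vf \<A> (fst c) (coord_vf c v)"
proof (rule smooth_vf_chart[OF c])
  show "smooth_on (snd c ` fst c) ((\<lambda>y. in_chart \<A> c y (coord_vf c v y)) \<circ> chart_inv c)"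
    by (subst smooth_on_cong[OF open_chart(2)[OF c], of _ "\<lambda>p. v"])
      (use c in_chart_coord_vf[OF c] smooth_on_const in auto)
qed (use open_chart c in auto)

section \<open>Germs and directional derivatives\<close>

abbreviation smooth_at :: "'a \<Rightarrow> ('a \<Rightarrow> 'b::real_normed_vector) \<Rightarrow> bool" where
  "smooth_at x f \<equiv> near (\<lambda>U. smooth_fun \<A> U f) x"

abbreviation smooth_vf_at :: "'a \<Rightarrow> 'a vfield \<Rightarrow> bool" where
  "smooth_vf_at x X \<equiv> near (\<lambda>U. smooth_vf \<A> U X) x"

lemma smooth_atI: "smooth_fun \<A> U f \<Longrightarrow> x \<in> U \<Longrightarrow> smooth_at x f"
  unfolding near_def using smooth_fun_open by blast

lemma smooth_vf_atI: "smooth_vf \<A> U f \<Longrightarrow> x \<in> U \<Longrightarrow> smooth_vf_at x f"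
  unfolding near_def using smooth_vf_open by blast

lemma smooth_at_const: "smooth_at x (\<lambda>y. k)"
  by (rule smooth_atI[OF smooth_fun_const[OF open_UNIV] UNIV_I])

lemma smooth_at_blinear:
  assumes "bounded_linear L" "smooth_at x f"
  shows "smooth_at x (\<lambda>y. L (f y))"
proof -
  obtain U where "x \<in> U" "smooth_fun \<A> U f" using assms(2) unfolding near_def by blast
  then show ?thesis using smooth_atI[OF smooth_fun_blinear[OF assms(1)]] by metis
qed

lemma smooth_vf_at2:
  assumes "smooth_vf_at x f" "smooth_vf_at x h"
  obtains U where "open U" "x \<in> U" "smooth_vf \<A> U f" "smooth_vf \<A> U h"
proof -
  obtain V W where "open V" "x \<in> V" "smooth_vf \<A> V f" "open W" "x \<in> W" "smooth_vf \<A> W h"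
    using assms unfolding near_def by blast
  then show ?thesis
    using smooth_vf_subset[of V f "V \<inter> W"] smooth_vf_subset[of W h "V \<inter> W"]
    by (intro that[of "V \<inter> W"]) auto
qed

lemma smooth_vf_at_add: "smooth_vf_at x X \<Longrightarrow> smooth_vf_at x Y \<Longrightarrow> smooth_vf_at x (\<lambda>y. X y + Y y)"
  by (erule (1) smooth_vf_at2) (rule smooth_vf_atI[OF smooth_vf_add])

lemma smooth_vf_at_scaleR:
  assumes "smooth_at x f" "smooth_vf_at x X"
  shows "smooth_vf_at x (\<lambda>y. f y *\<^sub>R X y)"
proof -
  obtain V W where "open V" "x \<in> V" "smooth_fun \<A> V f" "open W" "x \<in> W" "smooth_vf \<A> W X"
    using assms unfolding near_def by blast
  then show ?thesis
    using smooth_fun_subset[of V f "V \<inter> W"] smooth_vf_subset[of W X "V \<inter> W"]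
    by (intro smooth_vf_atI[of "V \<inter> W"] smooth_vf_scaleR) auto
qed

lemma ex_smooth_vf: "\<exists>Y. smooth_vf_at x Y \<and> Y x = v"
proof (intro exI conjI)
  show "smooth_vf_at x (coord_vf (chart_at \<A> x) v)"
    by (rule smooth_vf_atI[OF smooth_coord_vf]) (rule chart_at)+
  show "coord_vf (chart_at \<A> x) v x = v"
    using in_chart_coord_vf[of "chart_at \<A> x" x v] chart_at by (simp add: in_chart_at)
qed

lemma dirderiv_has_derivative:
  assumes "smooth_at x f"
  shows "((f \<circ> chart_inv (chart_at \<A> x)) has_derivative dirderiv \<A> f x) (at (snd (chart_at \<A> x) x))"
proof -
  obtain U where U: "x \<in> U" "smooth_fun \<A> U f" using assms unfolding near_def by blast
  have "f \<circ> chart_inv (chart_at \<A> x) differentiable at (snd (chart_at \<A> x) x)"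
    by (rule smooth_on_differentiable[OF smooth_fun_in_chart[OF U(2)]]) (use U chart_at in auto)
  then show ?thesis using has_frechet unfolding dirderiv_def by blast
qed

lemma dirderiv_eqI:
  "((f \<circ> chart_inv (chart_at \<A> x)) has_derivative f') (at (snd (chart_at \<A> x) x)) \<Longrightarrow> dirderiv \<A> f x v = f' v"
  unfolding dirderiv_def using frechet_derivative_eqI by metis

lemma dirderiv_const: "dirderiv \<A> (\<lambda>y. k) x v = 0"
  by (rule dirderiv_eqI[of _ _ "\<lambda>v. 0"]) (simp add: comp_def)

lemma dirderiv_add:
  assumes "smooth_at x f" "smooth_at x h"
  shows "dirderiv \<A> (\<lambda>y. f y + h y) x v = dirderiv \<A> f x v + dirderiv \<A> h x v"
  using has_derivative_add[OF assms[THEN dirderiv_has_derivative]] by (intro dirderiv_eqI) (simp add: comp_def)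

lemma dirderiv_blinear:
  assumes "bounded_linear L" "smooth_at x f"
  shows "dirderiv \<A> (\<lambda>y. L (f y)) x v = L (dirderiv \<A> f x v)"
  using bounded_linear.has_derivative[OF assms(1) dirderiv_has_derivative[OF assms(2)]]
  by (intro dirderiv_eqI) (simp add: comp_def)

lemma dirderiv_bilinear:
  assumes "bounded_bilinear p" "smooth_at x f" "smooth_at x h"
  shows "dirderiv \<A> (\<lambda>y. p (f y) (h y)) x v = p (f x) (dirderiv \<A> h x v) + p (dirderiv \<A> f x v) (h x)"
  using bounded_bilinear.FDERIV[OF assms(1) assms(2,3)[THEN dirderiv_has_derivative]]
  by (intro dirderiv_eqI) (simp add: comp_def chart_at)

lemma dirderiv_cong:
  assumes "open U" "x \<in> U" "\<And>y. y \<in> U \<Longrightarrow> f y = h y"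
  shows "dirderiv \<A> f x v = dirderiv \<A> h x v"
proof -
  let ?a = "chart_at \<A> x"
  have "frechet_derivative (f \<circ> chart_inv ?a) (at (snd ?a x)) = frechet_derivative (h \<circ> chart_inv ?a) (at (snd ?a x))"
    by (rule frechet_derivative_cong_open[of "snd ?a ` (U \<inter> fst ?a)"])
      (use assms open_chart_image chart_at in auto)
  then show ?thesis by (simp add: dirderiv_def)
qed

text \<open>Smoothness of a form is a local matter; in this shape it can be checked over one
  U(2)-chart around each point.\<close>

lemma one_formI:
  assumes "\<And>x. linear (\<xi> x)" "\<And>x. \<exists>U. open U \<and> x \<in> U \<and> (\<forall>V X. V \<subseteq> U \<longrightarrow> smooth_vf \<A> V X \<longrightarrow> smooth_fun \<A> V (\<lambda>y. \<xi> y (X y)))"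
  shows "one_form \<A> \<xi>"
  unfolding one_form_def
proof (intro conjI allI impI)
  fix U X assume X: "smooth_vf \<A> U X"
  show "smooth_fun \<A> U (\<lambda>x. \<xi> x (X x))"
  proof (rule smooth_fun_local[OF smooth_vf_open[OF X]])
    fix x assume "x \<in> U"
    obtain W where "open W" "x \<in> W" "\<And>V X. V \<subseteq> W \<Longrightarrow> smooth_vf \<A> V X \<Longrightarrow> smooth_fun \<A> V (\<lambda>y. \<xi> y (X y))"
      using assms(2)[of x] by blast
    then show "\<exists>V. x \<in> V \<and> smooth_fun \<A> V (\<lambda>x. \<xi> x (X x))"
      using smooth_vf_subset[OF X open_Int[OF smooth_vf_open[OF X] \<open>open W\<close>] Int_lower1] \<open>x \<in> U\<close>
      by (intro exI[of _ "U \<inter> W"]) auto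
  qed
qed (use assms in auto)

lemma one_form_scale:
  assumes "one_form \<A> \<xi>"
  shows "one_form \<A> (\<lambda>x v. k * \<xi> x v)"
  unfolding one_form_def
proof (intro conjI allI impI)
  show "linear (\<lambda>v. k * \<xi> x v)" for x
    using assms unfolding one_form_def linear_iff by (simp add: algebra_simps)
  fix U X assume X: "smooth_vf \<A> U X"
  show "smooth_fun \<A> U (\<lambda>x. k * \<xi> x (X x))"
    by (rule smooth_fun_mult[OF smooth_fun_const[OF smooth_vf_open[OF X]]])
      (use X assms in \<open>simp add: one_form_def\<close>)
qed

lemma one_form_add:
  assumes "one_form \<A> \<xi>" "one_form \<A> \<eta>"
  shows "one_form \<A> (\<lambda>x v. \<xi> x v + \<eta> x v)"
  unfolding one_form_def
proof (intro conjI allI impI)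
  show "linear (\<lambda>v. \<xi> x v + \<eta> x v)" for x
    using assms unfolding one_form_def linear_iff by (simp add: algebra_simps)
  fix U X assume X: "smooth_vf \<A> U X"
  show "smooth_fun \<A> U (\<lambda>x. \<xi> x (X x) + \<eta> x (X x))"
    by (rule smooth_fun_add) (use X assms in \<open>simp_all add: one_form_def\<close>)
qed

text \<open>A bump function times a coordinate differential. It provides the direction of an affine line in the
  degenerate case where all the minimizers coincide.\<close>

lemma ex_nonzero_one_form: "\<exists>\<eta>. one_form \<A> \<eta> \<and> (\<exists>x v. \<eta> x v \<noteq> 0)"
proof -
  fix x0 :: 'a
  define c where "c = chart_at \<A> x0"
  have c: "c \<in> \<A>" "x0 \<in> fst c" using chart_at unfolding c_def by auto
  obtain r where r: "r > 0" "cball (snd c x0) r \<subseteq> snd c ` fst c"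
    using open_chart(2)[OF c(1)] c(2) open_contains_cball by (metis imageI)
  define K where "K = chart_inv c ` cball (snd c x0) r"
  \<comment> \<open>The bump function vanishes in the chart domain off \<open>K\<close>. Closedness
    makes the complement of \<open>K\<close> open, so that this complement and the chart domain
    cover the manifold; the form is zero on the former.\<close>
  have K: "closed K"
    unfolding K_def
    by (intro compact_imp_closed compact_continuous_image
        continuous_on_subset[OF continuous_on_chart_inv[OF c(1)] r(2)] compact_cball)
  define f where "f y = flat_fun 0 (r\<^sup>2 - (snd c y - snd c x0) \<bullet> (snd c y - snd c x0))" for y
  define \<eta> where "\<eta> y v = (if y \<in> fst c then f y * (in_chart \<A> c y v $ 1) else 0)" for y v
  have f0: "f y = 0" if "y \<in> fst c" "y \<notin> K" for y
  proof -
    have "snd c y \<notin> cball (snd c x0) r"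
    proof
      assume "snd c y \<in> cball (snd c x0) r"
      then have "chart_inv c (snd c y) \<in> K" unfolding K_def by blast
      then show False using that c by simp
    qed
    then have "norm (snd c y - snd c x0) > r" by (simp add: dist_norm norm_minus_commute)
    then have "r\<^sup>2 < (norm (snd c y - snd c x0))\<^sup>2" using r(1) by (intro power_strict_mono) auto
    then show ?thesis unfolding f_def flat_fun_def by (simp add: power2_norm_eq_inner)
  qed
  have o: "open (snd c ` fst c)" using open_chart(2)[OF c(1)] .
  have "smooth_on (snd c ` fst c) (\<lambda>p. p - snd c x0)"
    using smooth_on_add[OF o smooth_on_ident smooth_on_const[of _ "- snd c x0"]] by simp
  then have "smooth_on (snd c ` fst c) (\<lambda>p. - ((p - snd c x0) \<bullet> (p - snd c x0)))"
    by (intro smooth_on_blinear[OF bounded_linear_minus[OF bounded_linear_ident] o]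
        smooth_on_bilinear[OF bounded_bilinear_inner o])
  then have "smooth_on (snd c ` fst c) (\<lambda>p. r\<^sup>2 + - ((p - snd c x0) \<bullet> (p - snd c x0)))"
    by (intro smooth_on_add[OF o smooth_on_const])
  then have "smooth_on (snd c ` fst c) (\<lambda>p. flat_fun 0 (r\<^sup>2 + - ((p - snd c x0) \<bullet> (p - snd c x0))))"
    by (rule smooth_on_compose[OF o open_UNIV _ _ smooth_on_flat_fun, rotated]) simp
  then have f: "smooth_fun \<A> (fst c) f"
    by (intro smooth_fun_chart[OF c(1) open_chart(1)[OF c(1)] order_refl])
      (subst smooth_on_cong[OF open_chart(2)[OF c(1)], of _ "\<lambda>p. flat_fun 0 (r\<^sup>2 + - ((p - snd c x0) \<bullet> (p - snd c x0)))"],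
        auto simp: f_def c(1))
  have "one_form \<A> \<eta>"
  proof (rule one_formI)
    show "linear (\<eta> x)" for x
      unfolding \<eta>_def using linear_add[OF linear_in_chart[OF c(1)]] linear_scale[OF linear_in_chart[OF c(1)]]
      by (intro linearI) (auto simp: algebra_simps)
    fix x
    show "\<exists>U. open U \<and> x \<in> U \<and> (\<forall>V X. V \<subseteq> U \<longrightarrow> smooth_vf \<A> V X \<longrightarrow> smooth_fun \<A> V (\<lambda>y. \<eta> y (X y)))"
    proof (cases "x \<in> fst c")
      case True
      have "smooth_fun \<A> V (\<lambda>y. \<eta> y (X y))" if "V \<subseteq> fst c" and X: "smooth_vf \<A> V X" for V X
      proof (rule smooth_fun_cong)
        have "smooth_on (snd c ` (V \<inter> fst c)) ((\<lambda>y. in_chart \<A> c y (X y)) \<circ> chart_inv c)"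
          using X c by (simp add: smooth_vf_def)
        then have "smooth_fun \<A> V (\<lambda>y. in_chart \<A> c y (X y))"
          using that(1) smooth_vf_open[OF X] by (intro smooth_fun_chart[OF c(1)]) (auto simp: Int_absorb2)
        then have "smooth_fun \<A> V (\<lambda>y. in_chart \<A> c y (X y) $ 1)"
          by (rule smooth_fun_blinear[OF bounded_linear_vec_nth])
        then show "smooth_fun \<A> V (\<lambda>y. f y * (in_chart \<A> c y (X y) $ 1))"
          by (intro smooth_fun_mult smooth_fun_subset[OF f _ that(1)] smooth_vf_open[OF X])
        show "f y * (in_chart \<A> c y (X y) $ 1) = \<eta> y (X y)" if "y \<in> V" for y
          using that \<open>V \<subseteq> fst c\<close> by (auto simp: \<eta>_def)
      qed
      then show ?thesis using True open_chart(1)[OF c(1)] by blast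
    next
      case False
      have KC: "K \<subseteq> fst c"
        unfolding K_def using r(2) c(1) by auto
      have "smooth_fun \<A> V (\<lambda>y. \<eta> y (X y))" if "V \<subseteq> - K" and X: "smooth_vf \<A> V X" for V X
        by (rule smooth_fun_cong[OF smooth_fun_const[OF smooth_vf_open[OF X], of 0]])
          (use that f0 in \<open>auto simp: \<eta>_def\<close>)
      then show ?thesis using False K KC by (intro exI[of _ "- K"]) auto
    qed
  qed
  moreover have "\<eta> x0 (coord_vf c (axis 1 1) x0) \<noteq> 0"
    unfolding \<eta>_def using c r(1) by (simp add: in_chart_coord_vf f_def flat_fun_def)
  ultimately show ?thesis by blast
qed

end

section \<open>Quaternions\<close>

lemma vector_4 [simp]:
  "(vector [a, b, c, d] :: 'a::zero^4) $ 1 = a" "(vector [a, b, c, d] :: 'a^4) $ 2 = b"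
  "(vector [a, b, c, d] :: 'a^4) $ 3 = c" "(vector [a, b, c, d] :: 'a^4) $ 4 = d"
  unfolding vector_def by simp_all

lemma vec4_eq_iff: "x = y \<longleftrightarrow> x $ 1 = y $ 1 \<and> x $ 2 = y $ 2 \<and> x $ 3 = y $ 3 \<and> x $ 4 = (y :: 'a^4) $ 4"
  by (simp add: vec_eq_iff forall_4)

lemma inner_vec4: "(x :: real^4) \<bullet> y = x $ 1 * y $ 1 + x $ 2 * y $ 2 + x $ 3 * y $ 3 + x $ 4 * y $ 4"
  by (simp add: inner_vec_def sum_4)

lemma det_4:
  "det (A::'a::comm_ring_1^4^4) =
    A$1$1 * A$2$2 * A$3$3 * A$4$4 - A$1$1 * A$2$2 * A$3$4 * A$4$3
  - A$1$1 * A$2$3 * A$3$2 * A$4$4 + A$1$1 * A$2$3 * A$3$4 * A$4$2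
  + A$1$1 * A$2$4 * A$3$2 * A$4$3 - A$1$1 * A$2$4 * A$3$3 * A$4$2
  - A$1$2 * A$2$1 * A$3$3 * A$4$4 + A$1$2 * A$2$1 * A$3$4 * A$4$3
  + A$1$2 * A$2$3 * A$3$1 * A$4$4 - A$1$2 * A$2$3 * A$3$4 * A$4$1
  - A$1$2 * A$2$4 * A$3$1 * A$4$3 + A$1$2 * A$2$4 * A$3$3 * A$4$1
  + A$1$3 * A$2$1 * A$3$2 * A$4$4 - A$1$3 * A$2$1 * A$3$4 * A$4$2
  - A$1$3 * A$2$2 * A$3$1 * A$4$4 + A$1$3 * A$2$2 * A$3$4 * A$4$1
  + A$1$3 * A$2$4 * A$3$1 * A$4$2 - A$1$3 * A$2$4 * A$3$2 * A$4$1
  - A$1$4 * A$2$1 * A$3$2 * A$4$3 + A$1$4 * A$2$1 * A$3$3 * A$4$2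
  + A$1$4 * A$2$2 * A$3$1 * A$4$3 - A$1$4 * A$2$2 * A$3$3 * A$4$1
  - A$1$4 * A$2$3 * A$3$1 * A$4$2 + A$1$4 * A$2$3 * A$3$2 * A$4$1"
proof -
  have f1234: "finite {2::4, 3, 4}" "1 \<notin> {2::4, 3, 4}" by auto
  have f234: "finite {3::4, 4}" "2 \<notin> {3::4, 4}" by auto
  have f34: "finite {4::4}" "3 \<notin> {4::4}" by auto
  show ?thesis
    unfolding det_def UNIV_4
    unfolding sum_over_permutations_insert[OF f1234]
    unfolding sum_over_permutations_insert[OF f234]
    unfolding sum_over_permutations_insert[OF f34]
    unfolding permutes_sing
    by (simp add: sign_swap_id permutation_swap_id permutation_compose sign_compose sign_id swap_id_eq algebra_simps)
qed

lemma qmul_nth: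
  "(p \<odot> q) $ 1 = p$1 * q$1 - p$2 * q$2 - p$3 * q$3 - p$4 * q$4"
  "(p \<odot> q) $ 2 = p$1 * q$2 + p$2 * q$1 + p$3 * q$4 - p$4 * q$3"
  "(p \<odot> q) $ 3 = p$1 * q$3 - p$2 * q$4 + p$3 * q$1 + p$4 * q$2"
  "(p \<odot> q) $ 4 = p$1 * q$4 + p$2 * q$3 - p$3 * q$2 + p$4 * q$1"
  by (simp_all add: qmul_def)

lemma q_nth [simp]:
  "q1 $ 1 = 1" "q1 $ 2 = 0" "q1 $ 3 = 0" "q1 $ 4 = 0"
  "qi $ 1 = 0" "qi $ 2 = 1" "qi $ 3 = 0" "qi $ 4 = 0"
  "qj $ 1 = 0" "qj $ 2 = 0" "qj $ 3 = 1" "qj $ 4 = 0"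
  by (simp_all add: q1_def qi_def qj_def)

definition qk :: quat where "qk = vector [0, 0, 0, 1]"

lemma qk_nth [simp]: "qk $ 1 = 0" "qk $ 2 = 0" "qk $ 3 = 0" "qk $ 4 = 1"
  by (simp_all add: qk_def)

definition qconj :: "quat \<Rightarrow> quat" where "qconj q = vector [q $ 1, - q $ 2, - q $ 3, - q $ 4]"

lemma qconj_nth [simp]:
  "qconj q $ 1 = q $ 1" "qconj q $ 2 = - q $ 2" "qconj q $ 3 = - q $ 3" "qconj q $ 4 = - q $ 4"
  by (simp_all add: qconj_def)

lemma qmul_assoc: "p \<odot> q \<odot> r = p \<odot> (q \<odot> r)"
  by (simp add: vec4_eq_iff qmul_nth algebra_simps)

lemma qmul_q1 [simp]: "q1 \<odot> p = p" "p \<odot> q1 = p"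
  by (simp_all add: vec4_eq_iff qmul_nth)

lemma qi_qi [simp]: "qi \<odot> (qi \<odot> v) = - v"
  by (simp add: vec4_eq_iff qmul_nth)

lemma qmul_add: "(p + q) \<odot> r = p \<odot> r + q \<odot> r" "p \<odot> (q + r) = p \<odot> q + p \<odot> r"
  by (simp_all add: vec4_eq_iff qmul_nth algebra_simps)

lemma qmul_diff: "(p - q) \<odot> r = p \<odot> r - q \<odot> r" "p \<odot> (q - r) = p \<odot> q - p \<odot> r"
  by (simp_all add: vec4_eq_iff qmul_nth algebra_simps)

lemma qmul_scaleR: "(k *\<^sub>R p) \<odot> r = k *\<^sub>R (p \<odot> r)" "p \<odot> (k *\<^sub>R r) = k *\<^sub>R (p \<odot> r)"
  by (simp_all add: vec4_eq_iff qmul_nth algebra_simps)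

lemma qmul_minus: "(- p) \<odot> r = - (p \<odot> r)" "p \<odot> (- r) = - (p \<odot> r)"
  by (simp_all add: vec4_eq_iff qmul_nth algebra_simps)

lemma qmul_zero [simp]: "0 \<odot> r = 0" "p \<odot> 0 = 0"
  by (simp_all add: vec4_eq_iff qmul_nth)

lemma bounded_bilinear_qmul: "bounded_bilinear (\<odot>)"
proof -
  have "bilinear (\<odot>)"
    unfolding bilinear_def by (auto intro!: linearI simp: qmul_add qmul_scaleR)
  then show ?thesis by (simp add: bilinear_conv_bounded_bilinear)
qed

lemma qmul_inner: "(p \<odot> x) \<bullet> (p \<odot> y) = (p \<bullet> p) * (x \<bullet> y)"
  by (simp add: inner_vec4 qmul_nth algebra_simps)

lemma qmul_inner_right: "(x \<odot> p) \<bullet> (y \<odot> p) = (x \<bullet> y) * (p \<bullet> p)"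
  by (simp add: inner_vec4 qmul_nth algebra_simps)

lemma qmul_inner_adjoint: "(p \<odot> x) \<bullet> y = x \<bullet> (qconj p \<odot> y)"
  by (simp add: inner_vec4 qmul_nth algebra_simps)

lemma qconj_qmul: "qconj p \<odot> (p \<odot> x) = (p \<bullet> p) *\<^sub>R x" "p \<odot> (qconj p \<odot> x) = (p \<bullet> p) *\<^sub>R x"
  by (simp_all add: vec4_eq_iff inner_vec4 qmul_nth algebra_simps)

lemma qmul_eq_0_iff: "p \<odot> q = 0 \<longleftrightarrow> p = 0 \<or> q = (0::quat)"
  by (metis qmul_inner inner_eq_zero_iff mult_eq_0_iff)

text \<open>The polarization of \<open>qmul_inner\<close> in its left factor. For orthogonal
  \<open>n\<close> and \<open>c\<close> it makes
  \<open>(n \<odot> r) \<bullet> (c \<odot> s)\<close> antisymmetric in \<open>r\<close> and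
  \<open>s\<close>.\<close>

lemma qmul_inner_polarized:
  "(n \<odot> r) \<bullet> (c \<odot> s) + (n \<odot> s) \<bullet> (c \<odot> r) = 2 * (n \<bullet> c) * (r \<bullet> s)"
  by (simp add: inner_vec4 qmul_nth algebra_simps)

text \<open>The quaternions \<open>x \<odot> qconj y\<close> and \<open>y \<odot> qconj x\<close>
  are conjugate with real part \<open>x \<bullet> y\<close>; orthogonality makes them imaginary, and
  the exchange changes the sign.\<close>

lemma qmul_conj_antisym: "x \<bullet> y = 0 \<Longrightarrow> x \<odot> (qconj y \<odot> z) = - (y \<odot> (qconj x \<odot> z))"
proof -
  have "x \<odot> (qconj y \<odot> z) + y \<odot> (qconj x \<odot> z) = (2 * (x \<bullet> y)) *\<^sub>R z"
    by (simp add: vec4_eq_iff inner_vec4 qmul_nth algebra_simps)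
  then show "x \<bullet> y = 0 \<Longrightarrow> ?thesis" by (simp add: eq_neg_iff_add_eq_0)
qed

lemma qmul_conj_antisym': "y \<bullet> z = 0 \<Longrightarrow> x \<odot> (qconj y \<odot> z) = - (x \<odot> (qconj z \<odot> y))"
proof -
  have "x \<odot> (qconj y \<odot> z) + x \<odot> (qconj z \<odot> y) = (2 * (y \<bullet> z)) *\<^sub>R x"
    by (simp add: vec4_eq_iff inner_vec4 qmul_nth algebra_simps)
  then show "y \<bullet> z = 0 \<Longrightarrow> ?thesis" by (simp add: eq_neg_iff_add_eq_0)
qed

section \<open>Rotations, left multiplications and the fiber of self-dual spinors\<close>

lemma quat_expand: "v = v $ 1 *\<^sub>R q1 + v $ 2 *\<^sub>R qi + v $ 3 *\<^sub>R qj + v $ 4 *\<^sub>R qk"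
  by (simp add: vec4_eq_iff)

text \<open>Orthonormality says that the square matrix of the vectors has its transpose as right
  inverse; being also a left inverse, the transpose yields completeness.\<close>

lemma orthonormal4_expand:
  fixes r :: "4 \<Rightarrow> real^4"
  assumes "\<And>j k. r j \<bullet> r k = (if j = k then 1 else 0)"
  shows "z = (\<Sum>j\<in>UNIV. (r j \<bullet> z) *\<^sub>R r j)"
proof -
  define R :: "real^4^4" where "R = (\<chi> i j. r i $ j)"
  have "R ** transpose R = mat 1"
    using assms by (simp add: R_def matrix_matrix_mult_def transpose_def mat_def vec_eq_iff inner_vec_def)
  then have "transpose R ** R = mat 1" using matrix_left_right_inverse by blast
  then have "z = transpose R *v (R *v z)" by (simp add: matrix_vector_mul_assoc)
  also have "\<dots> = (\<Sum>j\<in>UNIV. (r j \<bullet> z) *\<^sub>R r j)"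
    by (simp add: R_def matrix_vector_mult_def transpose_def vec_eq_iff inner_vec_def mult.commute)
  finally show ?thesis .
qed

text \<open>The vector paired with the fourth column is twice the ternary cross product of the other
  three, up to orientation conventions. Its purpose is to convert the sign of a determinant into the
  sign of one inner product.\<close>

lemma det_cross_product:
  fixes R :: "real^4^4"
  shows "2 * det R = column 4 R \<bullet> (column 3 R \<odot> (qconj (column 2 R) \<odot> column 1 R)
    - column 1 R \<odot> (qconj (column 2 R) \<odot> column 3 R))"
  by (simp add: det_4 inner_vec4 qmul_nth column_def algebra_simps)

text \<open>Conjugation by a rotation of the quaternions preserves the left multiplications: the images
  \<open>r\<^sub>1, \<dots>, r\<^sub>4\<close> of \<open>1, i, j, k\<close> satisfy \<open>r\<^sub>4 = r\<^sub>3 r\<^sub>2\<^sup>* r\<^sub>1\<close>, so left multiplication by \<open>i\<close> and \<open>j\<close>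
  becomes left multiplication by \<open>r\<^sub>2 r\<^sub>1\<^sup>*\<close> and \<open>r\<^sub>3 r\<^sub>1\<^sup>*\<close>.\<close>

lemma rotation_conjugates_left_mult:
  assumes R: "linear R" and iso: "\<And>v w. R v \<bullet> R w = v \<bullet> w" and det: "det (matrix R) > 0"
  shows "\<exists>p'. \<forall>v. R (p \<odot> v) = p' \<odot> R v"
proof -
  define r1 r2 r3 r4 where r: "r1 = R q1" "r2 = R qi" "r3 = R qj" "r4 = R qk"
  have ax: "axis 1 1 = q1" "axis 2 1 = qi" "axis 3 1 = qj" "axis 4 1 = qk"
    by (simp_all add: vec4_eq_iff axis_def)
  have o: "r1 \<bullet> r1 = 1" "r2 \<bullet> r2 = 1" "r3 \<bullet> r3 = 1" "r4 \<bullet> r4 = 1" "r1 \<bullet> r2 = 0" "r1 \<bullet> r3 = 0"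
    "r2 \<bullet> r3 = 0" "r1 \<bullet> r4 = 0" "r2 \<bullet> r4 = 0" "r3 \<bullet> r4 = 0"
    by (simp_all only: r iso) (simp_all add: inner_vec4)
  define w where "w = r3 \<odot> (qconj r2 \<odot> r1)"
  have w2: "w = - (r1 \<odot> (qconj r2 \<odot> r3))"
    unfolding w_def
    by (metis o(5,6,7) inner_commute minus_minus qmul_conj_antisym qmul_conj_antisym')
  have w3: "w = r2 \<odot> (qconj r1 \<odot> r3)"
    using w2 qmul_conj_antisym[OF o(5), of r3] by simp
  have w4: "w = - (r3 \<odot> (qconj r1 \<odot> r2))"
    unfolding w_def using qmul_conj_antisym'[OF o(5), of r3] by simp
  have "column i (matrix R) = R (axis i 1)" for i
    by (simp add: matrix_def column_def vec_eq_iff)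
  then have "2 * det (matrix R) = r4 \<bullet> w - r4 \<bullet> (- w)"
    unfolding det_cross_product inner_diff_right using w2 by (simp add: ax r w_def)
  \<comment> \<open>The determinant contributes only a sign: \<open>w\<close> will turn out to be a
    unit vector orthogonal to \<open>r1\<close>, \<open>r2\<close> and \<open>r3\<close>, hence
    equal to \<open>r4\<close> or to its negative.\<close>
  then have pos: "r4 \<bullet> w > 0" using det by simp
  have ww: "w \<bullet> w = 1"
  proof -
    have "qconj r2 \<bullet> qconj r2 = 1" using o(2) by (simp add: inner_vec4)
    then show ?thesis unfolding w_def by (simp add: qmul_inner o)
  qed
  have "r1 \<bullet> w = 0" "r2 \<bullet> w = 0" "r3 \<bullet> w = 0"
  proof -
    have a: "(p \<odot> (qconj q \<odot> p')) \<bullet> p' = (p \<bullet> q) * (p' \<bullet> p')" for p q p'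
      by (simp add: inner_vec4 qmul_nth algebra_simps)
    have b: "(p' \<odot> (qconj p \<odot> q)) \<bullet> p' = (p \<bullet> q) * (p' \<bullet> p')" for p q p'
      by (simp add: inner_vec4 qmul_nth algebra_simps)
    show "r1 \<bullet> w = 0" using a[of r3 r2 r1] o(7) by (simp add: w_def inner_commute)
    show "r2 \<bullet> w = 0" using a[of r3 r1 r2] o(6) by (simp add: w4 inner_commute)
    show "r3 \<bullet> w = 0" using b[of r3 r2 r1] o(5) by (simp add: w_def inner_commute)
  qed
  moreover define r where "r = (\<lambda>k::4. R (axis k 1))"
  have "r j \<bullet> r k = (if j = k then 1 else 0)" for j k
    by (simp add: r_def iso inner_axis_axis)
  from orthonormal4_expand[of r w, OF this]
  have "w = (r1 \<bullet> w) *\<^sub>R r1 + (r2 \<bullet> w) *\<^sub>R r2 + (r3 \<bullet> w) *\<^sub>R r3 + (r4 \<bullet> w) *\<^sub>R r4"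
    by (simp add: sum_4 r_def ax r)
  ultimately have w: "w = (r4 \<bullet> w) *\<^sub>R r4" by simp
  then have "w \<bullet> w = (r4 \<bullet> w)\<^sup>2" using o(4)
    by (metis inner_scaleR_left power2_eq_square)
  then have "r4 \<bullet> w = 1" using pos ww by (smt (verit) power2_eq_1_iff)
  then have r4: "r4 = w" using w by simp
  have lin: "R v = v $ 1 *\<^sub>R r1 + v $ 2 *\<^sub>R r2 + v $ 3 *\<^sub>R r3 + v $ 4 *\<^sub>R r4" for v
    by (subst quat_expand[of v]) (simp only: linear_add[OF R] linear_scale[OF R] r)
  have conj3: "x \<odot> (qconj y \<odot> (x \<odot> z)) = - (y \<odot> z)" if "x \<bullet> y = 0" "x \<bullet> x = 1" for x y z
    using qmul_conj_antisym[OF that(1), of "x \<odot> z"] that(2) by (simp add: qconj_qmul)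
  have unit: "x \<odot> (qconj r1 \<odot> r1) = x" for x
    using qconj_qmul(1)[of r1 q1] o(1) by simp
  have o': "r2 \<bullet> r1 = 0" "r3 \<bullet> r1 = 0" using o by (simp_all add: inner_commute)
  have i4: "r2 \<odot> (qconj r1 \<odot> r4) = - r3"
    unfolding r4 w3 conj3[OF o'(1) o(2)] by (simp add: qconj_qmul o)
  have j4: "r3 \<odot> (qconj r1 \<odot> r4) = r2"
    unfolding r4 w4 qmul_minus conj3[OF o'(2) o(3)] by (simp add: qconj_qmul o)
  have i2: "r2 \<odot> (qconj r1 \<odot> r2) = - r1" using conj3[OF o'(1) o(2), of q1] by simp
  have j3: "r3 \<odot> (qconj r1 \<odot> r3) = - r1" using conj3[OF o'(2) o(3), of q1] by simp
  have j2: "r3 \<odot> (qconj r1 \<odot> r2) = - r4" using r4 w4 by simp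
  have Ri: "R (qi \<odot> v) = r2 \<odot> (qconj r1 \<odot> R v)" for v
    unfolding lin[of v] lin[of "qi \<odot> v"] qmul_add qmul_scaleR unit i2 w3[symmetric] i4
    by (simp add: qmul_nth r4)
  have Rj: "R (qj \<odot> v) = r3 \<odot> (qconj r1 \<odot> R v)" for v
    unfolding lin[of v] lin[of "qj \<odot> v"] qmul_add qmul_scaleR unit j2 j3 j4
    by (simp add: qmul_nth)
  have "R (p \<odot> v) = (p $ 1 *\<^sub>R q1 + p $ 2 *\<^sub>R (r2 \<odot> qconj r1) + p $ 3 *\<^sub>R (r3 \<odot> qconj r1)
      + p $ 4 *\<^sub>R (r2 \<odot> qconj r1 \<odot> (r3 \<odot> qconj r1))) \<odot> R v" for v
  proof -
    \<comment> \<open>Transport is known for left multiplication by \<open>qi\<close> and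
      \<open>qj\<close> only; the one by the fourth unit is their composite.\<close>
    have "p \<odot> v = p $ 1 *\<^sub>R v + p $ 2 *\<^sub>R (qi \<odot> v) + p $ 3 *\<^sub>R (qj \<odot> v) + p $ 4 *\<^sub>R (qi \<odot> (qj \<odot> v))"
      by (simp add: vec4_eq_iff qmul_nth)
    then show ?thesis
      by (simp only: linear_add[OF R] linear_scale[OF R] Ri Rj qmul_add qmul_scaleR qmul_assoc qmul_q1)
  qed
  then show ?thesis by blast
qed

text \<open>Passing from the isometry hidden in \<open>Wplus\<close> to another oriented one
  conjugates by a rotation, and rotations preserve the set of left multiplications. Hence a
  self-dual spinor has a quaternion coefficient in every U(2)-chart.\<close>

lemma Wplus_left_mult:
  assumes "\<phi> \<in> Wplus gx" "oriented_isometry gx E"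
  shows "\<exists>p. \<forall>v. E (\<phi> v) = p \<odot> E v"
proof -
  obtain L p where L: "linear L" "\<And>v w. L v \<bullet> L w = gx v w" "det (matrix L) > 0"
      and \<phi>: "\<And>v. L (\<phi> v) = p \<odot> L v"
    using assms(1) unfolding Wplus_def oriented_isometry_def by blast
  have E: "linear E" "\<And>v w. E v \<bullet> E w = gx v w" "det (matrix E) > 0"
    using assms(2) unfolding oriented_isometry_def by auto
  have "inj L"
    unfolding linear_injective_0[OF L(1)] by (metis E(1,2) L(2) E(3) inner_eq_zero_iff
        det_nz_iff_inj[OF E(1)] inj_eq linear_0 order_less_irrefl)
  then obtain L' where L': "linear L'" "L' \<circ> L = id" "L \<circ> L' = id"
    using linear_injective_isomorphism[OF L(1)] L(1)
    by (metis fun_eq_iff comp_apply id_apply inj_linear_imp_inv_linear inv_o_cancel linear_injective_imp_surjective surj_iff)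
  have L'e: "L' (L v) = v" "L (L' v) = v" for v
    using L'(2,3) by (metis comp_apply id_apply)+
  define R where "R = E \<circ> L'"
  have R: "linear R" unfolding R_def by (rule linear_compose[OF L'(1) E(1)])
  have "matrix R ** matrix L = matrix (R \<circ> L)" by (rule matrix_compose[OF L(1) R, symmetric])
  also have "R \<circ> L = E" by (auto simp: R_def L'e)
  finally have "det (matrix R) * det (matrix L) = det (matrix E)" by (metis det_mul)
  then have "det (matrix R) > 0" using L(3) E(3) by (metis zero_less_mult_pos2)
  moreover have "R v \<bullet> R w = v \<bullet> w" for v w
    unfolding R_def comp_apply E(2) L(2)[symmetric] L'e ..
  ultimately obtain p' where p': "\<And>v. R (p \<odot> v) = p' \<odot> R v"
    using rotation_conjugates_left_mult[OF R] by blast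
  have "E (\<phi> v) = p' \<odot> E v" for v
  proof -
    have "E (\<phi> v) = R (L (\<phi> v))" by (simp add: R_def L'e)
    also have "\<dots> = p' \<odot> R (L v)" by (simp add: \<phi> p')
    finally show ?thesis by (simp add: R_def L'e)
  qed
  then show ?thesis by blast
qed

section \<open>Complex coordinates and the complex determinant\<close>

definition cx1 :: "quat \<Rightarrow> complex" where "cx1 v = Complex (v $ 1) (v $ 2)"
definition cx2 :: "quat \<Rightarrow> complex" where "cx2 v = Complex (v $ 3) (v $ 4)"

text \<open>The complex determinant of two quaternions \<open>z\<^sub>1 + z\<^sub>2 j\<close> as vectors \<open>(z\<^sub>1, z\<^sub>2)\<close>.\<close>

definition cdet :: "quat \<Rightarrow> quat \<Rightarrow> complex" where
  "cdet v w = cx1 v * cx2 w - cx2 v * cx1 w"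

lemmas cdet_simps = cdet_def cx1_def cx2_def complex_eq_iff

lemma bounded_bilinear_cdet: "bounded_bilinear cdet"
proof -
  have "bilinear cdet"
    unfolding bilinear_def by (auto intro!: linearI simp: cdet_simps algebra_simps)
  then show ?thesis by (simp add: bilinear_conv_bounded_bilinear)
qed

lemma cdet_self: "cdet v v = 0"
  by (simp add: cdet_simps algebra_simps)

lemma cdet_qi: "cdet (qi \<odot> v) w = \<i> * cdet v w" "cdet v (qi \<odot> w) = \<i> * cdet v w"
  by (simp_all add: cdet_simps qmul_nth algebra_simps)

text \<open>Right multiplication by imaginary quaternions is complex linear and trace-free, an
  action of su(2). This removes the form \<open>am\<close> from the induced connection on the
  determinant line.\<close>

lemma cdet_right_mult: "a \<in> ImH \<Longrightarrow> cdet (v \<odot> a) w + cdet v (w \<odot> a) = 0"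
  by (simp add: cdet_simps qmul_nth ImH_def algebra_simps)

lemma cdet_q1_qj: "cdet q1 qj = 1"
  by (simp add: cdet_simps)

text \<open>The entries on the left are Hermitian products, so this is multiplicativity of the
  determinant for a 2 by 2 complex matrix times an adjoint. It will show that the Hermitian metric
  on the determinant line does not depend on how bivectors are decomposed.\<close>

lemma cauchy_binet_quat:
  "Complex (v1 \<bullet> w1) (- (qi \<odot> v1) \<bullet> w1) * Complex (v2 \<bullet> w2) (- (qi \<odot> v2) \<bullet> w2)
   - Complex (v1 \<bullet> w2) (- (qi \<odot> v1) \<bullet> w2) * Complex (v2 \<bullet> w1) (- (qi \<odot> v2) \<bullet> w1)
   = cdet v1 v2 * cnj (cdet w1 w2)"
proof -
  have h: "Complex (v \<bullet> w) (- (qi \<odot> v) \<bullet> w) = cx1 v * cnj (cx1 w) + cx2 v * cnj (cx2 w)" for v w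
    by (simp add: cdet_simps qmul_nth inner_vec4 algebra_simps)
  show ?thesis unfolding h cdet_def by (simp add: algebra_simps)
qed

text \<open>If \<open>G y = a \<odot> y - y \<odot> b\<close> with imaginary \<open>a\<close> and
  \<open>b\<close>, then \<open>G q1\<close> has the entries of \<open>a - b\<close>, while
  \<open>G qj $ 4\<close>, \<open>G qk $ 2\<close> and \<open>G qi $ 3\<close> are the entries of
  \<open>a + b\<close>. The two definitions solve these equations for \<open>a\<close> and
  \<open>b\<close>.\<close>

definition skew_left :: "(quat \<Rightarrow> quat) \<Rightarrow> quat" where
  "skew_left G = (1/2) *\<^sub>R vector [0, G q1 $ 2 + G qj $ 4, G q1 $ 3 + G qk $ 2, G q1 $ 4 + G qi $ 3]"

definition skew_right :: "(quat \<Rightarrow> quat) \<Rightarrow> quat" where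
  "skew_right G = (1/2) *\<^sub>R vector [0, G qj $ 4 - G q1 $ 2, G qk $ 2 - G q1 $ 3, G qi $ 3 - G q1 $ 4]"

text \<open>The splitting of \<open>so(4)\<close> into two copies of the imaginary quaternions.\<close>

lemma skew_split:
  assumes "linear G" "\<And>v w. G v \<bullet> w = - (v \<bullet> G w)"
  shows "skew_left G \<in> ImH" "skew_right G \<in> ImH" "G y = skew_left G \<odot> y - y \<odot> skew_right G"
proof -
  show "skew_left G \<in> ImH" "skew_right G \<in> ImH"
    by (simp_all add: skew_left_def skew_right_def ImH_def)
  have G: "G y = y $ 1 *\<^sub>R G q1 + y $ 2 *\<^sub>R G qi + y $ 3 *\<^sub>R G qj + y $ 4 *\<^sub>R G qk"
    by (subst quat_expand[of y]) (simp only: linear_add[OF assms(1)] linear_scale[OF assms(1)])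
  have sk: "G q1 $ 1 = 0" "G qi $ 2 = 0" "G qj $ 3 = 0" "G qk $ 4 = 0"
    "G qi $ 1 = - G q1 $ 2" "G qj $ 1 = - G q1 $ 3" "G qk $ 1 = - G q1 $ 4"
    "G qj $ 2 = - G qi $ 3" "G qi $ 4 = - G qk $ 2" "G qk $ 3 = - G qj $ 4"
    using assms(2)[of q1 q1] assms(2)[of qi qi] assms(2)[of qj qj] assms(2)[of qk qk]
      assms(2)[of q1 qi] assms(2)[of q1 qj] assms(2)[of q1 qk] assms(2)[of qi qj]
      assms(2)[of qi qk] assms(2)[of qj qk]
    by (simp_all add: inner_vec4)
  show "G y = skew_left G \<odot> y - y \<odot> skew_right G"
    unfolding G by (simp add: vec4_eq_iff qmul_nth skew_left_def skew_right_def sk field_simps)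
qed

section \<open>Norms of the tensors at a point\<close>

lemma sum_swap_sym:
  fixes f :: "'i \<Rightarrow> 'i \<Rightarrow> 'b::comm_monoid_add"
  shows "(\<Sum>j\<in>I. \<Sum>k\<in>I. f j k) = (\<Sum>j\<in>I. \<Sum>k\<in>I. f k j)"
  by (rule sum.swap)

context
  fixes r c :: "4 \<Rightarrow> quat" and n :: quat
  assumes r: "\<And>j k. r j \<bullet> r k = (if j = k then 1 else 0)"
    and cn: "\<And>j. n \<bullet> c j = 0" and n: "n \<noteq> 0"
begin

private definition "s j = - ((n \<odot> r j) \<bullet> (\<Sum>k\<in>UNIV. c k \<odot> r k)) / (n \<bullet> n)"
private definition "b t j = c j + t j *\<^sub>R n" for t :: "4 \<Rightarrow> real"
text \<open>The pairing of the tensor with its transpose; \<open>Y\<close> below is its squared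
  norm. Together they determine the norms of the symmetric and antisymmetric parts.\<close>

private definition "X t = (\<Sum>j\<in>UNIV. \<Sum>k\<in>UNIV. (b t j \<odot> r k) \<bullet> (b t k \<odot> r j))"
private definition "Y t = (\<Sum>j\<in>UNIV. \<Sum>k\<in>UNIV. (b t j \<odot> r k) \<bullet> (b t j \<odot> r k))"

private lemma nn: "n \<bullet> n > 0" using n by simp

private lemma s_eq: "(n \<bullet> n) * s j = - (\<Sum>k\<in>UNIV. (n \<odot> r j) \<bullet> (c k \<odot> r k))"
  using nn by (simp add: s_def inner_sum_right)

private lemma Y_eq: "Y t = 4 * (\<Sum>j\<in>UNIV. c j \<bullet> c j) + 4 * (n \<bullet> n) * (\<Sum>j\<in>UNIV. (t j)\<^sup>2)"
proof -
  have 1: "b t j \<bullet> b t j = c j \<bullet> c j + (n \<bullet> n) * (t j)\<^sup>2" for j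
    using cn[of j] by (simp add: b_def inner_add_left inner_add_right inner_commute[of "c j" n] power2_eq_square)
  have "Y t = 4 * (\<Sum>j\<in>UNIV. b t j \<bullet> b t j)"
    unfolding Y_def by (simp add: qmul_inner r sum_distrib_left)
  then show ?thesis by (simp add: 1 sum.distrib sum_distrib_left algebra_simps)
qed

text \<open>In a mixed term \<open>c k\<close> multiplies a frame vector \<open>r j\<close> with a
  different index. Orthogonality to \<open>n\<close> allows the two frame vectors to be exchanged at
  the price of a sign, and the sum over \<open>k\<close> then collects
  \<open>c k \<odot> r k\<close>, which is what \<open>s\<close> is made of. In the quadratic part
  only the pairs \<open>j = k\<close> survive, hence the coefficient 1 where \<open>Y_eq\<close> has
  4.\<close>

private lemma X_eq: "X t = (\<Sum>j\<in>UNIV. \<Sum>k\<in>UNIV. (c j \<odot> r k) \<bullet> (c k \<odot> r j))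
    + 2 * (n \<bullet> n) * (\<Sum>j\<in>UNIV. t j * s j) + (n \<bullet> n) * (\<Sum>j\<in>UNIV. (t j)\<^sup>2)"
proof -
  have a: "(n \<odot> r k) \<bullet> (c i \<odot> r j) = - ((n \<odot> r j) \<bullet> (c i \<odot> r k))" for i j k
    using qmul_inner_polarized[of n "r k" "c i" "r j"] cn[of i] by simp
  have "(b t j \<odot> r k) \<bullet> (b t k \<odot> r j) = (c j \<odot> r k) \<bullet> (c k \<odot> r j)
      - t j * ((n \<odot> r j) \<bullet> (c k \<odot> r k)) - t k * ((n \<odot> r k) \<bullet> (c j \<odot> r j))
      + t j * t k * ((n \<bullet> n) * (if j = k then 1 else 0))" for j k
  proof -
    have "(c j \<odot> r k) \<bullet> (n \<odot> r j) = - ((n \<odot> r k) \<bullet> (c j \<odot> r j))"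
      using a[of j j k] by (simp add: inner_commute)
    then show ?thesis using a[of k k j] qmul_inner[of n "r k" "r j"] r[of k j]
      by (cases "j = k") (simp_all add: b_def qmul_add qmul_scaleR inner_add_left inner_add_right algebra_simps)
  qed
  then have "X t = (\<Sum>j\<in>UNIV. \<Sum>k\<in>UNIV. (c j \<odot> r k) \<bullet> (c k \<odot> r j))
      - (\<Sum>j\<in>UNIV. \<Sum>k\<in>UNIV. t j * ((n \<odot> r j) \<bullet> (c k \<odot> r k)))
      - (\<Sum>j\<in>UNIV. \<Sum>k\<in>UNIV. t k * ((n \<odot> r k) \<bullet> (c j \<odot> r j)))
      + (\<Sum>j\<in>UNIV. \<Sum>k\<in>UNIV. t j * t k * ((n \<bullet> n) * (if j = k then 1 else 0)))"
    unfolding X_def by (simp only: sum.distrib sum_subtractf)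
  also have "(\<Sum>j\<in>UNIV. \<Sum>k\<in>UNIV. t k * ((n \<odot> r k) \<bullet> (c j \<odot> r j)))
      = (\<Sum>j\<in>UNIV. \<Sum>k\<in>UNIV. t j * ((n \<odot> r j) \<bullet> (c k \<odot> r k)))"
    by (rule sum_swap_sym)
  also have "(\<Sum>j\<in>UNIV. \<Sum>k\<in>UNIV. t j * ((n \<odot> r j) \<bullet> (c k \<odot> r k)))
      = - ((n \<bullet> n) * (\<Sum>j\<in>UNIV. t j * s j))"
  proof -
    have "(\<Sum>k\<in>UNIV. t j * ((n \<odot> r j) \<bullet> (c k \<odot> r k))) = - ((n \<bullet> n) * (t j * s j))" for j
      using s_eq[of j] by (simp add: sum_distrib_left[symmetric] algebra_simps)
    then show ?thesis by (simp add: sum_negf sum_distrib_left)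
  qed
  also have "(\<Sum>j\<in>UNIV. \<Sum>k\<in>UNIV. t j * t k * ((n \<bullet> n) * (if j = k then 1 else 0)))
      = (n \<bullet> n) * (\<Sum>j\<in>UNIV. (t j)\<^sup>2)"
  proof -
    have "(\<Sum>k\<in>UNIV. t j * t k * ((n \<bullet> n) * (if j = k then 1 else 0))) = (n \<bullet> n) * (t j)\<^sup>2" for j
      by (simp add: if_distrib power2_eq_square algebra_simps cong: if_cong)
    then show ?thesis by (simp add: sum_distrib_left)
  qed
  finally show ?thesis by simp
qed

lemma tensor_norm_coeffs:
  "\<exists>C. \<forall>t. (\<Sum>j\<in>UNIV. \<Sum>k\<in>UNIV. ((c j + t j *\<^sub>R n) \<odot> r k) \<bullet> ((c j + t j *\<^sub>R n) \<odot> r k))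
    = C + 4 * (n \<bullet> n) * (\<Sum>j\<in>UNIV. (t j)\<^sup>2)"
  using Y_eq unfolding Y_def b_def by blast

text \<open>The coefficient \<open>q\<close> may be negative: the antisymmetric part uses
  \<open>q = - 3 / 2\<close> inside an expression that is subtracted.\<close>

private lemma square_complete:
  "q * (\<Sum>j\<in>UNIV. (t j)\<^sup>2) + (\<Sum>j\<in>UNIV. t j * s j) =
    q * (\<Sum>j\<in>UNIV. (t j + s j / (2 * q))\<^sup>2) - (\<Sum>j\<in>UNIV. (s j)\<^sup>2) / (4 * q)" if "q \<noteq> 0"
proof -
  have "q * (t j + s j / (2 * q))\<^sup>2 = q * (t j)\<^sup>2 + t j * s j + (s j)\<^sup>2 / (4 * q)" for j
    using that by (simp add: power2_eq_square field_simps)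
  then show ?thesis
    by (simp add: sum_distrib_left sum.distrib sum_divide_distrib)
qed

text \<open>Symmetrization averages \<open>Y\<close> and \<open>X\<close>: the quadratic
  coefficients 4 and 1 average to 5/2, and the linear coefficient 2 of \<open>X\<close> becomes 1,
  which places the vertex at \<open>- s j / 5\<close>.\<close>

lemma tensor_norm_sym_coeffs:
  "\<exists>C. \<forall>t. (\<Sum>j\<in>UNIV. \<Sum>k\<in>UNIV.
      ((1/2) *\<^sub>R ((c j + t j *\<^sub>R n) \<odot> r k + (c k + t k *\<^sub>R n) \<odot> r j)) \<bullet>
      ((1/2) *\<^sub>R ((c j + t j *\<^sub>R n) \<odot> r k + (c k + t k *\<^sub>R n) \<odot> r j)))
    = C + 5 / 2 * (n \<bullet> n) * (\<Sum>j\<in>UNIV.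
        (t j - - 1 / 5 * (- ((n \<odot> r j) \<bullet> (\<Sum>k\<in>UNIV. c k \<odot> r k)) / (n \<bullet> n)))\<^sup>2)"
proof -
  have "(\<Sum>j\<in>UNIV. \<Sum>k\<in>UNIV. ((1/2) *\<^sub>R (b t j \<odot> r k + b t k \<odot> r j)) \<bullet> ((1/2) *\<^sub>R (b t j \<odot> r k + b t k \<odot> r j)))
    = Y t / 2 + X t / 2" for t
  proof -
    have "((1/2) *\<^sub>R (b t j \<odot> r k + b t k \<odot> r j)) \<bullet> ((1/2) *\<^sub>R (b t j \<odot> r k + b t k \<odot> r j))
      = 1/4 * ((b t j \<odot> r k) \<bullet> (b t j \<odot> r k)) + 1/4 * ((b t k \<odot> r j) \<bullet> (b t k \<odot> r j))
       + 1/2 * ((b t j \<odot> r k) \<bullet> (b t k \<odot> r j))" for j k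
      by (simp add: inner_add_left inner_add_right inner_commute field_simps)
    then have "(\<Sum>j\<in>UNIV. \<Sum>k\<in>UNIV. ((1/2) *\<^sub>R (b t j \<odot> r k + b t k \<odot> r j)) \<bullet> ((1/2) *\<^sub>R (b t j \<odot> r k + b t k \<odot> r j)))
      = 1/4 * Y t + 1/4 * (\<Sum>j\<in>UNIV. \<Sum>k\<in>UNIV. (b t k \<odot> r j) \<bullet> (b t k \<odot> r j)) + 1/2 * X t"
      unfolding Y_def X_def by (simp only: sum.distrib sum_distrib_left)
    also have "(\<Sum>j\<in>UNIV. \<Sum>k\<in>UNIV. (b t k \<odot> r j) \<bullet> (b t k \<odot> r j)) = Y t"
      unfolding Y_def by (rule sum_swap_sym)
    finally show ?thesis by simp
  qed
  also have "Y t / 2 + X t / 2 = (2 * (\<Sum>j\<in>UNIV. c j \<bullet> c j)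
        + (\<Sum>j\<in>UNIV. \<Sum>k\<in>UNIV. (c j \<odot> r k) \<bullet> (c k \<odot> r j)) / 2)
      + (n \<bullet> n) * (5 / 2 * (\<Sum>j\<in>UNIV. (t j)\<^sup>2) + (\<Sum>j\<in>UNIV. t j * s j))" for t
    unfolding X_eq Y_eq by (simp add: field_simps)
  also have "\<dots> t = (2 * (\<Sum>j\<in>UNIV. c j \<bullet> c j)
        + (\<Sum>j\<in>UNIV. \<Sum>k\<in>UNIV. (c j \<odot> r k) \<bullet> (c k \<odot> r j)) / 2 - (n \<bullet> n) * ((\<Sum>j\<in>UNIV. (s j)\<^sup>2) / 10))
      + 5 / 2 * (n \<bullet> n) * (\<Sum>j\<in>UNIV. (t j - - 1 / 5 * s j)\<^sup>2)" for t
  proof -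
    have *: "5 / 2 * (\<Sum>j\<in>UNIV. (t j)\<^sup>2) + (\<Sum>j\<in>UNIV. t j * s j) =
        5 / 2 * (\<Sum>j\<in>UNIV. (t j - - 1 / 5 * s j)\<^sup>2) - (\<Sum>j\<in>UNIV. (s j)\<^sup>2) / 10"
      using square_complete[of "5/2" t] by simp
    show ?thesis unfolding * by (simp only: algebra_simps)
  qed
  finally show ?thesis unfolding b_def s_def by blast
qed

text \<open>Here \<open>X\<close> enters with the opposite sign: the quadratic coefficient is half
  of 4 - 1, and the reversed linear term moves the vertex to \<open>s j / 3\<close>.\<close>

lemma tensor_norm_alt_coeffs:
  "\<exists>C. \<forall>t. (\<Sum>j\<in>UNIV. \<Sum>k\<in>UNIV.
      ((1/2) *\<^sub>R ((c j + t j *\<^sub>R n) \<odot> r k - (c k + t k *\<^sub>R n) \<odot> r j)) \<bullet>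
      ((1/2) *\<^sub>R ((c j + t j *\<^sub>R n) \<odot> r k - (c k + t k *\<^sub>R n) \<odot> r j)))
    = C + 3 / 2 * (n \<bullet> n) * (\<Sum>j\<in>UNIV.
        (t j - 1 / 3 * (- ((n \<odot> r j) \<bullet> (\<Sum>k\<in>UNIV. c k \<odot> r k)) / (n \<bullet> n)))\<^sup>2)"
proof -
  have "(\<Sum>j\<in>UNIV. \<Sum>k\<in>UNIV. ((1/2) *\<^sub>R (b t j \<odot> r k - b t k \<odot> r j)) \<bullet> ((1/2) *\<^sub>R (b t j \<odot> r k - b t k \<odot> r j)))
    = Y t / 2 - X t / 2" for t
  proof -
    have "((1/2) *\<^sub>R (b t j \<odot> r k - b t k \<odot> r j)) \<bullet> ((1/2) *\<^sub>R (b t j \<odot> r k - b t k \<odot> r j))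
      = 1/4 * ((b t j \<odot> r k) \<bullet> (b t j \<odot> r k)) + 1/4 * ((b t k \<odot> r j) \<bullet> (b t k \<odot> r j))
       - 1/2 * ((b t j \<odot> r k) \<bullet> (b t k \<odot> r j))" for j k
      by (simp add: inner_diff_left inner_diff_right inner_commute field_simps)
    then have "(\<Sum>j\<in>UNIV. \<Sum>k\<in>UNIV. ((1/2) *\<^sub>R (b t j \<odot> r k - b t k \<odot> r j)) \<bullet> ((1/2) *\<^sub>R (b t j \<odot> r k - b t k \<odot> r j)))
      = 1/4 * Y t + 1/4 * (\<Sum>j\<in>UNIV. \<Sum>k\<in>UNIV. (b t k \<odot> r j) \<bullet> (b t k \<odot> r j)) - 1/2 * X t"
      unfolding Y_def X_def by (simp only: sum.distrib sum_subtractf sum_distrib_left)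
    also have "(\<Sum>j\<in>UNIV. \<Sum>k\<in>UNIV. (b t k \<odot> r j) \<bullet> (b t k \<odot> r j)) = Y t"
      unfolding Y_def by (rule sum_swap_sym)
    finally show ?thesis by simp
  qed
  also have "Y t / 2 - X t / 2 = (2 * (\<Sum>j\<in>UNIV. c j \<bullet> c j)
        - (\<Sum>j\<in>UNIV. \<Sum>k\<in>UNIV. (c j \<odot> r k) \<bullet> (c k \<odot> r j)) / 2)
      - (n \<bullet> n) * ((- 3 / 2) * (\<Sum>j\<in>UNIV. (t j)\<^sup>2) + (\<Sum>j\<in>UNIV. t j * s j))" for t
    unfolding X_eq Y_eq by (simp add: field_simps)
  also have "\<dots> t = (2 * (\<Sum>j\<in>UNIV. c j \<bullet> c j)
        - (\<Sum>j\<in>UNIV. \<Sum>k\<in>UNIV. (c j \<odot> r k) \<bullet> (c k \<odot> r j)) / 2 - (n \<bullet> n) * ((\<Sum>j\<in>UNIV. (s j)\<^sup>2) / 6))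
      + 3 / 2 * (n \<bullet> n) * (\<Sum>j\<in>UNIV. (t j - 1 / 3 * s j)\<^sup>2)" for t
  proof -
    have *: "- 3 / 2 * (\<Sum>j\<in>UNIV. (t j)\<^sup>2) + (\<Sum>j\<in>UNIV. t j * s j) =
        - (3 / 2 * (\<Sum>j\<in>UNIV. (t j - 1 / 3 * s j)\<^sup>2)) + (\<Sum>j\<in>UNIV. (s j)\<^sup>2) / 6"
      using square_complete[of "-3/2" t] by simp
    show ?thesis unfolding * by (simp add: algebra_simps)
  qed
  finally show ?thesis unfolding b_def s_def by blast
qed

text \<open>The vectors \<open>n \<odot> r j\<close> form an orthogonal basis of the quaternions.
  Tested against them, the equation decouples into four real equations, one for each unknown
  \<open>t j\<close>; this is where the spinor and the tangent space having equal real dimension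
  enters.\<close>

lemma dirac_vanishes_iff:
  "(\<Sum>k\<in>UNIV. (c k + t k *\<^sub>R n) \<odot> r k) = 0 \<longleftrightarrow>
    (\<forall>j. t j = - ((n \<odot> r j) \<bullet> (\<Sum>k\<in>UNIV. c k \<odot> r k)) / (n \<bullet> n))"
proof -
  let ?D = "\<Sum>k\<in>UNIV. c k \<odot> r k" and ?W = "\<Sum>k\<in>UNIV. (c k + t k *\<^sub>R n) \<odot> r k"
  have "(n \<odot> r j) \<bullet> ?W = (n \<odot> r j) \<bullet> ?D + (n \<bullet> n) * t j" for j
    by (simp add: qmul_add qmul_scaleR sum.distrib inner_add_right inner_sum_right qmul_inner r
        if_distrib mult.commute cong: if_cong)
  then have 1: "(n \<odot> r j) \<bullet> ?W = 0 \<longleftrightarrow> t j = - ((n \<odot> r j) \<bullet> ?D) / (n \<bullet> n)" for j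
    using nn by (simp add: field_simps) linarith
  have "?W = 0" if "\<And>j. (n \<odot> r j) \<bullet> ?W = 0"
  proof -
    \<comment> \<open>By adjointness the components of this quaternion in the frame \<open>r\<close>
      are the inner products assumed to vanish.\<close>
    have "qconj n \<odot> ?W = 0"
      by (subst orthonormal4_expand[of r, OF r]) (use that in \<open>simp add: qmul_inner_adjoint\<close>)
    moreover have "qconj n \<noteq> 0" using n by (auto simp: vec4_eq_iff)
    ultimately show ?thesis by (simp add: qmul_eq_0_iff)
  qed
  then show ?thesis using 1 by force
qed

end

section \<open>Unitary frames\<close>

text \<open>The Gram relations say that the matrix of \<open>E\<close> is inverse to the transposed
  frame matrix. The determinant identity serves to pass the orientation of a frame on to its
  coordinate map.\<close>

lemma frame_isometry:
  fixes f :: "4 \<Rightarrow> real^4" and gx :: "real^4 \<Rightarrow> real^4 \<Rightarrow> real"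
  assumes bil: "bilinear gx" and sym: "\<And>v w. gx v w = gx w v"
    and on: "\<And>j k. gx (f j) (f k) = (if j = k then 1 else 0)"
  defines "E \<equiv> \<lambda>v. (\<chi> k. gx (f k) v)"
  shows "linear E" "(\<Sum>k\<in>UNIV. gx (f k) v *\<^sub>R f k) = v" "E v \<bullet> E w = gx v w"
    "det (matrix E) * det ((\<chi> i. f i) :: real^4^4) = 1"
proof -
  have l: "linear (gx v)" for v using bil by (simp add: bilinear_def)
  show E: "linear E"
    unfolding E_def by (intro linearI) (simp_all add: vec_eq_iff linear_add[OF l] linear_scale[OF l])
  let ?F = "(\<chi> i. f i) :: real^4^4"
  have col: "matrix E *v v = E v" for v using matrix_vector_mul(2)[OF E] by metis
  have EF: "matrix E ** transpose ?F = mat 1"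
  proof -
    have "(matrix E ** transpose ?F) *v axis k 1 = axis k 1" for k
    proof -
      have h: "transpose ?F *v axis k 1 = f k"
        by (simp add: matrix_vector_mult_basis column_transpose row_def)
      then show ?thesis
        by (simp only: matrix_vector_mul_assoc[symmetric] h col) (simp add: E_def on axis_def vec_eq_iff)
    qed
    then have "column k (matrix E ** transpose ?F) = axis k 1" for k
      by (simp only: matrix_vector_mult_basis)
    then have "(matrix E ** transpose ?F) $ i $ k = axis k 1 $ i" for i k
      by (metis column_def vec_lambda_beta)
    then show ?thesis by (simp add: vec_eq_iff mat_def axis_def)
  qed
  show "det (matrix E) * det ?F = 1"
    using arg_cong[OF EF, of det] by (simp add: det_mul)
  have "transpose ?F ** matrix E = mat 1"
    using EF matrix_left_right_inverse by blast
  then have "transpose ?F *v E v = v" for v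
    by (metis col matrix_vector_mul_assoc matrix_vector_mul_lid)
  moreover have "transpose ?F *v E v = (\<Sum>k\<in>UNIV. gx (f k) v *\<^sub>R f k)" for v
    by (simp add: matrix_vector_mult_def transpose_def vec_eq_iff E_def mult.commute)
  ultimately show ex: "(\<Sum>k\<in>UNIV. gx (f k) v *\<^sub>R f k) = v" for v by metis
  have l': "linear (\<lambda>v. gx v w)" for w using bil by (simp add: bilinear_def)
  have "gx v w = gx (\<Sum>k\<in>UNIV. gx (f k) v *\<^sub>R f k) w" by (simp only: ex)
  also have "\<dots> = (\<Sum>k\<in>UNIV. gx (f k) v * gx (f k) w)"
    by (simp only: linear_sum[OF l'] linear_scale[OF l'] real_scaleR_def)
  finally show "E v \<bullet> E w = gx v w" by (simp add: E_def inner_vec_def)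
qed

text \<open>The frame \<open>onframe\<close> is chosen separately at each point without any
  continuity. Smoothness of the trace has to be read off in a smooth orthonormal frame, and this
  lemma permits the exchange.\<close>

lemma trace_orthonormal_independent:
  fixes e f :: "4 \<Rightarrow> real^4" and gx :: "real^4 \<Rightarrow> real^4 \<Rightarrow> real"
    and T :: "real^4 \<Rightarrow> real^4 \<Rightarrow> 'b::real_vector"
  assumes bil: "bilinear gx" and sym: "\<And>v w. gx v w = gx w v"
    and e: "\<And>j k. gx (e j) (e k) = (if j = k then 1 else 0)"
    and f: "\<And>j k. gx (f j) (f k) = (if j = k then 1 else 0)" and T: "bilinear T"
  shows "(\<Sum>k\<in>UNIV. T (e k) (e k)) = (\<Sum>k\<in>UNIV. T (f k) (f k))"
proof -
  have l: "linear (T v)" "linear (\<lambda>v. T v w)" for v w using T by (simp_all add: bilinear_def)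
  have m: "linear (gx v)" for v using bil by (simp add: bilinear_def)
  have "T (e k) (e k) = (\<Sum>i\<in>UNIV. \<Sum>j\<in>UNIV. (gx (f i) (e k) * gx (f j) (e k)) *\<^sub>R T (f i) (f j))" for k
  proof -
    have "T (e k) (e k) = T (\<Sum>i\<in>UNIV. gx (f i) (e k) *\<^sub>R f i) (\<Sum>j\<in>UNIV. gx (f j) (e k) *\<^sub>R f j)"
      by (simp only: frame_isometry(2)[OF bil sym f])
    also have "\<dots> = (\<Sum>i\<in>UNIV. gx (f i) (e k) *\<^sub>R T (f i) (\<Sum>j\<in>UNIV. gx (f j) (e k) *\<^sub>R f j))"
      by (simp only: linear_sum[OF l(2)] linear_scale[OF l(2)])
    also have "\<dots> = (\<Sum>i\<in>UNIV. gx (f i) (e k) *\<^sub>R (\<Sum>j\<in>UNIV. gx (f j) (e k) *\<^sub>R T (f i) (f j)))"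
      by (simp only: linear_sum[OF l(1)] linear_scale[OF l(1)])
    finally show ?thesis by (simp add: scaleR_sum_right)
  qed
  then have "(\<Sum>k\<in>UNIV. T (e k) (e k)) =
      (\<Sum>k\<in>UNIV. \<Sum>i\<in>UNIV. \<Sum>j\<in>UNIV. (gx (f i) (e k) * gx (f j) (e k)) *\<^sub>R T (f i) (f j))" by simp
  also have "\<dots> = (\<Sum>i\<in>UNIV. \<Sum>k\<in>UNIV. \<Sum>j\<in>UNIV. (gx (f i) (e k) * gx (f j) (e k)) *\<^sub>R T (f i) (f j))"
    by (rule sum.swap)
  also have "\<dots> = (\<Sum>i\<in>UNIV. \<Sum>j\<in>UNIV. \<Sum>k\<in>UNIV. (gx (f i) (e k) * gx (f j) (e k)) *\<^sub>R T (f i) (f j))"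
    by (rule sum.cong[OF refl], rule sum.swap)
  also have "\<dots> = (\<Sum>i\<in>UNIV. \<Sum>j\<in>UNIV. (if i = j then 1 else 0) *\<^sub>R T (f i) (f j))"
  proof (intro sum.cong refl)
    fix i j
    have "(if i = j then 1 else 0) = gx (f i) (f j)" by (simp add: f)
    also have "\<dots> = gx (f i) (\<Sum>k\<in>UNIV. gx (e k) (f j) *\<^sub>R e k)"
      by (simp only: frame_isometry(2)[OF bil sym e])
    also have "\<dots> = (\<Sum>k\<in>UNIV. gx (f i) (e k) * gx (f j) (e k))"
      by (simp only: linear_sum[OF m] linear_scale[OF m] real_scaleR_def sym[of "e _" "f j"]) (simp add: mult.commute)
    finally show "(\<Sum>k\<in>UNIV. (gx (f i) (e k) * gx (f j) (e k)) *\<^sub>R T (f i) (f j)) =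
        (if i = j then 1 else 0) *\<^sub>R T (f i) (f j)"
      by (simp only: scaleR_sum_left)
  qed
  also have "\<dots> = (\<Sum>i\<in>UNIV. T (f i) (f i))"
    by (simp add: if_distrib[of "\<lambda>c. c *\<^sub>R _"] cong: if_cong)
  finally show ?thesis .
qed

locale almost_hermitian_4manifold = oriented_4manifold \<A>
  for \<A> :: "'a::t2_space chart set" +
  fixes g :: "'a metric" and J :: "'a acs"
  assumes metric: "riemannian_metric \<A> g" and acs: "almost_complex_structure \<A> J"
    and compat: "compatible g J"
begin

lemma g_bilinear: "bilinear (g x)" and g_sym: "g x v w = g x w v" and g_pos: "v \<noteq> 0 \<Longrightarrow> g x v v > 0"
  using metric unfolding riemannian_metric_def by blast+

lemma g_linear: "linear (g x v)" "linear (\<lambda>v. g x v w)"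
  using g_bilinear by (auto simp: bilinear_def)

lemmas g_simps = linear_add[OF g_linear(1)] linear_add[OF g_linear(2)] linear_diff[OF g_linear(1)]
  linear_diff[OF g_linear(2)] linear_scale[OF g_linear(1)] linear_scale[OF g_linear(2)]
  linear_neg[OF g_linear(1)] linear_neg[OF g_linear(2)]

lemma smooth_g: "smooth_vf \<A> U X \<Longrightarrow> smooth_vf \<A> U Y \<Longrightarrow> smooth_fun \<A> U (\<lambda>x. g x (X x) (Y x))"
  using metric unfolding riemannian_metric_def by blast

lemma J_linear: "linear (J x)" and J_J [simp]: "J x (J x v) = - v"
  using acs unfolding almost_complex_structure_def endo_field_def by blast+

lemma smooth_J: "smooth_vf \<A> U X \<Longrightarrow> smooth_vf \<A> U (\<lambda>x. J x (X x))"
  using acs unfolding almost_complex_structure_def endo_field_def by blast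

lemma g_J: "g x (J x v) (J x w) = g x v w"
  using compat unfolding compatible_def by blast

lemma g_J_skew: "g x v (J x w) = - g x (J x v) w"
  using g_J[of x v "J x w"] by (simp add: g_simps)

lemma g_J_self: "g x v (J x v) = 0" "g x (J x v) v = 0"
  using g_J_skew[of x v v] g_sym[of x v "J x v"] by simp_all

lemma J_frame_det:
  assumes "det (vector [v, J x v, w, J x w] :: real^4^4) \<noteq> 0"
  shows "det (vector [v, J x v, w, J x w] :: real^4^4) > 0"
  using compat assms unfolding compatible_def Let_def by blast

lemma smooth_fun_pos_open:
  fixes h :: "'a \<Rightarrow> real"
  assumes "smooth_fun \<A> U h"
  shows "open {x \<in> U. h x > 0}"
proof (subst open_subopen, intro ballI)
  have *: "open {y \<in> U \<inter> fst c. h y > 0}" if c: "c \<in> \<A>" for c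
  proof -
    let ?S = "snd c ` (U \<inter> fst c)"
    have "continuous_on ?S (h \<circ> chart_inv c)"
      using smooth_fun_in_chart[OF assms c] unfolding smooth_on_def by (metis Ck_on.simps(1))
    moreover have "continuous_on (U \<inter> fst c) (snd c)"
      using homeomorphism_cont1[OF homeomorphism_chart[OF c]] continuous_on_subset by blast
    ultimately have "continuous_on (U \<inter> fst c) ((h \<circ> chart_inv c) \<circ> snd c)"
      by (rule continuous_on_compose[rotated])
    then have "continuous_on (U \<inter> fst c) h"
      by (rule continuous_on_eq) (use c in auto)
    moreover have "open (U \<inter> fst c)"
      using smooth_fun_open[OF assms] open_chart(1)[OF c] by blast
    ultimately have "open (h -` {0<..} \<inter> (U \<inter> fst c))"
      using continuous_on_open_vimage open_greaterThan by blast
    then show ?thesis by (simp add: vimage_def Int_def conj_ac cong: conj_cong)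
  qed
  show "\<exists>T. open T \<and> x \<in> T \<and> T \<subseteq> {x \<in> U. h x > 0}" if "x \<in> {x \<in> U. h x > 0}" for x
    using that chart_at[of x] *[OF chart_at(1)]
    by (intro exI[of _ "{y \<in> U \<inter> fst (chart_at \<A> x). h y > 0}"]) auto
qed

text \<open>Complex Gram-Schmidt: compatibility makes \<open>v\<close> and \<open>J v\<close>
  orthogonal of equal length, so each complex direction is normalized only once. The second
  direction is known to be nonzero only near \<open>x\<close>.\<close>

lemma ex_unitary_frame:
  "\<exists>U (f :: 4 \<Rightarrow> 'a vfield). x \<in> U \<and> (\<forall>k. smooth_vf \<A> U (f k)) \<and>
     (\<forall>y\<in>U. (\<forall>j k. g y (f j y) (f k y) = (if j = k then 1 else 0)) \<and>
       f 2 y = J y (f 1 y) \<and> f 4 y = J y (f 3 y))"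
proof -
  define c where "c = chart_at \<A> x"
  have c: "c \<in> \<A>" "x \<in> fst c" using chart_at unfolding c_def by auto
  define Y1 where "Y1 = coord_vf c (axis 1 1)"
  have Y1: "smooth_vf \<A> (fst c) Y1" unfolding Y1_def by (rule smooth_coord_vf[OF c(1)])
  have nz: "Y1 y \<noteq> 0" if "y \<in> fst c" for y
    using in_chart_coord_vf[OF c(1) that, of "axis 1 1"] linear_0[OF linear_in_chart[OF c(1) that]]
    by (auto simp: Y1_def axis_eq_0_iff)
  define f1 where "f1 y = inverse (sqrt (g y (Y1 y) (Y1 y))) *\<^sub>R Y1 y" for y
  have f1: "smooth_vf \<A> (fst c) f1"
    unfolding f1_def
    by (intro smooth_vf_scaleR[OF smooth_fun_inverse[OF smooth_fun_sqrt[OF smooth_g[OF Y1 Y1]]] Y1])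
      (use nz g_pos in \<open>auto simp: less_imp_neq[symmetric]\<close>)
  have f11: "g y (f1 y) (f1 y) = 1" if "y \<in> fst c" for y
    using g_pos[OF nz[OF that], of y] unfolding f1_def
    by (simp add: g_simps) (simp add: field_simps power2_eq_square[symmetric])
  \<comment> \<open>Two vectors do not span a space of dimension four. A coordinate field through
    \<open>w\<close> therefore has at \<open>x\<close> a nonzero component \<open>P\<close>
    orthogonal to the complex line of \<open>f1\<close>, and by openness the same holds
    nearby.\<close>
  obtain w where w: "w \<notin> span {f1 x, J x (f1 x)}"
  proof -
    have "dim {f1 x, J x (f1 x)} \<le> card {f1 x, J x (f1 x)}" by (rule dim_le_card') simp
    also have "\<dots> \<le> 2" by (simp add: card_insert_if)
    finally have "dim (span {f1 x, J x (f1 x)}) < DIM(real^4)" by (simp add: dim_span)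
    then have "span {f1 x, J x (f1 x)} \<noteq> UNIV" by (metis dim_UNIV less_irrefl)
    then show thesis using that by blast
  qed
  define Y2 where "Y2 = coord_vf c w"
  have Y2: "smooth_vf \<A> (fst c) Y2" unfolding Y2_def by (rule smooth_coord_vf[OF c(1)])
  have Y2x: "Y2 x = w" using coord_vf_in_chart[OF c, of w] by (simp add: Y2_def c_def in_chart_at)
  define P where "P y = Y2 y - (g y (f1 y) (Y2 y) *\<^sub>R f1 y + g y (J y (f1 y)) (Y2 y) *\<^sub>R J y (f1 y))" for y
  have P: "smooth_vf \<A> (fst c) P"
    unfolding P_def
    by (intro smooth_vf_diff smooth_vf_add smooth_vf_scaleR smooth_g smooth_J f1 Y2)
  have Px: "P x \<noteq> 0"
  proof
    assume "P x = 0"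
    then have "w = g x (f1 x) w *\<^sub>R f1 x + g x (J x (f1 x)) w *\<^sub>R J x (f1 x)" by (simp add: P_def Y2x)
    then show False using w by (metis insertI1 insert_iff span_add span_base span_scale)
  qed
  define U where "U = {y \<in> fst c. g y (P y) (P y) > 0}"
  have U: "open U" "U \<subseteq> fst c" "x \<in> U"
    using smooth_fun_pos_open[OF smooth_g[OF P P]] c g_pos[OF Px] unfolding U_def by auto
  define f3 where "f3 y = inverse (sqrt (g y (P y) (P y))) *\<^sub>R P y" for y
  have PU: "smooth_vf \<A> U P" by (rule smooth_vf_subset[OF P U(1,2)])
  have f3: "smooth_vf \<A> U f3"
    unfolding f3_def
    by (intro smooth_vf_scaleR[OF smooth_fun_inverse[OF smooth_fun_sqrt[OF smooth_g[OF PU PU]]] PU])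
      (auto simp: U_def)
  have f1U: "smooth_vf \<A> U f1" by (rule smooth_vf_subset[OF f1 U(1,2)])
  define f where "f k = (if k = 1 then f1 else if k = 2 then (\<lambda>y. J y (f1 y)) else
    if k = 3 then f3 else (\<lambda>y. J y (f3 y)))" for k :: 4
  have "smooth_vf \<A> U (f k)" for k
    unfolding f_def using f1U f3 smooth_J by auto
  moreover have "(\<forall>j k. g y (f j y) (f k y) = (if j = k then 1 else 0)) \<and>
       f 2 y = J y (f 1 y) \<and> f 4 y = J y (f 3 y)" if y: "y \<in> U" for y
  proof -
    have 11: "g y (f1 y) (f1 y) = 1" using f11 y U by blast
    have 33: "g y (f3 y) (f3 y) = 1"
      using y unfolding f3_def U_def
      by (simp add: g_simps) (simp add: field_simps power2_eq_square[symmetric])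
    have "g y (f1 y) (P y) = 0" "g y (J y (f1 y)) (P y) = 0"
      unfolding P_def by (simp_all add: g_simps 11 g_J g_J_self)
    then have 13: "g y (f1 y) (f3 y) = 0" "g y (J y (f1 y)) (f3 y) = 0"
      by (simp_all add: f3_def g_simps)
    have 14: "g y (f1 y) (J y (f3 y)) = 0" "g y (J y (f1 y)) (J y (f3 y)) = 0"
      using 13 g_J[of y "f1 y" "f3 y"] g_J_skew[of y "f1 y" "f3 y"] by simp_all
    have s: "g y (f3 y) (f1 y) = 0" "g y (f3 y) (J y (f1 y)) = 0" "g y (J y (f3 y)) (f1 y) = 0"
      "g y (J y (f3 y)) (J y (f1 y)) = 0"
      using 13 14 g_sym by metis+
    have f': "f 1 = f1" "f 2 = (\<lambda>y. J y (f1 y))" "f 3 = f3" "f 4 = (\<lambda>y. J y (f3 y))"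
      by (simp_all add: f_def)
    show ?thesis
      by (simp add: forall_4 f' 11 33 13 14 s g_J g_J_self)
  qed
  ultimately show ?thesis using U(3) by (intro exI[of _ U] exI[of _ f]) blast
qed

lemma ex_U2_chart: "\<exists>U E. x \<in> U \<and> U2_chart \<A> g J U E"
proof -
  obtain U and f :: "4 \<Rightarrow> 'a vfield" where U: "x \<in> U" and sm: "\<And>k. smooth_vf \<A> U (f k)"
    and on: "\<And>y j k. y \<in> U \<Longrightarrow> g y (f j y) (f k y) = (if j = k then 1 else 0)"
    and fJ: "\<And>y. y \<in> U \<Longrightarrow> f 2 y = J y (f 1 y)" "\<And>y. y \<in> U \<Longrightarrow> f 4 y = J y (f 3 y)"
    using ex_unitary_frame[of x] by blast
  define E where "E y v = (\<chi> k. g y (f k y) v)" for y v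
  have "U2_chart \<A> g J U E"
    unfolding U2_chart_def
  proof (intro conjI ballI allI impI)
    show "open U" using sm smooth_vf_open by blast
    fix y assume y: "y \<in> U"
    note fr = frame_isometry[OF g_bilinear g_sym on[OF y], folded E_def]
    have "(\<chi> i. f i y) = (vector [f 1 y, J y (f 1 y), f 3 y, J y (f 3 y)] :: real^4^4)"
      using fJ[OF y] by (simp add: vec_eq_iff forall_4)
    \<comment> \<open>The product of determinants in \<open>fr(4)\<close> is 1, so this one is
      nonzero, and compatibility decides its sign.\<close>
    then have "det ((\<chi> i. f i y) :: real^4^4) > 0"
      using J_frame_det fr(4) by (metis mult_zero_right zero_neq_one)
    then have "det (matrix (E y)) > 0"
      using fr(4) by (metis zero_less_mult_pos2 zero_less_one)
    then show "oriented_isometry (g y) (E y)"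
      unfolding oriented_isometry_def using fr(1,3) by blast
    show "E y (J y v) = qi \<odot> E y v" for v
      by (simp add: vec4_eq_iff E_def qmul_nth fJ[OF y] g_J_skew g_simps)
  next
    fix V X assume "V \<subseteq> U \<and> smooth_vf \<A> V X"
    then have V: "V \<subseteq> U" "smooth_vf \<A> V X" "open V" using smooth_vf_open by auto
    have "smooth_fun \<A> V (\<lambda>x. \<Sum>k\<in>UNIV. g x (f k x) (X x) *\<^sub>R axis k 1 :: quat)"
      by (intro smooth_fun_sum smooth_fun_scaleR smooth_fun_const smooth_g smooth_vf_subset[OF sm] V)
    moreover have "(\<Sum>k\<in>UNIV. g x (f k x) (X x) *\<^sub>R axis k 1 :: quat) = E x (X x)" for x
      by (simp add: E_def vec4_eq_iff sum_4 axis_def)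
    ultimately show "smooth_fun \<A> V (\<lambda>x. E x (X x))" by simp
  qed
  then show ?thesis using U by blast
qed

section \<open>Coordinates and their inverses in a U(2)-chart\<close>

context
  fixes U E assumes ch: "U2_chart \<A> g J U E"
begin

lemma U2_open: "open U" using ch by (simp add: U2_chart_def)

lemma smooth_U2: "smooth_vf \<A> V X \<Longrightarrow> V \<subseteq> U \<Longrightarrow> smooth_fun \<A> V (\<lambda>x. E x (X x))"
  using ch unfolding U2_chart_def by blast

lemma U2_isometry: "x \<in> U \<Longrightarrow> oriented_isometry (g x) (E x)"
  using ch unfolding U2_chart_def by blast

lemma U2_linear: "x \<in> U \<Longrightarrow> linear (E x)"
  and U2_inner: "x \<in> U \<Longrightarrow> E x v \<bullet> E x w = g x v w"
  using U2_isometry unfolding oriented_isometry_def by blast+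

lemma U2_J: "x \<in> U \<Longrightarrow> E x (J x v) = qi \<odot> E x v"
  using ch unfolding U2_chart_def by blast

lemma U2_inj: "x \<in> U \<Longrightarrow> inj (E x)"
  unfolding linear_injective_0[OF U2_linear]
  by (metis U2_inner g_pos inner_zero_left less_irrefl)

lemma U2_bij: "x \<in> U \<Longrightarrow> bij (E x)"
  using U2_inj linear_injective_imp_surjective[OF U2_linear] by (auto simp: bij_def)

lemma U2_inv [simp]: "x \<in> U \<Longrightarrow> E x (inv (E x) q) = q" "x \<in> U \<Longrightarrow> inv (E x) (E x v) = v"
  using U2_bij[of x] U2_inj[of x] by (simp_all add: surj_f_inv_f bij_is_surj)

text \<open>Smoothness of a chart is a condition on images of vector fields. Its inverse is
  controlled by expanding in an unrelated smooth orthonormal frame: the coefficients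
  \<open>E y (f k y) \<bullet> q\<close> are visibly smooth, and no matrix has to be inverted
  smoothly.\<close>

lemma smooth_U2_inv_const: "smooth_vf \<A> U (\<lambda>x. inv (E x) q)"
proof (rule smooth_vf_local[OF U2_open])
  fix x assume x: "x \<in> U"
  obtain W and f :: "4 \<Rightarrow> 'a vfield" where W: "x \<in> W" and sm: "\<And>k. smooth_vf \<A> W (f k)"
    and on: "\<And>y j k. y \<in> W \<Longrightarrow> g y (f j y) (f k y) = (if j = k then 1 else 0)"
    using ex_unitary_frame[of x] by blast
  define V where "V = U \<inter> W"
  have V: "open V" "V \<subseteq> U" "V \<subseteq> W" "x \<in> V" using W x U2_open smooth_vf_open[OF sm] by (auto simp: V_def)
  have fV: "smooth_vf \<A> V (f k)" for k by (rule smooth_vf_subset[OF sm V(1,3)])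
  have "smooth_vf \<A> V (\<lambda>y. \<Sum>k\<in>UNIV. (E y (f k y) \<bullet> q) *\<^sub>R f k y)"
    by (intro smooth_vf_sum V(1) smooth_vf_scaleR fV
        smooth_fun_bilinear[OF bounded_bilinear_inner] smooth_fun_const smooth_U2 V(2))
  moreover have "(\<Sum>k\<in>UNIV. (E y (f k y) \<bullet> q) *\<^sub>R f k y) = inv (E y) q" if y: "y \<in> V" for y
  proof -
    have "E y (f k y) \<bullet> q = g y (f k y) (inv (E y) q)" for k
      using U2_inner[of y "f k y" "inv (E y) q"] y V by auto
    then show ?thesis using frame_isometry(2)[OF g_bilinear g_sym on, of y] y V by auto
  qed
  ultimately have "smooth_vf \<A> V (\<lambda>y. inv (E y) q)" by (rule smooth_vf_cong)
  then show "\<exists>V. x \<in> V \<and> smooth_vf \<A> V (\<lambda>x. inv (E x) q)" using V(4) by blast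
qed

lemma U2_inv_linear:
  assumes x: "x \<in> U"
  shows "linear (inv (E x))"
proof (rule linearI)
  fix p q and k :: real
  have "E x (inv (E x) (p + q)) = E x (inv (E x) p + inv (E x) q)"
    using x by (simp add: linear_add[OF U2_linear[OF x]])
  then show "inv (E x) (p + q) = inv (E x) p + inv (E x) q" by (rule injD[OF U2_inj[OF x]])
  have "E x (inv (E x) (k *\<^sub>R p)) = E x (k *\<^sub>R inv (E x) p)"
    using x by (simp add: linear_scale[OF U2_linear[OF x]])
  then show "inv (E x) (k *\<^sub>R p) = k *\<^sub>R inv (E x) p" by (rule injD[OF U2_inj[OF x]])
qed

lemma U2_inv_expand: "x \<in> U \<Longrightarrow> inv (E x) q = (\<Sum>k\<in>UNIV. q $ k *\<^sub>R inv (E x) (axis k 1))"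
proof -
  assume x: "x \<in> U"
  have "q = (\<Sum>k\<in>UNIV. q $ k *\<^sub>R axis k 1)" by (simp add: vec4_eq_iff sum_4 axis_def)
  then have "inv (E x) q = inv (E x) (\<Sum>k\<in>UNIV. q $ k *\<^sub>R axis k 1)" by simp
  then show ?thesis by (simp only: linear_sum[OF U2_inv_linear[OF x]] linear_scale[OF U2_inv_linear[OF x]])
qed

lemma smooth_U2_inv:
  assumes "smooth_fun \<A> V h" "V \<subseteq> U"
  shows "smooth_vf \<A> V (\<lambda>x. inv (E x) (h x))"
proof (rule smooth_vf_cong)
  have V: "open V" using assms smooth_fun_open by blast
  show "smooth_vf \<A> V (\<lambda>x. \<Sum>k\<in>UNIV. (h x $ k) *\<^sub>R inv (E x) (axis k 1))"
    by (intro smooth_vf_sum V smooth_vf_scaleR smooth_fun_blinear[OF bounded_linear_vec_nth]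
        smooth_vf_subset[OF smooth_U2_inv_const V] assms)
qed (use assms U2_inv_expand[symmetric] in auto)

lemma smooth_at_U2:
  assumes "smooth_vf_at x Y" "x \<in> U"
  shows "smooth_at x (\<lambda>y. E y (Y y))"
proof -
  obtain V where V: "open V" "x \<in> V" "smooth_vf \<A> V Y" using assms unfolding near_def by blast
  have "smooth_fun \<A> (V \<inter> U) (\<lambda>y. E y (Y y))"
    by (rule smooth_U2[OF smooth_vf_subset[OF V(3)]]) (use V U2_open in auto)
  then show ?thesis by (rule smooth_atI) (use V assms in auto)
qed

end

end

section \<open>The determinant line\<close>

locale spin_geometry = almost_hermitian_4manifold \<A> g J
  for \<A> :: "'a::t2_space chart set" and g :: "'a metric" and J :: "'a acs" +
  fixes D :: "'a tconn"
  assumes lc: "levi_civita \<A> g D"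
begin

section \<open>Rules for the Levi-Civita connection and its complex part\<close>

lemma affine_D: "affine_connection \<A> D" and metric_D: "metric_connection \<A> g D"
  using lc unfolding levi_civita_def by auto

lemma D_linear: "smooth_vf_at x Y \<Longrightarrow> linear (\<lambda>v. D x v Y)"
  using affine_D unfolding affine_connection_def by blast

lemma D_add: "smooth_vf_at x Y \<Longrightarrow> smooth_vf_at x Z \<Longrightarrow> D x v (\<lambda>y. Y y + Z y) = D x v Y + D x v Z"
  using affine_D unfolding affine_connection_def by blast

lemma D_leibniz:
  "smooth_at x f \<Longrightarrow> smooth_vf_at x Y \<Longrightarrow>
    D x v (\<lambda>y. f y *\<^sub>R Y y) = dirderiv \<A> f x v *\<^sub>R Y x + f x *\<^sub>R D x v Y"
  using affine_D unfolding affine_connection_def by blast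

lemma smooth_D: "smooth_vf \<A> U X \<Longrightarrow> smooth_vf \<A> U Y \<Longrightarrow> smooth_vf \<A> U (\<lambda>x. D x (X x) Y)"
  using affine_D unfolding affine_connection_def by blast

lemma D_metric:
  "smooth_vf_at x Y \<Longrightarrow> smooth_vf_at x Z \<Longrightarrow>
    dirderiv \<A> (\<lambda>y. g y (Y y) (Z y)) x v = g x (D x v Y) (Z x) + g x (Y x) (D x v Z)"
  using metric_D unfolding metric_connection_def by blast

text \<open>The indicator function of \<open>V\<close> is constant near \<open>x\<close>, so the
  Leibniz rule at \<open>x\<close> accepts it as a cutoff. After multiplication by it the two fields
  agree everywhere.\<close>

lemma D_local:
  assumes Y: "smooth_vf_at x Y" and Z: "smooth_vf_at x Z"
    and V: "open V" "x \<in> V" "\<And>y. y \<in> V \<Longrightarrow> Y y = Z y"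
  shows "D x v Y = D x v Z"
proof -
  define f :: "'a \<Rightarrow> real" where "f y = (if y \<in> V then 1 else 0)" for y
  have f: "smooth_at x f"
    by (rule smooth_atI[OF smooth_fun_cong[OF smooth_fun_const[OF V(1), of 1]]]) (use V in \<open>auto simp: f_def\<close>)
  have df: "dirderiv \<A> f x v = 0"
    using dirderiv_cong[OF V(1,2), of f "\<lambda>y. 1"] dirderiv_const by (simp add: f_def)
  have "D x v (\<lambda>y. f y *\<^sub>R Y y) = D x v Y" "D x v (\<lambda>y. f y *\<^sub>R Z y) = D x v Z"
    using D_leibniz[OF f Y] D_leibniz[OF f Z] df V(2) by (simp_all add: f_def)
  moreover have "(\<lambda>y. f y *\<^sub>R Y y) = (\<lambda>y. f y *\<^sub>R Z y)" using V(3) by (auto simp: f_def)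
  ultimately show ?thesis by simp
qed

lemma smooth_vf_at_J: "smooth_vf_at x Y \<Longrightarrow> smooth_vf_at x (\<lambda>y. J y (Y y))"
  unfolding near_def using smooth_J by blast

text \<open>The \<open>J\<close>-complex part of the Levi-Civita connection. It and the connection \<open>conn_J\<close> that it induces on
  the determinant line serve as chart-free base points.\<close>

definition nabla_J :: "'a \<Rightarrow> real^4 \<Rightarrow> 'a vfield \<Rightarrow> real^4" where
  "nabla_J x u Y = (1/2) *\<^sub>R (D x u Y - J x (D x u (\<lambda>y. J y (Y y))))"

lemma smooth_nabla_J: "smooth_vf \<A> U X \<Longrightarrow> smooth_vf \<A> U Y \<Longrightarrow> smooth_vf \<A> U (\<lambda>x. nabla_J x (X x) Y)"
  unfolding nabla_J_def
  by (intro smooth_vf_scaleR smooth_fun_const smooth_vf_diff smooth_J smooth_D smooth_vf_open[of U X])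

lemma nabla_J_linear:
  assumes "smooth_vf_at x Y"
  shows "linear (\<lambda>u. nabla_J x u Y)"
  unfolding nabla_J_def
  using D_linear[OF assms] D_linear[OF smooth_vf_at_J[OF assms]] J_linear[of x]
  by (simp add: linear_iff algebra_simps)

text \<open>The connection matrix of \<open>D\<close>: its columns are the derivatives of the frame
  that the chart carries to the standard basis.\<close>

definition LC_matrix :: "'a \<Rightarrow> ('a \<Rightarrow> real^4 \<Rightarrow> quat) \<Rightarrow> real^4 \<Rightarrow> quat \<Rightarrow> quat" where
  "LC_matrix x E u y = (\<Sum>k\<in>UNIV. y $ k *\<^sub>R E x (D x u (\<lambda>z. inv (E z) (axis k 1))))"

abbreviation ksec_at :: "'a \<Rightarrow> ('a \<Rightarrow> cbivector) \<Rightarrow> bool" where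
  "ksec_at x s \<equiv> near (\<lambda>U. smooth_Ksec \<A> J U s) x"

section \<open>Fibers and smooth sections of the determinant line\<close>

lemma K_fiber_combination:
  assumes "\<omega> \<in> K_fiber j" "\<eta> \<in> K_fiber j"
  shows "(\<lambda>v w. a * \<omega> v w + b * \<eta> v w) \<in> K_fiber j"
proof -
  have l: "linear (\<lambda>w. \<omega> v w)" "linear (\<lambda>v. \<omega> v w)" "linear (\<lambda>w. \<eta> v w)" "linear (\<lambda>v. \<eta> v w)" for v w
    using assms unfolding K_fiber_def bilinear_def by auto
  have "bilinear (\<lambda>v w. a * \<omega> v w + b * \<eta> v w)"
    unfolding bilinear_def
    by (auto intro!: linearI simp: l[THEN linear_add] l[THEN linear_scale] algebra_simps)
  then show ?thesis using assms unfolding K_fiber_def by (auto simp: algebra_simps)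
qed

lemma Kstar_fiber_add: "z \<in> Kstar_fiber j \<Longrightarrow> z' \<in> Kstar_fiber j \<Longrightarrow> (\<lambda>\<omega>. z \<omega> + z' \<omega>) \<in> Kstar_fiber j"
  unfolding Kstar_fiber_def by (auto simp: algebra_simps)

lemma Kstar_fiber_mult: "z \<in> Kstar_fiber j \<Longrightarrow> (\<lambda>\<omega>. c * z \<omega>) \<in> Kstar_fiber j"
  unfolding Kstar_fiber_def by (auto simp: algebra_simps)

lemma cwedge_Kstar: "cwedge j v w \<in> Kstar_fiber j"
  unfolding Kstar_fiber_def cwedge_def by (auto simp: K_fiber_combination)

lemma smooth_Ksec_open: "smooth_Ksec \<A> J U s \<Longrightarrow> open U"
  by (simp add: smooth_Ksec_def)

lemma smooth_Ksec_subset: "smooth_Ksec \<A> J U s \<Longrightarrow> open V \<Longrightarrow> V \<subseteq> U \<Longrightarrow> smooth_Ksec \<A> J V s"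
  unfolding smooth_Ksec_def by (meson subset_iff)

lemma smooth_Kform_subset: "smooth_Kform \<A> J U s \<Longrightarrow> open V \<Longrightarrow> V \<subseteq> U \<Longrightarrow> smooth_Kform \<A> J V s"
  unfolding smooth_Kform_def by (meson subset_iff)

lemma smooth_KsecD:
  "smooth_Ksec \<A> J U s \<Longrightarrow> V \<subseteq> U \<Longrightarrow> smooth_Kform \<A> J V \<omega> \<Longrightarrow> smooth_fun \<A> V (\<lambda>x. s x (\<omega> x))"
  unfolding smooth_Ksec_def by blast

lemma smooth_Ksec_local:
  assumes "open U" "\<And>x. x \<in> U \<Longrightarrow> \<exists>V. x \<in> V \<and> smooth_Ksec \<A> J V s"
  shows "smooth_Ksec \<A> J U s"
  unfolding smooth_Ksec_def
proof (intro conjI ballI allI impI)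
  show "s x \<in> Kstar_fiber (J x)" if "x \<in> U" for x
    using assms(2)[OF that] unfolding smooth_Ksec_def by blast
  fix W \<omega> assume W: "W \<subseteq> U \<and> smooth_Kform \<A> J W \<omega>"
  show "smooth_fun \<A> W (\<lambda>x. s x (\<omega> x))"
  proof (rule smooth_fun_local)
    show "open W" using W unfolding smooth_Kform_def by blast
    fix x assume x: "x \<in> W"
    then obtain V where V: "x \<in> V" "smooth_Ksec \<A> J V s" using assms(2) W by blast
    then have "open (V \<inter> W)" using \<open>open W\<close> smooth_Ksec_open by blast
    then have "smooth_fun \<A> (V \<inter> W) (\<lambda>x. s x (\<omega> x))"
      using smooth_KsecD[OF V(2), of "V \<inter> W" \<omega>] smooth_Kform_subset[of W \<omega> "V \<inter> W"] W by blast
    then show "\<exists>V. x \<in> V \<and> smooth_fun \<A> V (\<lambda>x. s x (\<omega> x))" using V x by blast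
  qed
qed (rule assms)

lemma smooth_Ksec_cong:
  assumes "smooth_Ksec \<A> J U s" "\<And>x. x \<in> U \<Longrightarrow> s x = t x"
  shows "smooth_Ksec \<A> J U t"
  unfolding smooth_Ksec_def
proof (intro conjI ballI allI impI)
  show "open U" using assms smooth_Ksec_open by blast
  show "t x \<in> Kstar_fiber (J x)" if "x \<in> U" for x
    using assms that unfolding smooth_Ksec_def by metis
  fix W \<omega> assume W: "W \<subseteq> U \<and> smooth_Kform \<A> J W \<omega>"
  show "smooth_fun \<A> W (\<lambda>x. t x (\<omega> x))"
    by (rule smooth_fun_cong[OF smooth_KsecD[OF assms(1), of W \<omega>]]) (use W assms(2) in auto)
qed

lemma smooth_Ksec_add:
  assumes "smooth_Ksec \<A> J U s" "smooth_Ksec \<A> J U t"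
  shows "smooth_Ksec \<A> J U (\<lambda>x \<omega>. s x \<omega> + t x \<omega>)"
  unfolding smooth_Ksec_def
proof (intro conjI ballI allI impI)
  show "open U" using assms smooth_Ksec_open by blast
  show "(\<lambda>\<omega>. s x \<omega> + t x \<omega>) \<in> Kstar_fiber (J x)" if "x \<in> U" for x
    by (rule Kstar_fiber_add) (use assms that in \<open>simp_all add: smooth_Ksec_def\<close>)
  fix W \<omega> assume W: "W \<subseteq> U \<and> smooth_Kform \<A> J W \<omega>"
  show "smooth_fun \<A> W (\<lambda>x. s x (\<omega> x) + t x (\<omega> x))"
    by (rule smooth_fun_add; rule smooth_KsecD) (use W assms in auto)
qed

lemma smooth_Ksec_mult:
  assumes "smooth_fun \<A> U (f :: 'a \<Rightarrow> complex)" "smooth_Ksec \<A> J U t"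
  shows "smooth_Ksec \<A> J U (\<lambda>x \<omega>. f x * t x \<omega>)"
  unfolding smooth_Ksec_def
proof (intro conjI ballI allI impI)
  show "open U" using assms smooth_Ksec_open by blast
  show "(\<lambda>\<omega>. f x * t x \<omega>) \<in> Kstar_fiber (J x)" if "x \<in> U" for x
    by (rule Kstar_fiber_mult) (use assms that in \<open>simp_all add: smooth_Ksec_def\<close>)
  fix W \<omega> assume W: "W \<subseteq> U \<and> smooth_Kform \<A> J W \<omega>"
  then have "open W" by (simp add: smooth_Kform_def)
  then have "smooth_fun \<A> W f" using smooth_fun_subset[OF assms(1)] W by blast
  moreover have "smooth_fun \<A> W (\<lambda>x. t x (\<omega> x))" using smooth_KsecD[OF assms(2)] W by blast
  ultimately show "smooth_fun \<A> W (\<lambda>x. f x * t x (\<omega> x))" by (rule smooth_fun_mult)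
qed

lemma smooth_Ksec_cwedge:
  assumes "smooth_vf \<A> U X" "smooth_vf \<A> U Y"
  shows "smooth_Ksec \<A> J U (\<lambda>x. cwedge (J x) (X x) (Y x))"
  unfolding smooth_Ksec_def
proof (intro conjI ballI allI impI)
  show "open U" using assms smooth_vf_open by blast
  show "cwedge (J x) (X x) (Y x) \<in> Kstar_fiber (J x)" for x by (rule cwedge_Kstar)
  fix W \<omega> assume W: "W \<subseteq> U \<and> smooth_Kform \<A> J W \<omega>"
  then have "open W" by (simp add: smooth_Kform_def)
  then have "smooth_fun \<A> W (\<lambda>x. \<omega> x (X x) (Y x))"
    using W smooth_vf_subset[OF assms(1)] smooth_vf_subset[OF assms(2)] unfolding smooth_Kform_def by blast
  then show "smooth_fun \<A> W (\<lambda>x. cwedge (J x) (X x) (Y x) (\<omega> x))"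
    by (rule smooth_fun_cong) (use W in \<open>auto simp: cwedge_def smooth_Kform_def\<close>)
qed

lemma ksec_atI: "smooth_Ksec \<A> J U s \<Longrightarrow> x \<in> U \<Longrightarrow> ksec_at x s"
  unfolding near_def using smooth_Ksec_open by blast

lemma ksec_at2:
  assumes "ksec_at x s" "ksec_at x t"
  obtains U where "open U" "x \<in> U" "smooth_Ksec \<A> J U s" "smooth_Ksec \<A> J U t"
proof -
  obtain V W where "open V" "x \<in> V" "smooth_Ksec \<A> J V s" "open W" "x \<in> W" "smooth_Ksec \<A> J W t"
    using assms unfolding near_def by blast
  then show ?thesis
    using smooth_Ksec_subset[of V s "V \<inter> W"] smooth_Ksec_subset[of W t "V \<inter> W"]
    by (intro that[of "V \<inter> W"]) auto
qed

lemma ksec_at_add: "ksec_at x s \<Longrightarrow> ksec_at x t \<Longrightarrow> ksec_at x (\<lambda>x \<omega>. s x \<omega> + t x \<omega>)"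
  by (erule (1) ksec_at2) (rule ksec_atI[OF smooth_Ksec_add])

lemma ksec_at_mult:
  assumes "smooth_at x f" "ksec_at x t"
  shows "ksec_at x (\<lambda>x \<omega>. f x * t x \<omega>)"
proof -
  obtain V W where "open V" "x \<in> V" "smooth_fun \<A> V f" "open W" "x \<in> W" "smooth_Ksec \<A> J W t"
    using assms unfolding near_def by blast
  then show ?thesis
    using smooth_fun_subset[of V f "V \<inter> W"] smooth_Ksec_subset[of W t "V \<inter> W"]
    by (intro ksec_atI[of "V \<inter> W"] smooth_Ksec_mult) auto
qed

lemma ksec_at_Kstar: "ksec_at x s \<Longrightarrow> s x \<in> Kstar_fiber (J x)"
  unfolding near_def smooth_Ksec_def by blast

text \<open>In complex rank two every section of the determinant line is decomposable near a given
  point. Differentiating the factors then needs no chart.\<close>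

definition wedge_rep :: "'a \<Rightarrow> ('a \<Rightarrow> cbivector) \<Rightarrow> 'a vfield \<Rightarrow> 'a vfield \<Rightarrow> bool" where
  "wedge_rep x s X1 X2 \<longleftrightarrow> smooth_vf_at x X1 \<and> smooth_vf_at x X2 \<and>
     (\<exists>V. open V \<and> x \<in> V \<and> (\<forall>y\<in>V. s y = cwedge (J y) (X1 y) (X2 y)))"

text \<open>The Leibniz rule for a wedge, applied to some decomposition. That the result is the same
  for all of them is \<open>conn_J_wedge\<close>.\<close>

definition conn_J :: "'a \<Rightarrow> real^4 \<Rightarrow> ('a \<Rightarrow> cbivector) \<Rightarrow> cbivector" where
  "conn_J x u s = (SOME c. \<exists>X1 X2. wedge_rep x s X1 X2 \<and>
     c = (\<lambda>\<omega>. cwedge (J x) (nabla_J x u X1) (X2 x) \<omega> + cwedge (J x) (X1 x) (nabla_J x u X2) \<omega>))"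

definition cq :: "complex \<Rightarrow> quat" where "cq c = Re c *\<^sub>R q1 + Im c *\<^sub>R qi"

lemma cdet_cq: "cdet (cq c) qj = c"
  by (simp add: cq_def cdet_simps)

lemma bounded_linear_cq: "bounded_linear cq"
  unfolding linear_conv_bounded_linear[symmetric] by (intro linearI) (simp_all add: cq_def algebra_simps)

section \<open>Connections on the tangent bundle and the determinant line, in a U(2)-chart\<close>

context
  fixes U E assumes ch: "U2_chart \<A> g J U E"
begin

lemma smooth_vf_at_U2_inv: "x \<in> U \<Longrightarrow> smooth_vf_at x (\<lambda>z. inv (E z) q)"
  by (rule smooth_vf_atI[OF smooth_U2_inv_const[OF ch]])

text \<open>Expand \<open>Y\<close> in the frame of the chart; the Leibniz rule separates
  derivatives of the coefficients from derivatives of the frame. The expansion holds on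
  \<open>U\<close> only, hence the appeal to \<open>D_local\<close>.\<close>

lemma D_chart:
  assumes x: "x \<in> U" and Y: "smooth_vf_at x Y"
  shows "E x (D x u Y) = dirderiv \<A> (\<lambda>y. E y (Y y)) x u + LC_matrix x E u (E x (Y x))"
proof -
  define F where "F k = (\<lambda>z. inv (E z) (axis k 1 :: quat))" for k :: 4
  define h where "h k = (\<lambda>y. E y (Y y) $ k)" for k :: 4
  have EY: "smooth_at x (\<lambda>y. E y (Y y))" by (rule smooth_at_U2[OF ch Y x])
  have h: "smooth_at x (h k)" for k
    unfolding h_def by (rule smooth_at_blinear[OF bounded_linear_vec_nth EY])
  have F: "smooth_vf_at x (F k)" for k
    unfolding F_def by (rule smooth_vf_at_U2_inv[OF x])
  have hF: "smooth_vf_at x (\<lambda>y. h k y *\<^sub>R F k y)" for k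
    by (rule smooth_vf_at_scaleR[OF h F])
  let ?Z = "\<lambda>y. h 1 y *\<^sub>R F 1 y + (h 2 y *\<^sub>R F 2 y + (h 3 y *\<^sub>R F 3 y + h 4 y *\<^sub>R F 4 y))"
  have "D x u Y = D x u ?Z"
  proof (rule D_local[OF Y _ U2_open[OF ch] x])
    show "smooth_vf_at x ?Z" by (intro smooth_vf_at_add hF)
    show "Y y = ?Z y" if "y \<in> U" for y
      using U2_inv_expand[OF ch that, of "E y (Y y)"] U2_inv(2)[OF ch that]
      by (simp add: sum_4 h_def F_def add.assoc)
  qed
  also have "\<dots> = (\<Sum>k\<in>UNIV. dirderiv \<A> (h k) x u *\<^sub>R F k x + h k x *\<^sub>R D x u (F k))"
    by (simp add: D_add smooth_vf_at_add hF D_leibniz h F sum_4 add.assoc)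
  also have "E x \<dots> = (\<Sum>k\<in>UNIV. dirderiv \<A> (h k) x u *\<^sub>R axis k 1) + LC_matrix x E u (E x (Y x))"
    by (simp add: linear_sum[OF U2_linear[OF ch x]] linear_add[OF U2_linear[OF ch x]]
        linear_scale[OF U2_linear[OF ch x]] sum.distrib LC_matrix_def F_def h_def U2_inv(1)[OF ch x])
  also have "(\<Sum>k\<in>UNIV. dirderiv \<A> (h k) x u *\<^sub>R axis k 1) = dirderiv \<A> (\<lambda>y. E y (Y y)) x u"
    unfolding h_def dirderiv_blinear[OF bounded_linear_vec_nth EY]
    by (simp add: vec4_eq_iff sum_4 axis_def)
  finally show ?thesis .
qed

lemma LC_matrix_linear: "linear (LC_matrix x E u)"
  unfolding LC_matrix_def by (intro linearI) (simp_all add: scaleR_left_distrib sum.distrib scaleR_sum_right)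

text \<open>The inner products of the frame fields are constant, so metric compatibility annihilates
  the symmetric part of the matrix.\<close>

lemma LC_matrix_skew:
  assumes x: "x \<in> U"
  shows "LC_matrix x E u v \<bullet> w = - (v \<bullet> LC_matrix x E u w)"
proof -
  define F where "F k = (\<lambda>z. inv (E z) (axis k 1 :: quat))" for k :: 4
  have F: "smooth_vf_at x (F k)" for k
    unfolding F_def by (rule smooth_vf_at_U2_inv[OF x])
  define G where "G k = E x (D x u (F k))" for k
  have EF: "E y (F k y) = axis k 1" if "y \<in> U" for y k
    by (simp add: F_def U2_inv(1)[OF ch that])
  have sk: "G j $ k = - (G k $ j)" for j k
  proof -
    have "dirderiv \<A> (\<lambda>y. g y (F j y) (F k y)) x u = dirderiv \<A> (\<lambda>y. if j = k then 1 else 0) x u"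
      by (rule dirderiv_cong[OF U2_open[OF ch] x])
        (simp add: U2_inner[OF ch, symmetric] EF inner_axis_axis)
    then have "g x (D x u (F j)) (F k x) + g x (F j x) (D x u (F k)) = 0"
      by (simp add: D_metric[OF F F] dirderiv_const)
    then show ?thesis
      by (simp add: U2_inner[OF ch x, symmetric] EF[OF x] inner_axis inner_axis' G_def)
  qed
  have c: "LC_matrix x E u v = (\<Sum>k\<in>UNIV. v $ k *\<^sub>R G k)" for v by (simp add: LC_matrix_def G_def F_def)
  show ?thesis unfolding c inner_vec4 by (simp add: sum_4 sk[of 2 1] sk[of 3 1] sk[of 4 1] sk[of 3 2] sk[of 4 2] sk[of 4 3]
      sk[of 1 1, simplified] sk[of 2 2, simplified] sk[of 3 3, simplified] sk[of 4 4, simplified] algebra_simps)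
qed

lemma ex_LC_forms:
  "LC_forms \<A> D U E (\<lambda>x u. skew_left (LC_matrix x E u)) (\<lambda>x u. skew_right (LC_matrix x E u))"
  unfolding LC_forms_def
proof (intro ballI allI conjI impI)
  fix x u assume x: "x \<in> U"
  note sp = skew_split[OF LC_matrix_linear LC_matrix_skew[OF x], of u]
  show "skew_left (LC_matrix x E u) \<in> ImH" "skew_right (LC_matrix x E u) \<in> ImH" by (rule sp)+
  fix Y assume Y: "smooth_vf_at x Y"
  show "E x (D x u Y) = dirderiv \<A> (\<lambda>y. E y (Y y)) x u + skew_left (LC_matrix x E u) \<odot> E x (Y x)
      - E x (Y x) \<odot> skew_right (LC_matrix x E u)"
    unfolding D_chart[OF x Y] by (subst sp(3)) (rule add_diff_eq)
qed

text \<open>Averaging with the conjugate by \<open>qi\<close> cancels the \<open>j\<close> and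
  \<open>k\<close> components of \<open>ap\<close>, which anticommute with \<open>qi\<close>, and
  keeps the \<open>i\<close> component. Right multiplication by \<open>am\<close> commutes with
  \<open>qi\<close> and survives unchanged.\<close>

lemma nabla_J_chart:
  assumes "LC_forms \<A> D U E ap am" and x: "x \<in> U" and Y: "smooth_vf_at x Y"
  shows "E x (nabla_J x u Y) = dirderiv \<A> (\<lambda>y. E y (Y y)) x u + (ap x u $ 2 *\<^sub>R qi) \<odot> E x (Y x) - E x (Y x) \<odot> am x u"
proof -
  let ?d = "dirderiv \<A> (\<lambda>y. E y (Y y)) x u" and ?y = "E x (Y x)"
  have im: "ap x u $ 1 = 0" using assms(1) x unfolding LC_forms_def ImH_def by blast
  have 1: "E x (D x u Z) = dirderiv \<A> (\<lambda>y. E y (Z y)) x u + ap x u \<odot> E x (Z x) - E x (Z x) \<odot> am x u"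
    if "smooth_vf_at x Z" for Z using assms(1) x that unfolding LC_forms_def by blast
  have "dirderiv \<A> (\<lambda>y. E y (J y (Y y))) x u = dirderiv \<A> (\<lambda>y. qi \<odot> E y (Y y)) x u"
    by (rule dirderiv_cong[OF U2_open[OF ch] x]) (rule U2_J[OF ch])
  also have "\<dots> = qi \<odot> ?d"
    by (rule dirderiv_blinear[OF bounded_bilinear.bounded_linear_right[OF bounded_bilinear_qmul]
          smooth_at_U2[OF ch Y x]])
  finally have 2: "E x (D x u (\<lambda>y. J y (Y y))) = qi \<odot> ?d + ap x u \<odot> (qi \<odot> ?y) - (qi \<odot> ?y) \<odot> am x u"
    using 1[OF smooth_vf_at_J[OF Y]] U2_J[OF ch x] by simp
  have "E x (nabla_J x u Y) = (1/2) *\<^sub>R (E x (D x u Y) - qi \<odot> E x (D x u (\<lambda>y. J y (Y y))))"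
    unfolding nabla_J_def
    by (simp add: linear_scale[OF U2_linear[OF ch x]] linear_diff[OF U2_linear[OF ch x]] U2_J[OF ch x])
  also have "\<dots> = ?d + (ap x u $ 2 *\<^sub>R qi) \<odot> ?y - ?y \<odot> am x u"
    unfolding 2 1[OF Y] by (simp add: vec4_eq_iff qmul_nth im field_simps)
  finally show ?thesis .
qed

text \<open>The complex volume form of the chart, dual to \<open>K_frame\<close>: evaluating a
  section of the determinant line on it yields the coefficient of the section.\<close>

definition cvol :: "'a \<Rightarrow> cform" where "cvol x = (\<lambda>v w. cdet (E x v) (E x w))"

lemma cvol_bilinear:
  assumes x: "x \<in> U"
  shows "bilinear (cvol x)"
proof -
  have c: "bilinear cdet" by (simp add: bilinear_conv_bounded_bilinear bounded_bilinear_cdet)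
  have l: "linear (cdet v)" "linear (\<lambda>v. cdet v w)" for v w using c by (auto simp: bilinear_def)
  show ?thesis
    unfolding bilinear_def cvol_def
    using linear_compose[OF U2_linear[OF ch x] l(1)] linear_compose[OF U2_linear[OF ch x] l(2)]
    by (simp add: comp_def)
qed

lemma cvol_K: "x \<in> U \<Longrightarrow> cvol x \<in> K_fiber (J x)"
  unfolding K_fiber_def mem_Collect_eq
  by (intro conjI allI) (simp_all add: cvol_bilinear, simp_all add: cvol_def cdet_self cdet_qi U2_J[OF ch])

text \<open>The preimages of \<open>q1\<close> and \<open>qj\<close> form a complex basis of the
  tangent space, so an alternating complex bilinear form is determined by its value on this
  pair.\<close>

lemma K_expand:
  assumes x: "x \<in> U" and \<omega>: "\<omega> \<in> K_fiber (J x)"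
  shows "\<omega> v w = \<omega> (inv (E x) q1) (inv (E x) qj) * cvol x v w"
proof -
  define a b where ab: "a = inv (E x) q1" "b = inv (E x) qj"
  have bil: "bilinear \<omega>" and alt: "\<And>v. \<omega> v v = 0"
    and wJ: "\<And>v w. \<omega> (J x v) w = \<i> * \<omega> v w" "\<And>v w. \<omega> v (J x w) = \<i> * \<omega> v w"
    using \<omega> unfolding K_fiber_def by auto
  have e: "v = E x v $ 1 *\<^sub>R a + E x v $ 2 *\<^sub>R J x a + E x v $ 3 *\<^sub>R b + E x v $ 4 *\<^sub>R J x b" for v
  proof (rule injD[OF U2_inj[OF ch x]])
    have "E x (J x b) = qk" by (simp add: U2_J[OF ch x] ab U2_inv(1)[OF ch x] vec4_eq_iff qmul_nth)
    then have "E x (E x v $ 1 *\<^sub>R a + E x v $ 2 *\<^sub>R J x a + E x v $ 3 *\<^sub>R b + E x v $ 4 *\<^sub>R J x b) =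
        E x v $ 1 *\<^sub>R q1 + E x v $ 2 *\<^sub>R qi + E x v $ 3 *\<^sub>R qj + E x v $ 4 *\<^sub>R qk"
      by (simp add: linear_add[OF U2_linear[OF ch x]] linear_scale[OF U2_linear[OF ch x]] U2_J[OF ch x] ab U2_inv(1)[OF ch x])
    then show "E x v = E x (E x v $ 1 *\<^sub>R a + E x v $ 2 *\<^sub>R J x a + E x v $ 3 *\<^sub>R b + E x v $ 4 *\<^sub>R J x b)"
      by (rule trans[OF quat_expand sym])
  qed
  have ba: "\<omega> b a = - \<omega> a b"
    using alt[of "a + b"] alt[of a] alt[of b] by (simp add: bilinear_ladd[OF bil] bilinear_radd[OF bil] add_eq_0_iff)
  obtain k where k: "\<omega> a b = k" by simp
  have 1: "\<omega> u a = - k * cx2 (E x u)" "\<omega> u b = k * cx1 (E x u)" for u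
  proof -
    have h: "\<omega> u t = \<omega> (E x u $ 1 *\<^sub>R a + E x u $ 2 *\<^sub>R J x a + E x u $ 3 *\<^sub>R b + E x u $ 4 *\<^sub>R J x b) t" for t
      by (rule arg_cong[where f = "\<lambda>r. \<omega> r t", OF e])
    show "\<omega> u a = - k * cx2 (E x u)"
      unfolding h[of a] by (simp add: bilinear_ladd[OF bil] bilinear_lmul[OF bil] wJ alt ba k cx2_def
          scaleR_conv_of_real[where 'a = complex] Complex_eq algebra_simps)
    show "\<omega> u b = k * cx1 (E x u)"
      unfolding h[of b] by (simp add: bilinear_ladd[OF bil] bilinear_lmul[OF bil] wJ alt k cx1_def
          scaleR_conv_of_real[where 'a = complex] Complex_eq algebra_simps)
  qed
  have "\<omega> v w = \<omega> v (E x w $ 1 *\<^sub>R a + E x w $ 2 *\<^sub>R J x a + E x w $ 3 *\<^sub>R b + E x w $ 4 *\<^sub>R J x b)"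
    by (rule arg_cong[OF e])
  also have "\<dots> = k * cvol x v w"
    by (simp add: bilinear_radd[OF bil] bilinear_rmul[OF bil] wJ 1 cvol_def cdet_def)
      (simp add: cx1_def cx2_def scaleR_conv_of_real[where 'a = complex] Complex_eq algebra_simps)
  finally have "\<omega> v w = \<omega> a b * cvol x v w" unfolding k .
  then show ?thesis unfolding ab .
qed

lemma K_frame_cvol: "x \<in> U \<Longrightarrow> K_frame J E x (cvol x) = 1"
  using cvol_K[of x] unfolding K_frame_def cwedge_def
  by (simp only: if_True) (simp add: cvol_def U2_inv(1)[OF ch] cdet_q1_qj)

lemma cwedge_chart: "x \<in> U \<Longrightarrow> cwedge (J x) v w \<omega> = cvol x v w * K_frame J E x \<omega>"
proof (cases "\<omega> \<in> K_fiber (J x)")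
  case True
  assume "x \<in> U"
  from K_expand[OF this True, of v w] show ?thesis
    unfolding K_frame_def cwedge_def if_P[OF True] by (simp only: mult.commute)
qed (simp add: K_frame_def cwedge_def)

lemma Kstar_expand:
  assumes x: "x \<in> U" and z: "z \<in> Kstar_fiber (J x)"
  shows "z \<omega> = z (cvol x) * K_frame J E x \<omega>"
proof (cases "\<omega> \<in> K_fiber (J x)")
  case True
  let ?c = "\<omega> (inv (E x) q1) (inv (E x) qj)"
  \<comment> \<open>Linearity in \<open>Kstar_fiber\<close> is phrased for combinations of two
    forms; the second summand has coefficient 0.\<close>
  have "\<omega> = (\<lambda>v w. ?c * cvol x v w + 0 * cvol x v w)"
  proof (intro ext)
    show "\<omega> v w = ?c * cvol x v w + 0 * cvol x v w" for v w
      unfolding mult_zero_left add_0_right by (rule K_expand[OF x True])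
  qed
  then have "z \<omega> = z (\<lambda>v w. ?c * cvol x v w + 0 * cvol x v w)" by (rule arg_cong)
  also have "\<dots> = ?c * z (cvol x) + 0 * z (cvol x)"
    using z cvol_K[OF x] unfolding Kstar_fiber_def by blast
  finally show ?thesis using True by (simp add: K_frame_def cwedge_def)
next
  case False
  then show ?thesis using z by (simp add: K_frame_def cwedge_def Kstar_fiber_def)
qed

lemma K_frame_Kstar: "K_frame J E x \<in> Kstar_fiber (J x)"
  unfolding K_frame_def by (rule cwedge_Kstar)

lemma smooth_cvol: "smooth_Kform \<A> J U cvol"
  unfolding smooth_Kform_def
proof (intro conjI ballI allI impI)
  fix V X Y assume V: "V \<subseteq> U \<and> smooth_vf \<A> V X \<and> smooth_vf \<A> V Y"
  show "smooth_fun \<A> V (\<lambda>x. cvol x (X x) (Y x))"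
    unfolding cvol_def by (intro smooth_fun_bilinear[OF bounded_bilinear_cdet] smooth_U2[OF ch]) (use V in auto)
qed (use U2_open[OF ch] cvol_K in auto)

lemma smooth_K_frame: "smooth_Ksec \<A> J U (K_frame J E)"
  unfolding K_frame_def[abs_def] by (rule smooth_Ksec_cwedge[OF smooth_U2_inv_const[OF ch] smooth_U2_inv_const[OF ch]])

lemma smooth_coeff: "smooth_Ksec \<A> J V s \<Longrightarrow> V \<subseteq> U \<Longrightarrow> smooth_fun \<A> V (\<lambda>x. s x (cvol x))"
  by (rule smooth_KsecD[OF _ order_refl smooth_Kform_subset[OF smooth_cvol smooth_Ksec_open]])

lemma smooth_at_coeff:
  assumes "ksec_at x s" "x \<in> U"
  shows "smooth_at x (\<lambda>y. s y (cvol y))"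
proof -
  obtain V where V: "open V" "x \<in> V" "smooth_Ksec \<A> J V s" using assms unfolding near_def by blast
  have "smooth_fun \<A> (V \<inter> U) (\<lambda>y. s y (cvol y))"
    by (rule smooth_coeff[OF smooth_Ksec_subset[OF V(3)]]) (use V U2_open[OF ch] in auto)
  then show ?thesis by (rule smooth_atI) (use V assms in auto)
qed

lemma herm_chart:
  "x \<in> U \<Longrightarrow> herm (g x) (J x) v1 w1 * herm (g x) (J x) v2 w2 - herm (g x) (J x) v1 w2 * herm (g x) (J x) v2 w1
    = cvol x v1 v2 * cnj (cvol x w1 w2)"
  using cauchy_binet_quat[of "E x v1" "E x w1" "E x v2" "E x w2"]
  by (simp add: herm_def U2_inner[OF ch, symmetric] U2_J[OF ch] cvol_def)

lemma ex_cwedge: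
  assumes x: "x \<in> U" and z: "z \<in> Kstar_fiber (J x)"
  shows "z = cwedge (J x) (inv (E x) (cq (z (cvol x)))) (inv (E x) qj)"
proof
  fix \<omega>
  show "z \<omega> = cwedge (J x) (inv (E x) (cq (z (cvol x)))) (inv (E x) qj) \<omega>"
    using Kstar_expand[OF x z, of \<omega>] unfolding cwedge_chart[OF x]
    by (simp add: cvol_def U2_inv(1)[OF ch x] cdet_cq)
qed

lemma cwedge_cvol: "x \<in> U \<Longrightarrow> cwedge (J x) v w (cvol x) = cvol x v w"
  using cwedge_chart K_frame_cvol by simp

text \<open>By the Cauchy-Binet identity the Gram determinant depends only on the two bivectors, so
  the description by \<open>THE\<close> has exactly one solution.\<close>

lemma Kstar_herm_chart:
  assumes x: "x \<in> U" and z: "z \<in> Kstar_fiber (J x)" "z' \<in> Kstar_fiber (J x)"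
  shows "Kstar_herm (g x) (J x) z z' = z (cvol x) * cnj (z' (cvol x))"
  unfolding Kstar_herm_def
proof (rule the_equality)
  show "\<exists>v1 v2 w1 w2. z = cwedge (J x) v1 v2 \<and> z' = cwedge (J x) w1 w2 \<and>
      z (cvol x) * cnj (z' (cvol x)) =
      herm (g x) (J x) v1 w1 * herm (g x) (J x) v2 w2 - herm (g x) (J x) v1 w2 * herm (g x) (J x) v2 w1"
  proof (intro exI conjI)
    show "z = cwedge (J x) (inv (E x) (cq (z (cvol x)))) (inv (E x) qj)"
      "z' = cwedge (J x) (inv (E x) (cq (z' (cvol x)))) (inv (E x) qj)"
      using ex_cwedge[OF x] z by blast+
  qed (unfold herm_chart[OF x], simp add: cvol_def U2_inv(1)[OF ch x] cdet_cq)
next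
  fix c assume "\<exists>v1 v2 w1 w2. z = cwedge (J x) v1 v2 \<and> z' = cwedge (J x) w1 w2 \<and> c =
      herm (g x) (J x) v1 w1 * herm (g x) (J x) v2 w2 - herm (g x) (J x) v1 w2 * herm (g x) (J x) v2 w1"
  then show "c = z (cvol x) * cnj (z' (cvol x))"
    unfolding herm_chart[OF x] using cwedge_cvol[OF x] by auto
qed

lemma ex_wedge_rep:
  assumes x: "x \<in> U" and s: "ksec_at x s"
  shows "\<exists>X1 X2. wedge_rep x s X1 X2"
proof -
  obtain V where V: "open V" "x \<in> V" "smooth_Ksec \<A> J V s" using s unfolding near_def by blast
  define W where "W = V \<inter> U"
  have W: "open W" "x \<in> W" "W \<subseteq> U" "smooth_Ksec \<A> J W s"
    using V x U2_open[OF ch] smooth_Ksec_subset[OF V(3)] by (auto simp: W_def)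
  have "smooth_vf \<A> W (\<lambda>y. inv (E y) (cq (s y (cvol y))))"
    by (intro smooth_U2_inv[OF ch] smooth_fun_blinear[OF bounded_linear_cq] smooth_coeff W)
  then have 1: "smooth_vf_at x (\<lambda>y. inv (E y) (cq (s y (cvol y))))" by (rule smooth_vf_atI) (rule W)
  have "s y = cwedge (J y) (inv (E y) (cq (s y (cvol y)))) (inv (E y) qj)" if "y \<in> W" for y
    by (rule ex_cwedge) (use that W in \<open>auto simp: smooth_Ksec_def\<close>)
  then show ?thesis
    unfolding wedge_rep_def
    using 1 smooth_vf_at_U2_inv[OF x, of qj] W(1,2) by blast
qed

text \<open>The right-hand side mentions the decomposition only through \<open>s\<close>, which
  gives independence of the choice in \<open>conn_J\<close>. The two contributions of
  \<open>am\<close> cancel by \<open>cdet_right_mult\<close>, and those of the \<open>i\<close>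
  component of \<open>ap\<close> add up to the factor 2.\<close>

lemma wedge_derivative_chart:
  assumes lcf: "LC_forms \<A> D U E ap am" and x: "x \<in> U" and rep: "wedge_rep x s X1 X2"
  shows "cwedge (J x) (nabla_J x u X1) (X2 x) \<omega> + cwedge (J x) (X1 x) (nabla_J x u X2) \<omega> =
    (dirderiv \<A> (\<lambda>y. s y (cvol y)) x u + 2 * \<i> * complex_of_real (ap x u $ 2) * s x (cvol x)) * K_frame J E x \<omega>"
proof -
  obtain V where X: "smooth_vf_at x X1" "smooth_vf_at x X2" and V: "open V" "x \<in> V"
    and sV: "\<And>y. y \<in> V \<Longrightarrow> s y = cwedge (J y) (X1 y) (X2 y)"
    using rep unfolding wedge_rep_def by blast
  have am: "am x u \<in> ImH" using lcf x unfolding LC_forms_def by blast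
  let ?y1 = "E x (X1 x)" and ?y2 = "E x (X2 x)"
  have "dirderiv \<A> (\<lambda>y. s y (cvol y)) x u = dirderiv \<A> (\<lambda>y. cdet (E y (X1 y)) (E y (X2 y))) x u"
    by (rule dirderiv_cong[OF open_Int[OF V(1) U2_open[OF ch]]])
      (use V x sV cwedge_cvol in \<open>auto simp: cvol_def\<close>)
  also have "\<dots> = cdet ?y1 (dirderiv \<A> (\<lambda>y. E y (X2 y)) x u) + cdet (dirderiv \<A> (\<lambda>y. E y (X1 y)) x u) ?y2"
    by (rule dirderiv_bilinear[OF bounded_bilinear_cdet smooth_at_U2[OF ch X(1) x] smooth_at_U2[OF ch X(2) x]])
  finally have d: "dirderiv \<A> (\<lambda>y. s y (cvol y)) x u =
    cdet ?y1 (dirderiv \<A> (\<lambda>y. E y (X2 y)) x u) + cdet (dirderiv \<A> (\<lambda>y. E y (X1 y)) x u) ?y2" .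
  have s: "s x (cvol x) = cdet ?y1 ?y2" using sV[OF V(2)] cwedge_cvol[OF x] by (simp add: cvol_def)
  have oms: "cvol x v w = cdet (E x v) (E x w)" for v w by (simp add: cvol_def)
  interpret cd: bounded_bilinear cdet by (rule bounded_bilinear_cdet)
  have "cvol x (nabla_J x u X1) (X2 x) + cvol x (X1 x) (nabla_J x u X2) =
      dirderiv \<A> (\<lambda>y. s y (cvol y)) x u + 2 * \<i> * complex_of_real (ap x u $ 2) * s x (cvol x)"
    unfolding oms nabla_J_chart[OF lcf x X(1)] nabla_J_chart[OF lcf x X(2)] d s
    using cdet_right_mult[OF am, of ?y1 ?y2]
    by (simp add: cd.add_left cd.add_right cd.diff_left cd.diff_right qmul_scaleR cd.scaleR_left cd.scaleR_right
        cdet_qi scaleR_conv_of_real[where 'a = complex] algebra_simps add_eq_0_iff)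
  then show ?thesis
    unfolding cwedge_chart[OF x] by (simp only: distrib_right[symmetric])
qed

lemma conn_J_chart:
  assumes lcf: "LC_forms \<A> D U E ap am" and x: "x \<in> U" and s: "ksec_at x s"
  shows "conn_J x u s = (\<lambda>\<omega>. (dirderiv \<A> (\<lambda>y. s y (cvol y)) x u
      + 2 * \<i> * complex_of_real (ap x u $ 2) * s x (cvol x)) * K_frame J E x \<omega>)"
proof -
  have "\<exists>X1 X2. wedge_rep x s X1 X2" by (rule ex_wedge_rep[OF x s])
  then have "\<exists>c X1 X2. wedge_rep x s X1 X2 \<and>
      c = (\<lambda>\<omega>. cwedge (J x) (nabla_J x u X1) (X2 x) \<omega> + cwedge (J x) (X1 x) (nabla_J x u X2) \<omega>)" by metis
  from someI_ex[OF this] obtain X1 X2 where rep: "wedge_rep x s X1 X2"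
    and conn_J: "conn_J x u s = (\<lambda>\<omega>. cwedge (J x) (nabla_J x u X1) (X2 x) \<omega> + cwedge (J x) (X1 x) (nabla_J x u X2) \<omega>)"
    unfolding conn_J_def by metis
  show ?thesis unfolding conn_J by (rule ext) (rule wedge_derivative_chart[OF lcf x rep])
qed

end

end

section \<open>Unitary connections\<close>

context spin_geometry
begin

section \<open>The induced connection and its translates are unitary\<close>

lemma wedge_rep_ksec_at: "wedge_rep x s X1 X2 \<Longrightarrow> ksec_at x s"
proof -
  assume "wedge_rep x s X1 X2"
  then obtain V where X: "smooth_vf_at x X1" "smooth_vf_at x X2" and V: "open V" "x \<in> V"
    and s: "\<And>y. y \<in> V \<Longrightarrow> s y = cwedge (J y) (X1 y) (X2 y)"
    unfolding wedge_rep_def by blast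
  obtain W where W: "open W" "x \<in> W" "smooth_vf \<A> W X1" "smooth_vf \<A> W X2"
    using X by (rule smooth_vf_at2)
  have "smooth_Ksec \<A> J (V \<inter> W) (\<lambda>y. cwedge (J y) (X1 y) (X2 y))"
    by (rule smooth_Ksec_cwedge; rule smooth_vf_subset) (use V W in auto)
  then have "smooth_Ksec \<A> J (V \<inter> W) s"
    by (rule smooth_Ksec_cong) (simp add: s)
  then show ?thesis by (rule ksec_atI) (use V W in auto)
qed

lemma conn_J_wedge:
  assumes "wedge_rep x s X1 X2"
  shows "conn_J x u s = (\<lambda>\<omega>. cwedge (J x) (nabla_J x u X1) (X2 x) \<omega> + cwedge (J x) (X1 x) (nabla_J x u X2) \<omega>)"
proof -
  obtain U E where x: "x \<in> U" and ch: "U2_chart \<A> g J U E" using ex_U2_chart by blast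
  note lcf = ex_LC_forms[OF ch]
  show ?thesis
    unfolding conn_J_chart[OF ch lcf x wedge_rep_ksec_at[OF assms]]
    by (rule ext) (rule wedge_derivative_chart[OF ch lcf x assms, symmetric])
qed

lemma ksec_at_wedge: "ksec_at x s \<Longrightarrow> \<exists>X1 X2. wedge_rep x s X1 X2"
  using ex_U2_chart[of x] ex_wedge_rep by blast

lemma conn_J_Kstar: "ksec_at x s \<Longrightarrow> conn_J x u s \<in> Kstar_fiber (J x)"
proof -
  assume "ksec_at x s"
  then obtain X1 X2 where rep: "wedge_rep x s X1 X2" using ksec_at_wedge by blast
  show ?thesis unfolding conn_J_wedge[OF rep] by (intro Kstar_fiber_add cwedge_Kstar)
qed

lemma conn_J_linear: "ksec_at x s \<Longrightarrow> linear (\<lambda>u. conn_J x u s \<omega>)"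
proof -
  assume "ksec_at x s"
  then obtain X1 X2 where rep: "wedge_rep x s X1 X2" using ksec_at_wedge by blast
  then have n: "linear (\<lambda>u. nabla_J x u X1)" "linear (\<lambda>u. nabla_J x u X2)"
    using nabla_J_linear unfolding wedge_rep_def by blast+
  show ?thesis
  proof (cases "\<omega> \<in> K_fiber (J x)")
    case True
    then have b: "bilinear \<omega>" by (simp add: K_fiber_def)
    show ?thesis unfolding conn_J_wedge[OF rep] cwedge_def if_P[OF True]
      by (intro linearI) (simp_all add: linear_add[OF n(1)] linear_add[OF n(2)] linear_scale[OF n(1)]
          linear_scale[OF n(2)] bilinear_ladd[OF b] bilinear_radd[OF b] bilinear_lmul[OF b] bilinear_rmul[OF b]
          algebra_simps)
  next
    case False
    then show ?thesis unfolding conn_J_wedge[OF rep] cwedge_def by (simp add: linear_zero)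
  qed
qed

lemma conn_J_add:
  assumes s: "ksec_at x s" and t: "ksec_at x t"
  shows "conn_J x u (\<lambda>y \<omega>. s y \<omega> + t y \<omega>) = (\<lambda>\<omega>. conn_J x u s \<omega> + conn_J x u t \<omega>)"
proof -
  obtain U E where x: "x \<in> U" and ch: "U2_chart \<A> g J U E" using ex_U2_chart by blast
  note lcf = ex_LC_forms[OF ch]
  show ?thesis
    unfolding conn_J_chart[OF ch lcf x s] conn_J_chart[OF ch lcf x t] conn_J_chart[OF ch lcf x ksec_at_add[OF s t]]
      dirderiv_add[OF smooth_at_coeff[OF ch s x] smooth_at_coeff[OF ch t x]]
    by (simp add: algebra_simps)
qed

lemma conn_J_leibniz:
  assumes f: "smooth_at x f" and s: "ksec_at x s"
  shows "conn_J x u (\<lambda>y \<omega>. f y * s y \<omega>) = (\<lambda>\<omega>. dirderiv \<A> f x u * s x \<omega> + f x * conn_J x u s \<omega>)"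
proof -
  obtain U E where x: "x \<in> U" and ch: "U2_chart \<A> g J U E" using ex_U2_chart by blast
  note lcf = ex_LC_forms[OF ch]
  have "s x = (\<lambda>\<omega>. s x (cvol E x) * K_frame J E x \<omega>)"
    by (rule ext) (rule Kstar_expand[OF ch x ksec_at_Kstar[OF s]])
  then obtain z where z: "s x = (\<lambda>\<omega>. z * K_frame J E x \<omega>)" "s x (cvol E x) = z" by blast
  show ?thesis
    unfolding conn_J_chart[OF ch lcf x s] conn_J_chart[OF ch lcf x ksec_at_mult[OF f s]]
      dirderiv_bilinear[OF bounded_bilinear_mult f smooth_at_coeff[OF ch s x]] z(2)
    unfolding z(1) by (simp add: algebra_simps)
qed

text \<open>In the unit-length frame of a chart the connection coefficient is imaginary, so it
  cancels against its conjugate and only the product rule remains.\<close>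

lemma conn_J_metric:
  assumes s: "ksec_at x s" and t: "ksec_at x t"
  shows "dirderiv \<A> (\<lambda>y. Kstar_herm (g y) (J y) (s y) (t y)) x u =
    Kstar_herm (g x) (J x) (conn_J x u s) (t x) + Kstar_herm (g x) (J x) (s x) (conn_J x u t)"
proof -
  obtain U E where x: "x \<in> U" and ch: "U2_chart \<A> g J U E" using ex_U2_chart by blast
  note lcf = ex_LC_forms[OF ch]
  obtain V where V: "open V" "x \<in> V" "smooth_Ksec \<A> J V s" "smooth_Ksec \<A> J V t"
    using s t by (rule ksec_at2)
  have "dirderiv \<A> (\<lambda>y. Kstar_herm (g y) (J y) (s y) (t y)) x u =
      dirderiv \<A> (\<lambda>y. s y (cvol E y) * cnj (t y (cvol E y))) x u"
    by (rule dirderiv_cong[OF open_Int[OF V(1) U2_open[OF ch]]])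
      (use V x Kstar_herm_chart[OF ch] in \<open>auto simp: smooth_Ksec_def\<close>)
  also have "\<dots> = s x (cvol E x) * cnj (dirderiv \<A> (\<lambda>y. t y (cvol E y)) x u)
      + dirderiv \<A> (\<lambda>y. s y (cvol E y)) x u * cnj (t x (cvol E x))"
    using dirderiv_bilinear[OF bounded_bilinear_mult smooth_at_coeff[OF ch s x]
        smooth_at_blinear[OF bounded_linear_cnj smooth_at_coeff[OF ch t x]]]
      dirderiv_blinear[OF bounded_linear_cnj smooth_at_coeff[OF ch t x]] by simp
  finally show ?thesis
    unfolding Kstar_herm_chart[OF ch x conn_J_Kstar[OF s] ksec_at_Kstar[OF t]]
      Kstar_herm_chart[OF ch x ksec_at_Kstar[OF s] conn_J_Kstar[OF t]]
    unfolding conn_J_chart[OF ch lcf x s] conn_J_chart[OF ch lcf x t]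
    by (simp add: K_frame_cvol[OF ch x] algebra_simps)
qed

lemma Kstar_herm_bilinear:
  assumes "z \<in> Kstar_fiber (J x)" "w \<in> Kstar_fiber (J x)" "z' \<in> Kstar_fiber (J x)"
  shows "Kstar_herm (g x) (J x) (\<lambda>\<omega>. z \<omega> + c * z' \<omega>) w =
      Kstar_herm (g x) (J x) z w + c * Kstar_herm (g x) (J x) z' w"
    and "Kstar_herm (g x) (J x) w (\<lambda>\<omega>. z \<omega> + c * z' \<omega>) =
      Kstar_herm (g x) (J x) w z + cnj c * Kstar_herm (g x) (J x) w z'"
proof -
  obtain U E where x: "x \<in> U" and ch: "U2_chart \<A> g J U E" using ex_U2_chart by blast
  note h = Kstar_herm_chart[OF ch x]
  have k: "(\<lambda>\<omega>. z \<omega> + c * z' \<omega>) \<in> Kstar_fiber (J x)"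
    by (intro Kstar_fiber_add Kstar_fiber_mult assms)
  show "Kstar_herm (g x) (J x) (\<lambda>\<omega>. z \<omega> + c * z' \<omega>) w =
      Kstar_herm (g x) (J x) z w + c * Kstar_herm (g x) (J x) z' w"
    unfolding h[OF k assms(2)] h[OF assms(1,2)] h[OF assms(3,2)] by (simp add: algebra_simps)
  show "Kstar_herm (g x) (J x) w (\<lambda>\<omega>. z \<omega> + c * z' \<omega>) =
      Kstar_herm (g x) (J x) w z + cnj c * Kstar_herm (g x) (J x) w z'"
    unfolding h[OF assms(2) k] h[OF assms(2,1)] h[OF assms(2,3)] by (simp add: algebra_simps)
qed

text \<open>One pair of smooth factors serves all points near \<open>x\<close>; by
  \<open>conn_J_wedge\<close> it replaces the pairs chosen independently at each point.\<close>

lemma smooth_conn_J: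
  assumes X: "smooth_vf \<A> U X" and s: "smooth_Ksec \<A> J U s"
  shows "smooth_Ksec \<A> J U (\<lambda>x. conn_J x (X x) s)"
proof (rule smooth_Ksec_local[OF smooth_vf_open[OF X]])
  fix x assume x: "x \<in> U"
  obtain X1 X2 where "wedge_rep x s X1 X2" using ksec_at_wedge[OF ksec_atI[OF s x]] by blast
  then obtain V where rep: "smooth_vf_at x X1" "smooth_vf_at x X2" and V: "open V" "x \<in> V"
    and sV: "\<And>y. y \<in> V \<Longrightarrow> s y = cwedge (J y) (X1 y) (X2 y)"
    unfolding wedge_rep_def by blast
  obtain W0 where W0: "open W0" "x \<in> W0" "smooth_vf \<A> W0 X1" "smooth_vf \<A> W0 X2"
    using rep by (rule smooth_vf_at2)
  define W where "W = U \<inter> V \<inter> W0"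
  have W: "open W" "x \<in> W" "W \<subseteq> U" "W \<subseteq> V" "W \<subseteq> W0"
    using x V W0 smooth_vf_open[OF X] by (auto simp: W_def)
  have X1: "smooth_vf \<A> W X1" and X2: "smooth_vf \<A> W X2" and XW: "smooth_vf \<A> W X"
    using smooth_vf_subset W0 X W by blast+
  have "smooth_Ksec \<A> J W (\<lambda>y \<omega>. cwedge (J y) (nabla_J y (X y) X1) (X2 y) \<omega> + cwedge (J y) (X1 y) (nabla_J y (X y) X2) \<omega>)"
    by (intro smooth_Ksec_add smooth_Ksec_cwedge smooth_nabla_J X1 X2 XW)
  then have "smooth_Ksec \<A> J W (\<lambda>y. conn_J y (X y) s)"
  proof (rule smooth_Ksec_cong)
    fix y assume y: "y \<in> W"
    have "wedge_rep y s X1 X2"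
      unfolding wedge_rep_def
      using smooth_vf_atI[OF X1 y] smooth_vf_atI[OF X2 y] y W sV by blast
    then show "(\<lambda>\<omega>. cwedge (J y) (nabla_J y (X y) X1) (X2 y) \<omega> + cwedge (J y) (X1 y) (nabla_J y (X y) X2) \<omega>) = conn_J y (X y) s"
      using conn_J_wedge by simp
  qed
  then show "\<exists>V. x \<in> V \<and> smooth_Ksec \<A> J V (\<lambda>x. conn_J x (X x) s)" using W(2) by blast
qed

definition conn :: "('a \<Rightarrow> real^4 \<Rightarrow> real) \<Rightarrow> 'a kconn" where
  "conn \<beta> = add_i \<A> J conn_J \<beta>"

lemma conn_at: "ksec_at x s \<Longrightarrow> conn \<beta> x u s = (\<lambda>\<omega>. conn_J x u s \<omega> + \<i> * complex_of_real (\<beta> x u) * s x \<omega>)"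
  by (simp add: conn_def add_i_def)

lemma add_i_conn: "add_i \<A> J (conn \<beta>) \<gamma> = conn (\<lambda>x v. \<beta> x v + \<gamma> x v)"
  by (intro ext) (simp add: conn_def add_i_def algebra_simps)

lemma unitary_conn:
  assumes "one_form \<A> \<beta>"
  shows "unitary_connection \<A> g J (conn \<beta>)"
  unfolding unitary_connection_def
proof (intro conjI allI impI)
  have \<beta>: "linear (\<beta> x)" for x using assms by (simp add: one_form_def)
  fix x v s t
  {
    assume s: "ksec_at x s"
    show "conn \<beta> x v s \<in> Kstar_fiber (J x)"
      unfolding conn_at[OF s] by (intro Kstar_fiber_add Kstar_fiber_mult conn_J_Kstar[OF s] ksec_at_Kstar[OF s])
    show "linear (\<lambda>v. conn \<beta> x v s \<omega>)" for \<omega>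
      unfolding conn_at[OF s]
      by (intro linearI) (simp_all add: linear_add[OF conn_J_linear[OF s]] linear_scale[OF conn_J_linear[OF s]]
          linear_add[OF \<beta>] linear_scale[OF \<beta>] scaleR_conv_of_real[where 'a = complex] algebra_simps)
  }
  {
    assume "ksec_at x s \<and> ksec_at x t"
    then have s: "ksec_at x s" and t: "ksec_at x t" by auto
    show "conn \<beta> x v (\<lambda>y \<omega>. s y \<omega> + t y \<omega>) = (\<lambda>\<omega>. conn \<beta> x v s \<omega> + conn \<beta> x v t \<omega>)"
      unfolding conn_at[OF s] conn_at[OF t] conn_at[OF ksec_at_add[OF s t]] conn_J_add[OF s t]
      by (simp add: algebra_simps)
    show "dirderiv \<A> (\<lambda>y. Kstar_herm (g y) (J y) (s y) (t y)) x v =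
        Kstar_herm (g x) (J x) (conn \<beta> x v s) (t x) + Kstar_herm (g x) (J x) (s x) (conn \<beta> x v t)"
      unfolding conn_at[OF s] conn_at[OF t] conn_J_metric[OF s t]
        Kstar_herm_bilinear(1)[OF conn_J_Kstar[OF s] ksec_at_Kstar[OF t] ksec_at_Kstar[OF s]]
        Kstar_herm_bilinear(2)[OF conn_J_Kstar[OF t] ksec_at_Kstar[OF s] ksec_at_Kstar[OF t]]
      by simp
  }
  {
    fix f :: "'a \<Rightarrow> complex"
    assume "smooth_at x f \<and> ksec_at x s"
    then have f: "smooth_at x f" and s: "ksec_at x s" by auto
    show "conn \<beta> x v (\<lambda>y \<omega>. f y * s y \<omega>) = (\<lambda>\<omega>. dirderiv \<A> f x v * s x \<omega> + f x * conn \<beta> x v s \<omega>)"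
      unfolding conn_at[OF s] conn_at[OF ksec_at_mult[OF f s]] conn_J_leibniz[OF f s]
      by (simp add: algebra_simps)
  }
  {
    assume "\<not> ksec_at x s"
    then show "conn \<beta> x v s = undefined" by (simp add: conn_def add_i_def)
  }
next
  fix U X s assume "smooth_vf \<A> U X \<and> smooth_Ksec \<A> J U s"
  then have X: "smooth_vf \<A> U X" and s: "smooth_Ksec \<A> J U s" by auto
  have "smooth_fun \<A> U (\<lambda>x. \<beta> x (X x))" using assms X by (simp add: one_form_def)
  then have "smooth_fun \<A> U (\<lambda>x. complex_of_real (\<beta> x (X x)))"
    by (rule smooth_fun_blinear[OF bounded_linear_of_real])
  then have "smooth_fun \<A> U (\<lambda>x. \<i> * complex_of_real (\<beta> x (X x)))"
    by (rule smooth_fun_blinear[OF bounded_linear_mult_right])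
  then have "smooth_Ksec \<A> J U (\<lambda>x \<omega>. conn_J x (X x) s \<omega> + \<i> * complex_of_real (\<beta> x (X x)) * s x \<omega>)"
    by (intro smooth_Ksec_add smooth_conn_J X s smooth_Ksec_mult)
  then show "smooth_Ksec \<A> J U (\<lambda>x. conn \<beta> x (X x) s)"
    by (rule smooth_Ksec_cong) (simp add: conn_at[OF ksec_atI[OF s]])
qed

section \<open>Every unitary connection as the base connection plus an imaginary multiple of the
  identity\<close>

context
  fixes A assumes A: "unitary_connection \<A> g J A"
begin

lemma unitary_Kstar: "ksec_at x s \<Longrightarrow> A x v s \<in> Kstar_fiber (J x)"
  using conjunct1[OF A[unfolded unitary_connection_def]] by simp

lemma unitary_linear: "ksec_at x s \<Longrightarrow> linear (\<lambda>v. A x v s \<omega>)"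
  using conjunct1[OF A[unfolded unitary_connection_def]] by simp

lemma unitary_leibniz:
  "smooth_at x f \<Longrightarrow> ksec_at x s \<Longrightarrow>
    A x v (\<lambda>y \<omega>. f y * s y \<omega>) = (\<lambda>\<omega>. dirderiv \<A> f x v * s x \<omega> + f x * A x v s \<omega>)"
  using A unfolding unitary_connection_def by blast

lemma unitary_metric:
  "ksec_at x s \<Longrightarrow> ksec_at x t \<Longrightarrow>
    dirderiv \<A> (\<lambda>y. Kstar_herm (g y) (J y) (s y) (t y)) x v =
      Kstar_herm (g x) (J x) (A x v s) (t x) + Kstar_herm (g x) (J x) (s x) (A x v t)"
  using A unfolding unitary_connection_def by blast

lemma unitary_undefined: "\<not> ksec_at x s \<Longrightarrow> A x v s = undefined"
  using A unfolding unitary_connection_def by blast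

lemma unitary_local:
  assumes s: "ksec_at x s" and t: "ksec_at x t"
    and V: "open V" "x \<in> V" "\<And>y. y \<in> V \<Longrightarrow> s y = t y"
  shows "A x v s = A x v t"
proof -
  define f :: "'a \<Rightarrow> complex" where "f y = (if y \<in> V then 1 else 0)" for y
  have f: "smooth_at x f"
    by (rule smooth_atI[OF smooth_fun_cong[OF smooth_fun_const[OF V(1), of 1]]]) (use V in \<open>auto simp: f_def\<close>)
  have df: "dirderiv \<A> f x v = 0"
    using dirderiv_cong[OF V(1,2), of f "\<lambda>y. 1"] dirderiv_const by (simp add: f_def)
  have "A x v (\<lambda>y \<omega>. f y * s y \<omega>) = A x v s" "A x v (\<lambda>y \<omega>. f y * t y \<omega>) = A x v t"
    using unitary_leibniz[OF f s] unitary_leibniz[OF f t] df V(2) by (simp_all add: f_def)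
  moreover have "(\<lambda>y \<omega>. f y * s y \<omega>) = (\<lambda>y \<omega>. f y * t y \<omega>)" using V(3) by (auto simp: f_def fun_eq_iff)
  ultimately show ?thesis by simp
qed

text \<open>On a frame of unit length, metric compatibility forces the coefficient of
  \<open>A\<close> to be imaginary. For a general section the derivative terms of \<open>A\<close>
  and \<open>conn_J\<close> agree, so the difference is this coefficient minus that of
  \<open>conn_J\<close>.\<close>

lemma unitary_minus_conn_J:
  "\<exists>b::real. \<forall>s. ksec_at x s \<longrightarrow> A x u s = (\<lambda>\<omega>. conn_J x u s \<omega> + \<i> * complex_of_real b * s x \<omega>)"
proof -
  obtain U E where x: "x \<in> U" and ch: "U2_chart \<A> g J U E" using ex_U2_chart by blast
  note lcf = ex_LC_forms[OF ch]
  define F where "F = K_frame J E"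
  have F: "ksec_at x F" unfolding F_def by (rule ksec_atI[OF smooth_K_frame[OF ch] x])
  have FK: "F y \<in> Kstar_fiber (J y)" for y unfolding F_def by (rule K_frame_Kstar[OF ch])
  have F1: "F y (cvol E y) = 1" if "y \<in> U" for y unfolding F_def by (rule K_frame_cvol[OF ch that])
  define l where "l = A x u F (cvol E x)"
  have AF: "A x u F \<omega> = l * F x \<omega>" for \<omega>
    unfolding l_def F_def by (rule Kstar_expand[OF ch x]) (use unitary_Kstar[OF F] in \<open>simp add: F_def\<close>)
  have "dirderiv \<A> (\<lambda>y. Kstar_herm (g y) (J y) (F y) (F y)) x u = dirderiv \<A> (\<lambda>y. 1 :: complex) x u"
    by (rule dirderiv_cong[OF U2_open[OF ch] x]) (simp add: Kstar_herm_chart[OF ch _ FK FK] F1)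
  then have "Kstar_herm (g x) (J x) (A x u F) (F x) + Kstar_herm (g x) (J x) (F x) (A x u F) = 0"
    using unitary_metric[OF F F] by (simp add: dirderiv_const)
  then have "l + cnj l = 0"
    unfolding Kstar_herm_chart[OF ch x FK unitary_Kstar[OF F]] Kstar_herm_chart[OF ch x unitary_Kstar[OF F] FK]
    by (simp add: F1[OF x] l_def)
  then have "Re l = 0" by (simp add: complex_eq_iff)
  then have l: "l = \<i> * complex_of_real (Im l)" by (simp add: complex_eq_iff)
  show ?thesis
  proof (intro exI allI impI)
    fix s assume s: "ksec_at x s"
    obtain V where V: "open V" "x \<in> V" "smooth_Ksec \<A> J V s" using s unfolding near_def by blast
    let ?z = "\<lambda>y. s y (cvol E y)"
    have z: "smooth_at x ?z" by (rule smooth_at_coeff[OF ch s x])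
    have sx: "s x \<omega> = ?z x * F x \<omega>" for \<omega>
      unfolding F_def by (rule Kstar_expand[OF ch x ksec_at_Kstar[OF s]])
    have "A x u s = A x u (\<lambda>y \<omega>. ?z y * F y \<omega>)"
    proof (rule unitary_local[OF s ksec_at_mult[OF z F] open_Int[OF V(1) U2_open[OF ch]]])
      fix y assume "y \<in> V \<inter> U"
      then show "s y = (\<lambda>\<omega>. ?z y * F y \<omega>)"
        using V(3) Kstar_expand[OF ch, of y "s y"] unfolding F_def smooth_Ksec_def by blast
    qed (use V x in auto)
    also have "\<dots> = (\<lambda>\<omega>. (dirderiv \<A> ?z x u + l * ?z x) * F x \<omega>)"
      unfolding unitary_leibniz[OF z F] AF by (simp add: algebra_simps)
    \<comment> \<open>The witness \<open>b\<close> appears here: the subtracted term is the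
      coefficient of \<open>conn_J\<close>, twice the \<open>i\<close> component of the left
      connection form.\<close>
    also have "\<dots> = (\<lambda>\<omega>. conn_J x u s \<omega> + \<i> * complex_of_real (Im l - 2 * skew_left (LC_matrix x E u) $ 2) * s x \<omega>)"
      unfolding conn_J_chart[OF ch lcf x s] F_def[symmetric]
      by (subst l, rule ext, subst (2) sx) (simp add: algebra_simps)
    finally show "A x u s = (\<lambda>\<omega>. conn_J x u s \<omega> + \<i> * complex_of_real (Im l - 2 * skew_left (LC_matrix x E u) $ 2) * s x \<omega>)" .
  qed
qed

end

lemma ex_nonzero_ksec: "\<exists>s \<omega>. ksec_at x s \<and> s x \<omega> = 1"
proof -
  obtain U E where x: "x \<in> U" and ch: "U2_chart \<A> g J U E" using ex_U2_chart by blast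
  show ?thesis using ksec_atI[OF smooth_K_frame[OF ch] x] K_frame_cvol[OF ch x] by blast
qed

text \<open>The inverse of \<open>conn\<close>, by \<open>beta_conn\<close> and
  \<open>conn_beta\<close>. It translates questions about unitary connections into questions about
  real numbers at a point and a tangent vector.\<close>

definition beta :: "'a kconn \<Rightarrow> 'a \<Rightarrow> real^4 \<Rightarrow> real" where
  "beta A x u = (THE b. \<forall>s. ksec_at x s \<longrightarrow> A x u s = (\<lambda>\<omega>. conn_J x u s \<omega> + \<i> * complex_of_real b * s x \<omega>))"

lemma beta_eqI:
  assumes "\<And>s. ksec_at x s \<Longrightarrow> A x u s = (\<lambda>\<omega>. conn_J x u s \<omega> + \<i> * complex_of_real b * s x \<omega>)"
  shows "beta A x u = b"
  unfolding beta_def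
proof (rule the_equality)
  fix c assume c: "\<forall>s. ksec_at x s \<longrightarrow> A x u s = (\<lambda>\<omega>. conn_J x u s \<omega> + \<i> * complex_of_real c * s x \<omega>)"
  obtain s \<omega> where s: "ksec_at x s" "s x \<omega> = 1" using ex_nonzero_ksec by blast
  have "conn_J x u s \<omega> + \<i> * complex_of_real c * s x \<omega> = conn_J x u s \<omega> + \<i> * complex_of_real b * s x \<omega>"
    using fun_cong[OF assms[OF s(1)], of \<omega>] fun_cong[OF c[rule_format, OF s(1)], of \<omega>] by simp
  then show "c = b" using s(2) by simp
qed (use assms in blast)

lemma beta_eq:
  assumes "unitary_connection \<A> g J A" "ksec_at x s"
  shows "A x u s = (\<lambda>\<omega>. conn_J x u s \<omega> + \<i> * complex_of_real (beta A x u) * s x \<omega>)"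
proof -
  obtain b where b: "\<And>s. ksec_at x s \<Longrightarrow> A x u s = (\<lambda>\<omega>. conn_J x u s \<omega> + \<i> * complex_of_real b * s x \<omega>)"
    using unitary_minus_conn_J[OF assms(1)] by metis
  then have "beta A x u = b" by (rule beta_eqI)
  then show ?thesis using b assms(2) by blast
qed

lemma beta_conn: "beta (conn \<beta>) x u = \<beta> x u"
  by (rule beta_eqI) (rule conn_at)

text \<open>Equality includes arguments that are not smooth near the point, where both sides are
  \<open>undefined\<close>.\<close>

lemma conn_beta:
  assumes "unitary_connection \<A> g J A"
  shows "conn (beta A) = A"
proof (intro ext)
  fix x v s \<omega>
  show "conn (beta A) x v s \<omega> = A x v s \<omega>"
  proof (cases "ksec_at x s")
    case True
    then show ?thesis using conn_at beta_eq[OF assms] by simp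
  next
    case False
    then show ?thesis using unitary_undefined[OF assms] by (simp add: conn_def add_i_def)
  qed
qed

lemma beta_linear:
  assumes "unitary_connection \<A> g J A"
  shows "linear (beta A x)"
proof -
  obtain s \<omega> where s: "ksec_at x s" "s x \<omega> = 1" using ex_nonzero_ksec by blast
  have "\<i> * complex_of_real (beta A x u) = A x u s \<omega> - conn_J x u s \<omega>" for u
    using beta_eq[OF assms s(1), of u] s(2) by simp
  then have b: "beta A x u = Im (A x u s \<omega> - conn_J x u s \<omega>)" for u
    by (metis Im_i_times Re_complex_of_real)
  show ?thesis
    by (intro linearI) (simp_all add: b linear_add[OF unitary_linear[OF assms s(1)]] linear_add[OF conn_J_linear[OF s(1)]]
        linear_scale[OF unitary_linear[OF assms s(1)]] linear_scale[OF conn_J_linear[OF s(1)]] algebra_simps)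
qed

end

section \<open>Spinorial connections and the minimizers\<close>

context spin_geometry
begin

lemma unitary_K_form:
  assumes A: "unitary_connection \<A> g J A" and ch: "U2_chart \<A> g J U E"
    and lcf: "LC_forms \<A> D U E ap am" and x: "x \<in> U" and z: "smooth_at x z"
  shows "A x u (\<lambda>y \<omega>. z y * K_frame J E y \<omega>) =
    (\<lambda>\<omega>. (dirderiv \<A> z x u + 2 * \<i> * complex_of_real (ap x u $ 2 + beta A x u / 2) * z x) * K_frame J E x \<omega>)"
proof -
  have F: "ksec_at x (K_frame J E)" by (rule ksec_atI[OF smooth_K_frame[OF ch] x])
  note zF = ksec_at_mult[OF z F]
  have d: "dirderiv \<A> (\<lambda>y. z y * K_frame J E y (cvol E y)) x u = dirderiv \<A> z x u"
    by (rule dirderiv_cong[OF U2_open[OF ch] x]) (simp add: K_frame_cvol[OF ch])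
  show ?thesis
    unfolding beta_eq[OF A zF] conn_J_chart[OF ch lcf x zF] d by (simp add: K_frame_cvol[OF ch x] algebra_simps)
qed

text \<open>In a chart \<open>\<alpha>\<close> is the \<open>i\<close> component of
  \<open>ap\<close> plus \<open>beta / 2\<close>. The first summand belongs to
  \<open>nabla_J\<close>, the second turns into a multiple of \<open>J\<close>. As the resulting
  expression refers to no chart, all charts describe the same vector.\<close>

lemma nabla_minus_eq:
  assumes A: "unitary_connection \<A> g J A" and Y: "smooth_vf_at x Y"
  shows "nabla_minus \<A> g J D A x u Y = nabla_J x u Y + (beta A x u / 2) *\<^sub>R J x (Y x)"
  unfolding nabla_minus_def
proof (rule the_equality)
  let ?w = "nabla_J x u Y + (beta A x u / 2) *\<^sub>R J x (Y x)"
  have chart: "E x ?w = dirderiv \<A> (\<lambda>y. E y (Y y)) x u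
      + ((ap x u $ 2 + beta A x u / 2) *\<^sub>R qi) \<odot> E x (Y x) - E x (Y x) \<odot> am x u"
    if "U2_chart \<A> g J U E" "x \<in> U" "LC_forms \<A> D U E ap am" for U E ap am
    using nabla_J_chart[OF that(1,3,2) Y]
    by (simp add: linear_add[OF U2_linear[OF that(1,2)]] linear_scale[OF U2_linear[OF that(1,2)]]
        U2_J[OF that(1,2)] scaleR_left_distrib qmul_add qmul_scaleR)
  obtain U E where x: "x \<in> U" and ch: "U2_chart \<A> g J U E" using ex_U2_chart by blast
  note lcf = ex_LC_forms[OF ch]
  have "K_form \<A> J A U E (\<lambda>x u. skew_left (LC_matrix x E u) $ 2 + beta A x u / 2)"
    unfolding K_form_def using unitary_K_form[OF A ch lcf] by blast
  then show "\<exists>U E ap am \<alpha>. U2_chart \<A> g J U E \<and> x \<in> U \<and> LC_forms \<A> D U E ap am \<and> K_form \<A> J A U E \<alpha> \<and>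
     E x ?w = dirderiv \<A> (\<lambda>y. E y (Y y)) x u + (\<alpha> x u *\<^sub>R qi) \<odot> E x (Y x) - E x (Y x) \<odot> am x u"
    using ch x lcf chart[OF ch x lcf] by blast
  fix w
  assume "\<exists>U E ap am \<alpha>. U2_chart \<A> g J U E \<and> x \<in> U \<and> LC_forms \<A> D U E ap am \<and> K_form \<A> J A U E \<alpha> \<and>
     E x w = dirderiv \<A> (\<lambda>y. E y (Y y)) x u + (\<alpha> x u *\<^sub>R qi) \<odot> E x (Y x) - E x (Y x) \<odot> am x u"
  then obtain U E ap am \<alpha> where ch: "U2_chart \<A> g J U E" and x: "x \<in> U" and lcf: "LC_forms \<A> D U E ap am"
    and kf: "K_form \<A> J A U E \<alpha>"
    and w: "E x w = dirderiv \<A> (\<lambda>y. E y (Y y)) x u + (\<alpha> x u *\<^sub>R qi) \<odot> E x (Y x) - E x (Y x) \<odot> am x u"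
    by blast
  \<comment> \<open>Testing \<open>K_form\<close> on the constant function 1 pins down the otherwise
    arbitrary \<open>\<alpha>\<close>.\<close>
  have 1: "smooth_at x (\<lambda>y. 1 :: complex)" by (rule smooth_at_const)
  have "A x u (\<lambda>y \<omega>. 1 * K_frame J E y \<omega>) =
      (\<lambda>\<omega>. (dirderiv \<A> (\<lambda>y. 1) x u + 2 * \<i> * complex_of_real (\<alpha> x u) * 1) * K_frame J E x \<omega>)"
    using kf x 1 unfolding K_form_def by blast
  from fun_cong[OF trans[OF sym[OF this] unitary_K_form[OF A ch lcf x 1]], of "cvol E x"]
  have "complex_of_real (\<alpha> x u) = complex_of_real (ap x u $ 2 + beta A x u / 2)"
    by (simp add: K_frame_cvol[OF ch x] dirderiv_const)
  then have "\<alpha> x u = ap x u $ 2 + beta A x u / 2" by (simp only: of_real_eq_iff)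
  then have "E x w = E x ?w" using w chart[OF ch x lcf] by simp
  then show "w = ?w" by (rule injD[OF U2_inj[OF ch x]])
qed

lemma U2_frame_orthonormal:
  "U2_chart \<A> g J U E \<Longrightarrow> x \<in> U \<Longrightarrow>
    g x (inv (E x) (axis j 1)) (inv (E x) (axis k 1)) = (if j = k then 1 else 0)"
  by (simp add: U2_inner[symmetric] U2_inv(1) inner_axis_axis)

lemma onframe_orthonormal: "g x (onframe (g x) j) (onframe (g x) k) = (if j = k then 1 else 0)"
proof -
  obtain U E where x: "x \<in> U" and ch: "U2_chart \<A> g J U E" using ex_U2_chart by blast
  have "\<exists>e :: 4 \<Rightarrow> real^4. \<forall>j k. g x (e j) (e k) = (if j = k then 1 else 0)"
    by (rule exI[of _ "\<lambda>k. inv (E x) (axis k 1)"]) (simp add: U2_frame_orthonormal[OF ch x])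
  from someI_ex[OF this] show ?thesis unfolding onframe_def by blast
qed

lemma linear_eq_on_onframe:
  assumes "linear f" "linear h" "\<And>j. f (onframe (g x) j) = h (onframe (g x) j)"
  shows "f v = h v"
proof -
  let ?e = "onframe (g x)"
  have v: "v = (\<Sum>k\<in>UNIV. g x (?e k) v *\<^sub>R ?e k)"
    using frame_isometry(2)[OF g_bilinear g_sym onframe_orthonormal] by metis
  have "f (\<Sum>k\<in>UNIV. g x (?e k) v *\<^sub>R ?e k) = h (\<Sum>k\<in>UNIV. g x (?e k) v *\<^sub>R ?e k)"
    by (simp only: linear_sum[OF assms(1)] linear_sum[OF assms(2)] linear_scale[OF assms(1)]
        linear_scale[OF assms(2)] assms(3))
  then show ?thesis by (simp only: v[symmetric])
qed

end

locale self_dual_spinor = spin_geometry \<A> g J D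
  for \<A> :: "'a::t2_space chart set" and g :: "'a metric" and J :: "'a acs" and D :: "'a tconn" +
  fixes \<phi> :: "'a \<Rightarrow> real^4 \<Rightarrow> real^4"
  assumes spinor: "selfdual_spinor_field \<A> g \<phi>" and nowhere_zero: "\<phi> x \<noteq> (\<lambda>v. 0)"
begin

section \<open>The derivative of the spinor field as a left multiplication\<close>

lemma phi_linear: "linear (\<phi> x)"
  using spinor unfolding selfdual_spinor_field_def endo_field_def by blast

lemma smooth_phi: "smooth_vf \<A> U X \<Longrightarrow> smooth_vf \<A> U (\<lambda>x. \<phi> x (X x))"
  using spinor unfolding selfdual_spinor_field_def endo_field_def by blast

lemma smooth_vf_at_phi: "smooth_vf_at x X \<Longrightarrow> smooth_vf_at x (\<lambda>x. \<phi> x (X x))"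
  unfolding near_def using smooth_phi by blast

text \<open>The tensor that belongs to the base connection \<open>conn_J\<close>. The extension of
  \<open>v\<close> is chosen here and shown to be arbitrary in \<open>spinB_J_field\<close>.\<close>

definition spinB_J :: "'a \<Rightarrow> real^4 \<Rightarrow> real^4 \<Rightarrow> real^4" where
  "spinB_J x u v = (let Y = (SOME Y. smooth_vf_at x Y \<and> Y x = v) in nabla_J x u (\<lambda>y. \<phi> y (Y y)) - \<phi> x (D x u Y))"

text \<open>A left multiplication is recovered from its value at 1.\<close>

definition phi_coeff :: "('a \<Rightarrow> real^4 \<Rightarrow> quat) \<Rightarrow> 'a \<Rightarrow> quat" where
  "phi_coeff E y = E y (\<phi> y (inv (E y) q1))"

definition spinB_J_coeff :: "('a \<Rightarrow> real^4 \<Rightarrow> quat) \<Rightarrow> 'a \<Rightarrow> real^4 \<Rightarrow> quat" where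
  "spinB_J_coeff E x u = dirderiv \<A> (phi_coeff E) x u + (skew_left (LC_matrix x E u) $ 2 *\<^sub>R qi) \<odot> phi_coeff E x
     - phi_coeff E x \<odot> skew_left (LC_matrix x E u)"

context
  fixes U E assumes ch: "U2_chart \<A> g J U E"
begin

lemma phi_chart: "x \<in> U \<Longrightarrow> E x (\<phi> x v) = phi_coeff E x \<odot> E x v"
proof -
  assume x: "x \<in> U"
  obtain p where p: "\<And>v. E x (\<phi> x v) = p \<odot> E x v"
    using Wplus_left_mult[OF _ U2_isometry[OF ch x]] spinor unfolding selfdual_spinor_field_def by blast
  then show ?thesis by (simp add: phi_coeff_def U2_inv(1)[OF ch x])
qed

lemma phi_coeff_nonzero: "x \<in> U \<Longrightarrow> phi_coeff E x \<noteq> 0"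
proof
  assume x: "x \<in> U" and "phi_coeff E x = 0"
  then have "E x (\<phi> x v) = E x 0" for v by (simp add: phi_chart linear_0[OF U2_linear[OF ch x]])
  then have "\<phi> x v = 0" for v using injD[OF U2_inj[OF ch x]] by blast
  then show False using nowhere_zero by blast
qed

lemma smooth_at_phi_coeff: "x \<in> U \<Longrightarrow> smooth_at x (phi_coeff E)"
  unfolding phi_coeff_def[abs_def]
  by (rule smooth_atI[OF smooth_U2[OF ch smooth_phi[OF smooth_U2_inv_const[OF ch]] order_refl]])

text \<open>The derivatives of \<open>Y\<close> cancel between the two terms, and so do the terms
  with the right connection form. What remains is a left multiplication applied to the value of
  \<open>Y\<close> at \<open>x\<close>, so tensoriality and the quaternionic form of the derivative
  are obtained together.\<close>

lemma spinB_J_chart_field: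
  assumes x: "x \<in> U" and Y: "smooth_vf_at x Y"
  shows "E x (nabla_J x u (\<lambda>y. \<phi> y (Y y)) - \<phi> x (D x u Y)) = spinB_J_coeff E x u \<odot> E x (Y x)"
proof -
  note lcf = ex_LC_forms[OF ch]
  let ?p = "phi_coeff E" and ?ap = "skew_left (LC_matrix x E u)" and ?am = "skew_right (LC_matrix x E u)"
  have "dirderiv \<A> (\<lambda>y. E y (\<phi> y (Y y))) x u = dirderiv \<A> (\<lambda>y. ?p y \<odot> E y (Y y)) x u"
    by (rule dirderiv_cong[OF U2_open[OF ch] x]) (rule phi_chart)
  also have "\<dots> = ?p x \<odot> dirderiv \<A> (\<lambda>y. E y (Y y)) x u + dirderiv \<A> ?p x u \<odot> E x (Y x)"
    by (rule dirderiv_bilinear[OF bounded_bilinear_qmul smooth_at_phi_coeff[OF x] smooth_at_U2[OF ch Y x]])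
  finally have d: "dirderiv \<A> (\<lambda>y. E y (\<phi> y (Y y))) x u =
      ?p x \<odot> dirderiv \<A> (\<lambda>y. E y (Y y)) x u + dirderiv \<A> ?p x u \<odot> E x (Y x)" .
  have DY: "E x (D x u Y) = dirderiv \<A> (\<lambda>y. E y (Y y)) x u + ?ap \<odot> E x (Y x) - E x (Y x) \<odot> ?am"
    using lcf x Y unfolding LC_forms_def by blast
  show ?thesis
    unfolding linear_diff[OF U2_linear[OF ch x]] nabla_J_chart[OF ch lcf x smooth_vf_at_phi[OF Y]]
      phi_chart[OF x] d DY spinB_J_coeff_def
    by (simp add: qmul_add qmul_diff qmul_assoc)
qed

end

lemma spinB_J_field: "smooth_vf_at x Y \<Longrightarrow> nabla_J x u (\<lambda>y. \<phi> y (Y y)) - \<phi> x (D x u Y) = spinB_J x u (Y x)"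
proof -
  assume Y: "smooth_vf_at x Y"
  define Z where "Z = (SOME Z. smooth_vf_at x Z \<and> Z x = Y x)"
  have Z: "smooth_vf_at x Z" "Z x = Y x"
    using someI_ex[OF ex_smooth_vf[of x "Y x"]] unfolding Z_def by auto
  obtain U E where x: "x \<in> U" and ch: "U2_chart \<A> g J U E" using ex_U2_chart by blast
  have "spinB_J x u (Y x) = nabla_J x u (\<lambda>y. \<phi> y (Z y)) - \<phi> x (D x u Z)"
    unfolding spinB_J_def Z_def Let_def ..
  moreover have "nabla_J x u (\<lambda>y. \<phi> y (Y y)) - \<phi> x (D x u Y) = nabla_J x u (\<lambda>y. \<phi> y (Z y)) - \<phi> x (D x u Z)"
    by (rule injD[OF U2_inj[OF ch x]]) (simp only: spinB_J_chart_field[OF ch x] Y Z)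
  ultimately show ?thesis by simp
qed

lemma spinB_J_chart:
  assumes "U2_chart \<A> g J U E" "x \<in> U"
  shows "E x (spinB_J x u v) = spinB_J_coeff E x u \<odot> E x v"
proof -
  obtain Y where Y: "smooth_vf_at x Y" "Y x = v" using ex_smooth_vf by blast
  show ?thesis using spinB_J_chart_field[OF assms Y(1), of u] unfolding spinB_J_field[OF Y(1)] Y(2) .
qed

lemma spinB_J_bilinear: "bilinear (spinB_J x)"
  unfolding bilinear_def
proof (intro conjI allI)
  fix u
  obtain U E where x: "x \<in> U" and ch: "U2_chart \<A> g J U E" using ex_U2_chart by blast
  show "linear (spinB_J x u)"
    by (intro linearI; rule injD[OF U2_inj[OF ch x]])
      (simp_all add: linear_add[OF U2_linear[OF ch x]] linear_scale[OF U2_linear[OF ch x]]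
        spinB_J_chart[OF ch x] qmul_add qmul_scaleR)
next
  fix v
  obtain Y where Y: "smooth_vf_at x Y" "Y x = v" using ex_smooth_vf by blast
  note n = nabla_J_linear[OF smooth_vf_at_phi[OF Y(1)]] and d = D_linear[OF Y(1)]
  have "linear (\<lambda>u. nabla_J x u (\<lambda>y. \<phi> y (Y y)) - \<phi> x (D x u Y))"
    by (intro linearI) (simp_all add: linear_add[OF n] linear_scale[OF n] linear_add[OF d] linear_scale[OF d]
        linear_add[OF phi_linear] linear_scale[OF phi_linear] algebra_simps)
  then show "linear (\<lambda>u. spinB_J x u v)" unfolding spinB_J_field[OF Y(1)] Y(2) .
qed

lemma smooth_spinB_J:
  assumes X: "smooth_vf \<A> U X" and Y: "smooth_vf \<A> U Y"
  shows "smooth_vf \<A> U (\<lambda>x. spinB_J x (X x) (Y x))"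
proof (rule smooth_vf_cong)
  show "smooth_vf \<A> U (\<lambda>x. nabla_J x (X x) (\<lambda>y. \<phi> y (Y y)) - \<phi> x (D x (X x) Y))"
    by (intro smooth_vf_diff smooth_nabla_J smooth_phi smooth_D X Y)
  show "nabla_J x (X x) (\<lambda>y. \<phi> y (Y y)) - \<phi> x (D x (X x) Y) = spinB_J x (X x) (Y x)" if "x \<in> U" for x
    by (rule spinB_J_field[OF smooth_vf_atI[OF Y that]])
qed

lemma nabla_plus_eq:
  assumes A: "unitary_connection \<A> g J A"
  shows "nabla_plus \<A> g J D A x u \<phi> v = spinB_J x u v + (beta A x u / 2) *\<^sub>R J x (\<phi> x v)"
proof -
  have *: "nabla_minus \<A> g J D A x u (\<lambda>y. \<phi> y (Y y)) - \<phi> x (D x u Y)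
      = spinB_J x u (Y x) + (beta A x u / 2) *\<^sub>R J x (\<phi> x (Y x))" if "smooth_vf_at x Y" for Y
    unfolding nabla_minus_eq[OF A smooth_vf_at_phi[OF that]] using spinB_J_field[OF that, of u] by (simp add: algebra_simps)
  show ?thesis
    unfolding nabla_plus_def
  proof (rule the_equality)
    obtain Y where Y: "smooth_vf_at x Y" "Y x = v" using ex_smooth_vf by blast
    then show "\<exists>Y. smooth_vf_at x Y \<and> Y x = v \<and> spinB_J x u v + (beta A x u / 2) *\<^sub>R J x (\<phi> x v) =
        nabla_minus \<A> g J D A x u (\<lambda>y. \<phi> y (Y y)) - \<phi> x (D x u Y)"
      using *[OF Y(1)] by metis
  qed (use * in metis)
qed

text \<open>\<open>A\<close> minimizes the norm of \<open>\<B>\<^sup>A \<phi>\<close> if its \<open>\<B>\<^sup>A\<^sub>X \<phi>\<close> are pointwise orthogonal to \<open>i \<phi>\<close>;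
  \<open>offset_J\<close> is the correction of \<open>spinB_J\<close> that achieves this. Its defining quotient does not depend on the vector
  \<open>axis 1 1\<close>.\<close>

definition offset_J :: "'a \<Rightarrow> real^4 \<Rightarrow> real" where
  "offset_J x u = - g x (spinB_J x u (axis 1 1)) (J x (\<phi> x (axis 1 1))) / g x (\<phi> x (axis 1 1)) (\<phi> x (axis 1 1))"

definition phi_norm2 :: "'a \<Rightarrow> real" where
  "phi_norm2 x = g x (\<phi> x (axis 1 1)) (\<phi> x (axis 1 1)) / g x (axis 1 1) (axis 1 1)"

definition spinB_min :: "'a \<Rightarrow> tensor" where
  "spinB_min x = (\<lambda>u v. spinB_J x u v + offset_J x u *\<^sub>R J x (\<phi> x v))"

definition sigma :: "'a \<Rightarrow> real^4 \<Rightarrow> real" where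
  "sigma x u = - g x (J x (\<phi> x u)) (tensor_tr (g x) (spinB_min x)) / phi_norm2 x"

text \<open>All maps involved are left multiplications in the chart, so numerators and denominators
  carry the same factor \<open>E x w \<bullet> E x w\<close>.\<close>

lemma chart_inner_quotients:
  assumes ch: "U2_chart \<A> g J U E" and x: "x \<in> U" and w: "w \<noteq> 0"
  shows "- g x (spinB_J x u w) (J x (\<phi> x w)) / g x (\<phi> x w) (\<phi> x w) =
      - (spinB_J_coeff E x u \<bullet> (qi \<odot> phi_coeff E x)) / (phi_coeff E x \<bullet> phi_coeff E x)"
    and "g x (\<phi> x w) (\<phi> x w) / g x w w = phi_coeff E x \<bullet> phi_coeff E x"
proof -
  have "E x w \<bullet> E x w \<noteq> 0" using g_pos[OF w, of x] U2_inner[OF ch x, of w w] by simp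
  moreover have "g x (spinB_J x u w) (J x (\<phi> x w)) = (spinB_J_coeff E x u \<bullet> (qi \<odot> phi_coeff E x)) * (E x w \<bullet> E x w)"
    unfolding U2_inner[OF ch x, symmetric] spinB_J_chart[OF ch x] U2_J[OF ch x] phi_chart[OF ch x]
    by (simp only: qmul_assoc[symmetric] qmul_inner_right)
  moreover have "g x (\<phi> x w) (\<phi> x w) = (phi_coeff E x \<bullet> phi_coeff E x) * (E x w \<bullet> E x w)"
    unfolding U2_inner[OF ch x, symmetric] phi_chart[OF ch x] by (simp only: qmul_inner_right)
  moreover have "g x w w = E x w \<bullet> E x w" using U2_inner[OF ch x] by simp
  ultimately show "- g x (spinB_J x u w) (J x (\<phi> x w)) / g x (\<phi> x w) (\<phi> x w) =
      - (spinB_J_coeff E x u \<bullet> (qi \<odot> phi_coeff E x)) / (phi_coeff E x \<bullet> phi_coeff E x)"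
    "g x (\<phi> x w) (\<phi> x w) / g x w w = phi_coeff E x \<bullet> phi_coeff E x" by simp_all
qed

lemma axis_nonzero: "(axis 1 1 :: real^4) \<noteq> 0"
  by (simp add: axis_eq_0_iff)

text \<open>The vectors \<open>axis 1 1\<close> refer to the preferred chart of each point and need
  not form a smooth field. Smoothness of \<open>offset_J\<close> is proved with a smooth
  nonvanishing test field instead.\<close>

lemma offset_J_any: "w \<noteq> 0 \<Longrightarrow> offset_J x u = - g x (spinB_J x u w) (J x (\<phi> x w)) / g x (\<phi> x w) (\<phi> x w)"
proof -
  assume w: "w \<noteq> 0"
  obtain U E where x: "x \<in> U" and ch: "U2_chart \<A> g J U E" using ex_U2_chart by blast
  show ?thesis unfolding offset_J_def chart_inner_quotients(1)[OF ch x w] chart_inner_quotients(1)[OF ch x axis_nonzero] ..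
qed

lemma phi_norm2_any: "w \<noteq> 0 \<Longrightarrow> phi_norm2 x = g x (\<phi> x w) (\<phi> x w) / g x w w"
proof -
  assume w: "w \<noteq> 0"
  obtain U E where x: "x \<in> U" and ch: "U2_chart \<A> g J U E" using ex_U2_chart by blast
  show ?thesis unfolding phi_norm2_def chart_inner_quotients(2)[OF ch x w] chart_inner_quotients(2)[OF ch x axis_nonzero] ..
qed

lemma phi_norm2_pos: "phi_norm2 x > 0"
proof -
  obtain U E where x: "x \<in> U" and ch: "U2_chart \<A> g J U E" using ex_U2_chart by blast
  show ?thesis unfolding phi_norm2_def chart_inner_quotients(2)[OF ch x axis_nonzero]
    using phi_coeff_nonzero[OF ch x] by simp
qed

lemma phi_nonzero: "w \<noteq> 0 \<Longrightarrow> g x (\<phi> x w) (\<phi> x w) > 0"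
  using phi_norm2_pos[of x] g_pos[of w x] phi_norm2_any[of w x] by (simp add: zero_less_divide_iff)

lemma offset_J_linear: "linear (offset_J x)"
  unfolding offset_J_def
  using linear_compose[of "\<lambda>u. spinB_J x u (axis 1 1)"] spinB_J_bilinear[of x] unfolding bilinear_def
  by (intro linearI) (simp_all add: linear_add[of "\<lambda>u. spinB_J x u (axis 1 1)"] linear_scale[of "\<lambda>u. spinB_J x u (axis 1 1)"]
      g_simps add_divide_distrib diff_divide_distrib)

lemma inv_chart_nonzero:
  assumes "U2_chart \<A> g J U E" "x \<in> U"
  shows "inv (E x) q1 \<noteq> 0"
proof
  assume "inv (E x) q1 = 0"
  then have "q1 = 0" using U2_inv(1)[OF assms, of q1] linear_0[OF U2_linear[OF assms]] by simp
  then show False using q_nth(1) by simp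
qed

lemma offset_J_one_form: "one_form \<A> offset_J"
proof (rule one_formI[OF offset_J_linear])
  fix x
  obtain U E where x: "x \<in> U" and ch: "U2_chart \<A> g J U E" using ex_U2_chart by blast
  have "smooth_fun \<A> V (\<lambda>y. offset_J y (X y))" if "V \<subseteq> U" and X: "smooth_vf \<A> V X" for V X
  proof (rule smooth_fun_cong)
    have f: "smooth_vf \<A> V (\<lambda>y. inv (E y) q1)"
      by (rule smooth_vf_subset[OF smooth_U2_inv_const[OF ch] smooth_vf_open[OF X] that(1)])
    show "smooth_fun \<A> V (\<lambda>y. - g y (spinB_J y (X y) (inv (E y) q1)) (J y (\<phi> y (inv (E y) q1)))
        / g y (\<phi> y (inv (E y) q1)) (\<phi> y (inv (E y) q1)))"
      by (intro smooth_fun_divide smooth_fun_minus smooth_g smooth_spinB_J smooth_J smooth_phi f X)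
        (use phi_nonzero inv_chart_nonzero[OF ch] that(1) in \<open>simp add: subset_iff less_imp_neq[symmetric]\<close>)
    show "- g y (spinB_J y (X y) (inv (E y) q1)) (J y (\<phi> y (inv (E y) q1)))
        / g y (\<phi> y (inv (E y) q1)) (\<phi> y (inv (E y) q1)) = offset_J y (X y)" if "y \<in> V" for y
      by (rule offset_J_any[symmetric]) (use that \<open>V \<subseteq> U\<close> inv_chart_nonzero[OF ch] in auto)
  qed
  then show "\<exists>U. open U \<and> x \<in> U \<and> (\<forall>V X. V \<subseteq> U \<longrightarrow> smooth_vf \<A> V X \<longrightarrow> smooth_fun \<A> V (\<lambda>y. offset_J y (X y)))"
    using U2_open[OF ch] x by blast
qed

lemma spinB_min_bilinear: "bilinear (spinB_min x)"
proof -
  have b: "linear (spinB_J x u)" "linear (\<lambda>u. spinB_J x u v)" for u v using spinB_J_bilinear by (auto simp: bilinear_def)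
  show ?thesis
    unfolding bilinear_def spinB_min_def
    by (auto intro!: linearI simp: linear_add[OF b(1)] linear_scale[OF b(1)] linear_add[OF b(2)] linear_scale[OF b(2)]
        linear_add[OF offset_J_linear] linear_scale[OF offset_J_linear] linear_add[OF phi_linear] linear_scale[OF phi_linear]
        linear_add[OF J_linear] linear_scale[OF J_linear] algebra_simps)
qed

lemma sigma_linear: "linear (sigma x)"
  unfolding sigma_def
  by (intro linearI) (simp_all add: linear_add[OF phi_linear] linear_scale[OF phi_linear]
        linear_add[OF J_linear] linear_scale[OF J_linear] g_simps add_divide_distrib diff_divide_distrib)

lemma sigma_one_form: "one_form \<A> sigma"
proof (rule one_formI[OF sigma_linear])
  fix x
  obtain U E where x: "x \<in> U" and ch: "U2_chart \<A> g J U E" using ex_U2_chart by blast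
  have "smooth_fun \<A> V (\<lambda>y. sigma y (X y))" if "V \<subseteq> U" and X: "smooth_vf \<A> V X" for V X
  proof -
    have V: "open V" using X smooth_vf_open by blast
    have f: "smooth_vf \<A> V (\<lambda>y. inv (E y) q)" for q
      by (rule smooth_vf_subset[OF smooth_U2_inv_const[OF ch] V that(1)])
    have t: "smooth_fun \<A> V (\<lambda>y. offset_J y (inv (E y) q))" for q
      using offset_J_one_form f unfolding one_form_def by blast
    have "smooth_vf \<A> V (\<lambda>y. \<Sum>k\<in>UNIV. spinB_min y (inv (E y) (axis k 1)) (inv (E y) (axis k 1)))"
      unfolding spinB_min_def by (intro smooth_vf_sum smooth_vf_add smooth_spinB_J smooth_vf_scaleR smooth_J smooth_phi f t V)
    then have tr: "smooth_vf \<A> V (\<lambda>y. tensor_tr (g y) (spinB_min y))"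
    proof (rule smooth_vf_cong)
      show "(\<Sum>k\<in>UNIV. spinB_min y (inv (E y) (axis k 1)) (inv (E y) (axis k 1))) = tensor_tr (g y) (spinB_min y)" if "y \<in> V" for y
        unfolding tensor_tr_def Let_def
        by (rule trace_orthonormal_independent[OF g_bilinear g_sym U2_frame_orthonormal[OF ch] onframe_orthonormal spinB_min_bilinear])
          (use that \<open>V \<subseteq> U\<close> in auto)
    qed
    have nz: "inv (E y) q1 \<noteq> 0" if "y \<in> V" for y using inv_chart_nonzero[OF ch] \<open>V \<subseteq> U\<close> that by blast
    have "smooth_fun \<A> V (\<lambda>y. g y (\<phi> y (inv (E y) q1)) (\<phi> y (inv (E y) q1)) / g y (inv (E y) q1) (inv (E y) q1))"
      by (intro smooth_fun_divide smooth_g smooth_phi f) (use nz g_pos in \<open>simp add: less_imp_neq[symmetric]\<close>)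
    then have "smooth_fun \<A> V phi_norm2"
      by (rule smooth_fun_cong) (simp add: nz phi_norm2_any[symmetric])
    then show ?thesis
      unfolding sigma_def
      by (intro smooth_fun_divide smooth_fun_minus smooth_g smooth_J smooth_phi X tr)
        (simp_all add: phi_norm2_pos less_imp_neq[symmetric])
  qed
  then show "\<exists>U. open U \<and> x \<in> U \<and> (\<forall>V X. V \<subseteq> U \<longrightarrow> smooth_vf \<A> V X \<longrightarrow> smooth_fun \<A> V (\<lambda>y. sigma y (X y)))"
    using U2_open[OF ch] x by blast
qed

text \<open>The one-form \<open>t\<close> of the overview. The half converts the scalar on the
  determinant line into the scalar on spinors, and \<open>offset_J\<close> moves the origin to the
  connection whose derivative of \<open>\<phi>\<close> is orthogonal to
  \<open>i \<phi>\<close>.\<close>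

definition offset :: "'a kconn \<Rightarrow> 'a \<Rightarrow> real^4 \<Rightarrow> real" where
  "offset A x u = beta A x u / 2 - offset_J x u"

lemma spinB_eq:
  assumes "unitary_connection \<A> g J A"
  shows "spinB \<A> g J D \<phi> A x = (\<lambda>u v. spinB_min x u v + offset A x u *\<^sub>R J x (\<phi> x v))"
  unfolding spinB_def clifford_def nabla_plus_eq[OF assms] spinB_min_def offset_def
  by (simp add: algebra_simps)

text \<open>The passage from geometry to quaternion algebra at one point: \<open>L\<close>,
  \<open>n\<close> and \<open>c\<close> meet the hypotheses under which the norms were
  computed.\<close>

lemma pointwise_data:
  "\<exists>L n c. linear L \<and> (\<forall>v w. L v \<bullet> L w = g x v w) \<and> n \<noteq> 0 \<and> (\<forall>u. n \<bullet> c u = 0) \<and>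
    (\<forall>u v. L (spinB_min x u v) = c u \<odot> L v) \<and> (\<forall>v. L (J x (\<phi> x v)) = n \<odot> L v) \<and> n \<bullet> n = phi_norm2 x"
proof -
  obtain U E where x: "x \<in> U" and ch: "U2_chart \<A> g J U E" using ex_U2_chart by blast
  define n where "n = qi \<odot> phi_coeff E x"
  have "qi \<bullet> qi = 1" by (simp add: inner_vec4)
  then have nn: "n \<bullet> n = phi_coeff E x \<bullet> phi_coeff E x" by (simp add: n_def qmul_inner)
  define c where "c u = spinB_J_coeff E x u + offset_J x u *\<^sub>R n" for u
  show ?thesis
  proof (rule exI[of _ "E x"], rule exI[of _ n], rule exI[of _ c], intro conjI allI)
    show "linear (E x)" by (rule U2_linear[OF ch x])
    show "E x v \<bullet> E x w = g x v w" for v w by (rule U2_inner[OF ch x])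
    have nz: "phi_coeff E x \<bullet> phi_coeff E x \<noteq> 0" using phi_coeff_nonzero[OF ch x] by simp
    then show "n \<noteq> 0" using nn by auto
    have "offset_J x u * (n \<bullet> n) = - (spinB_J_coeff E x u \<bullet> n)" for u
      unfolding offset_J_def chart_inner_quotients(1)[OF ch x axis_nonzero] nn using nz by (simp add: n_def)
    then show "n \<bullet> c u = 0" for u by (simp add: c_def inner_add_right inner_commute)
    show J: "E x (J x (\<phi> x v)) = n \<odot> E x v" for v
      by (simp add: U2_J[OF ch x] phi_chart[OF ch x] n_def qmul_assoc)
    show "E x (spinB_min x u v) = c u \<odot> E x v" for u v
      by (simp add: spinB_min_def c_def linear_add[OF U2_linear[OF ch x]] linear_scale[OF U2_linear[OF ch x]] J
          spinB_J_chart[OF ch x] qmul_add qmul_scaleR)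
    show "n \<bullet> n = phi_norm2 x"
      unfolding nn phi_norm2_def chart_inner_quotients(2)[OF ch x axis_nonzero] ..
  qed
qed

abbreviation frame :: "'a \<Rightarrow> 4 \<Rightarrow> real^4" where "frame x \<equiv> onframe (g x)"

text \<open>At each point the squared norm is a quadratic polynomial in the offset of the connection, with vertex
  \<open>m\<close>.\<close>

definition norm_profile :: "('a kconn \<Rightarrow> 'a \<Rightarrow> tensor) \<Rightarrow> ('a \<Rightarrow> real^4 \<Rightarrow> real) \<Rightarrow> bool" where
  "norm_profile T m \<longleftrightarrow> (\<forall>x. \<exists>C K. K > 0 \<and> (\<forall>A. unitary_connection \<A> g J A \<longrightarrow>
     tensor_norm (g x) (T A x) = sqrt (C + K * (\<Sum>j\<in>UNIV. (offset A x (frame x j) - m x (frame x j))\<^sup>2))))"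

lemma norm_profiles_and_dirac:
  "norm_profile (spinB \<A> g J D \<phi>) (\<lambda>x v. 0)"
  "norm_profile (\<lambda>A x. Sym (spinB \<A> g J D \<phi> A x)) (\<lambda>x v. - 1 / 5 * sigma x v)"
  "norm_profile (\<lambda>A x. Alt (spinB \<A> g J D \<phi> A x)) (\<lambda>x v. 1 / 3 * sigma x v)"
  "unitary_connection \<A> g J A \<Longrightarrow>
    dirac \<A> g J D \<phi> A x = 0 \<longleftrightarrow> (\<forall>j. offset A x (frame x j) = sigma x (frame x j))"
proof -
  \<comment> \<open>The four claims are proved jointly at a fixed point because they share one
    choice of \<open>L\<close>, \<open>n\<close> and \<open>c\<close>.\<close>
  have "(\<exists>C K. K > 0 \<and> (\<forall>A. unitary_connection \<A> g J A \<longrightarrow>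
       tensor_norm (g x) (spinB \<A> g J D \<phi> A x) =
         sqrt (C + K * (\<Sum>j\<in>UNIV. (offset A x (frame x j) - 0)\<^sup>2)))) \<and>
    (\<exists>C K. K > 0 \<and> (\<forall>A. unitary_connection \<A> g J A \<longrightarrow>
       tensor_norm (g x) (Sym (spinB \<A> g J D \<phi> A x)) =
         sqrt (C + K * (\<Sum>j\<in>UNIV. (offset A x (frame x j) - - 1 / 5 * sigma x (frame x j))\<^sup>2)))) \<and>
    (\<exists>C K. K > 0 \<and> (\<forall>A. unitary_connection \<A> g J A \<longrightarrow>
       tensor_norm (g x) (Alt (spinB \<A> g J D \<phi> A x)) =
         sqrt (C + K * (\<Sum>j\<in>UNIV. (offset A x (frame x j) - 1 / 3 * sigma x (frame x j))\<^sup>2)))) \<and>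
    (\<forall>A. unitary_connection \<A> g J A \<longrightarrow>
      (dirac \<A> g J D \<phi> A x = 0 \<longleftrightarrow> (\<forall>j. offset A x (frame x j) = sigma x (frame x j))))" for x
  proof -
    obtain L c n where L: "linear L" "\<And>v w. L v \<bullet> L w = g x v w" and n: "n \<noteq> 0"
      and cn: "\<And>u. n \<bullet> c u = 0" and LB: "\<And>u v. L (spinB_min x u v) = c u \<odot> L v"
      and Ln: "\<And>v. L (J x (\<phi> x v)) = n \<odot> L v" and nn: "n \<bullet> n = phi_norm2 x"
      using pointwise_data[of x] by blast
    note Lsimps = linear_add[OF L(1)] linear_diff[OF L(1)] linear_scale[OF L(1)] linear_sum[OF L(1)]
    define r where "r k = L (frame x k)" for k
    define d where "d k = c (frame x k)" for k
    have r: "r j \<bullet> r k = (if j = k then 1 else 0)" for j k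
      unfolding r_def L(2) by (rule onframe_orthonormal)
    have dn: "n \<bullet> d j = 0" for j unfolding d_def by (rule cn)
    have LT: "L (spinB \<A> g J D \<phi> A x (frame x j) (frame x k)) = (d j + offset A x (frame x j) *\<^sub>R n) \<odot> r k"
      if "unitary_connection \<A> g J A" for A j k
      unfolding spinB_eq[OF that] by (simp add: Lsimps LB Ln d_def r_def qmul_add qmul_scaleR)
    have tr: "L (tensor_tr (g x) (spinB_min x)) = (\<Sum>k\<in>UNIV. d k \<odot> r k)"
      unfolding tensor_tr_def Let_def by (simp add: Lsimps LB d_def r_def)
    have sg: "sigma x (frame x j) = - ((n \<odot> r j) \<bullet> (\<Sum>k\<in>UNIV. d k \<odot> r k)) / (n \<bullet> n)" for j
      unfolding sigma_def L(2)[symmetric] Ln tr nn r_def ..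
    have pos: "n \<bullet> n > 0" using n by simp
    have nrm: "tensor_norm (g x) T = sqrt (\<Sum>j\<in>UNIV. \<Sum>k\<in>UNIV.
        L (T (frame x j) (frame x k)) \<bullet> L (T (frame x j) (frame x k)))" for T
      unfolding tensor_norm_def Let_def L(2) ..
    obtain C1 where C1: "\<And>t. (\<Sum>j\<in>UNIV. \<Sum>k\<in>UNIV. ((d j + t j *\<^sub>R n) \<odot> r k) \<bullet> ((d j + t j *\<^sub>R n) \<odot> r k))
        = C1 + 4 * (n \<bullet> n) * (\<Sum>j\<in>UNIV. (t j)\<^sup>2)"
      using tensor_norm_coeffs[of r n d, OF r dn n] by blast
    obtain C2 where C2: "\<And>t. (\<Sum>j\<in>UNIV. \<Sum>k\<in>UNIV.
        ((1/2) *\<^sub>R ((d j + t j *\<^sub>R n) \<odot> r k + (d k + t k *\<^sub>R n) \<odot> r j)) \<bullet>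
        ((1/2) *\<^sub>R ((d j + t j *\<^sub>R n) \<odot> r k + (d k + t k *\<^sub>R n) \<odot> r j)))
        = C2 + 5 / 2 * (n \<bullet> n) * (\<Sum>j\<in>UNIV. (t j - - 1 / 5 * sigma x (frame x j))\<^sup>2)"
      using tensor_norm_sym_coeffs[of r n d, OF r dn n] unfolding sg by blast
    obtain C3 where C3: "\<And>t. (\<Sum>j\<in>UNIV. \<Sum>k\<in>UNIV.
        ((1/2) *\<^sub>R ((d j + t j *\<^sub>R n) \<odot> r k - (d k + t k *\<^sub>R n) \<odot> r j)) \<bullet>
        ((1/2) *\<^sub>R ((d j + t j *\<^sub>R n) \<odot> r k - (d k + t k *\<^sub>R n) \<odot> r j)))
        = C3 + 3 / 2 * (n \<bullet> n) * (\<Sum>j\<in>UNIV. (t j - 1 / 3 * sigma x (frame x j))\<^sup>2)"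
      using tensor_norm_alt_coeffs[of r n d, OF r dn n] unfolding sg by blast
    show ?thesis
    proof (intro conjI)
      show "\<exists>C K. K > 0 \<and> (\<forall>A. unitary_connection \<A> g J A \<longrightarrow>
         tensor_norm (g x) (spinB \<A> g J D \<phi> A x) =
           sqrt (C + K * (\<Sum>j\<in>UNIV. (offset A x (frame x j) - 0)\<^sup>2)))"
        by (rule exI[of _ C1], rule exI[of _ "4 * (n \<bullet> n)"])
          (use pos in \<open>simp add: nrm LT C1[of "\<lambda>j. offset _ x (frame x j)"]\<close>)
      show "\<exists>C K. K > 0 \<and> (\<forall>A. unitary_connection \<A> g J A \<longrightarrow>
         tensor_norm (g x) (Sym (spinB \<A> g J D \<phi> A x)) =
           sqrt (C + K * (\<Sum>j\<in>UNIV. (offset A x (frame x j) - - 1 / 5 * sigma x (frame x j))\<^sup>2)))"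
      proof (rule exI[of _ C2], rule exI[of _ "5 / 2 * (n \<bullet> n)"], intro conjI allI impI)
        fix A assume A: "unitary_connection \<A> g J A"
        show "tensor_norm (g x) (Sym (spinB \<A> g J D \<phi> A x)) =
           sqrt (C2 + 5 / 2 * (n \<bullet> n) * (\<Sum>j\<in>UNIV. (offset A x (frame x j) - - 1 / 5 * sigma x (frame x j))\<^sup>2))"
          unfolding nrm Sym_def linear_scale[OF L(1)] linear_add[OF L(1)] LT[OF A] C2 ..
      qed (use pos in simp)
      show "\<exists>C K. K > 0 \<and> (\<forall>A. unitary_connection \<A> g J A \<longrightarrow>
         tensor_norm (g x) (Alt (spinB \<A> g J D \<phi> A x)) =
           sqrt (C + K * (\<Sum>j\<in>UNIV. (offset A x (frame x j) - 1 / 3 * sigma x (frame x j))\<^sup>2)))"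
      proof (rule exI[of _ C3], rule exI[of _ "3 / 2 * (n \<bullet> n)"], intro conjI allI impI)
        fix A assume A: "unitary_connection \<A> g J A"
        show "tensor_norm (g x) (Alt (spinB \<A> g J D \<phi> A x)) =
           sqrt (C3 + 3 / 2 * (n \<bullet> n) * (\<Sum>j\<in>UNIV. (offset A x (frame x j) - 1 / 3 * sigma x (frame x j))\<^sup>2))"
          unfolding nrm Alt_def linear_scale[OF L(1)] linear_diff[OF L(1)] LT[OF A] C3 ..
      qed (use pos in simp)
      show "\<forall>A. unitary_connection \<A> g J A \<longrightarrow>
        (dirac \<A> g J D \<phi> A x = 0 \<longleftrightarrow> (\<forall>j. offset A x (frame x j) = sigma x (frame x j)))"
      proof (intro allI impI)
        fix A assume A: "unitary_connection \<A> g J A"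
        have "inj L"
          unfolding linear_injective_0[OF L(1)] by (metis L(2) g_pos inner_zero_left less_irrefl)
        then have "dirac \<A> g J D \<phi> A x = 0 \<longleftrightarrow> L (dirac \<A> g J D \<phi> A x) = 0"
          using linear_injective_0[OF L(1)] linear_0[OF L(1)] by metis
        also have "L (dirac \<A> g J D \<phi> A x) = (\<Sum>k\<in>UNIV. (d k + offset A x (frame x k) *\<^sub>R n) \<odot> r k)"
          unfolding dirac_def tensor_tr_def Let_def by (simp add: Lsimps LT[OF A])
        finally show "dirac \<A> g J D \<phi> A x = 0 \<longleftrightarrow> (\<forall>j. offset A x (frame x j) = sigma x (frame x j))"
          unfolding sg dirac_vanishes_iff[of r n d, OF r dn n] .
      qed
    qed
  qed
  note * = this
  show "norm_profile (spinB \<A> g J D \<phi>) (\<lambda>x v. 0)"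
    "norm_profile (\<lambda>A x. Sym (spinB \<A> g J D \<phi> A x)) (\<lambda>x v. - 1 / 5 * sigma x v)"
    "norm_profile (\<lambda>A x. Alt (spinB \<A> g J D \<phi> A x)) (\<lambda>x v. 1 / 3 * sigma x v)"
    unfolding norm_profile_def using * by blast+
  show "unitary_connection \<A> g J A \<Longrightarrow>
    dirac \<A> g J D \<phi> A x = 0 \<longleftrightarrow> (\<forall>j. offset A x (frame x j) = sigma x (frame x j))"
    using * by blast
qed

text \<open>The form solves \<open>beta / 2 - offset_J = m\<close> for \<open>beta\<close>.\<close>

definition conn_offset :: "('a \<Rightarrow> real^4 \<Rightarrow> real) \<Rightarrow> 'a kconn" where
  "conn_offset m = conn (\<lambda>x u. 2 * offset_J x u + 2 * m x u)"

lemma unitary_conn_offset: "one_form \<A> m \<Longrightarrow> unitary_connection \<A> g J (conn_offset m)"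
  unfolding conn_offset_def by (intro unitary_conn one_form_add one_form_scale offset_J_one_form)

lemma offset_conn_offset: "offset (conn_offset m) x u = m x u"
  by (simp add: offset_def conn_offset_def beta_conn add_divide_distrib)

lemma conn_offset_inj: "conn_offset m = conn_offset m' \<Longrightarrow> m = m'"
  using offset_conn_offset by (metis ext)

lemma eq_conn_offset:
  assumes A: "unitary_connection \<A> g J A" and m: "one_form \<A> m"
    and "\<And>x j. offset A x (frame x j) = m x (frame x j)"
  shows "A = conn_offset m"
proof -
  have "offset A x u = m x u" for x u
  proof (rule linear_eq_on_onframe[where x = x])
    show "linear (offset A x)"
      unfolding offset_def using linear_add[OF beta_linear[OF A]] linear_scale[OF beta_linear[OF A]]
      by (intro linearI) (simp_all add: linear_add[OF offset_J_linear] linear_scale[OF offset_J_linear] algebra_simps add_divide_distrib)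
    show "linear (m x)" using m by (simp add: one_form_def)
  qed (rule assms)
  then have "beta A = (\<lambda>x u. 2 * offset_J x u + 2 * m x u)"
    unfolding offset_def by (intro ext) (simp add: field_simps)
  then show ?thesis unfolding conn_offset_def using conn_beta[OF A] by simp
qed

text \<open>Since \<open>m\<close> is a global one-form, a single connection sits at the vertex at
  every point. A rival minimum point is compared with this one connection, which forces its sum of
  squares to vanish everywhere; competitors localized near a point never have to be built.\<close>

lemma minimum_point_unique:
  assumes prof: "norm_profile T m" and m: "one_form \<A> m"
  shows "is_unique (minimum_point \<A> g J T) (conn_offset m)"
  unfolding is_unique_def
proof (intro conjI allI impI)
  note u = unitary_conn_offset[OF m]
  show "minimum_point \<A> g J T (conn_offset m)"
    unfolding minimum_point_def
  proof (intro conjI allI impI u)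
    fix x A' assume A': "unitary_connection \<A> g J A'"
    obtain C K where K: "K > 0" and N: "\<And>A. unitary_connection \<A> g J A \<Longrightarrow> tensor_norm (g x) (T A x) =
        sqrt (C + K * (\<Sum>j\<in>UNIV. (offset A x (frame x j) - m x (frame x j))\<^sup>2))"
      using prof unfolding norm_profile_def by blast
    show "tensor_norm (g x) (T (conn_offset m) x) \<le> tensor_norm (g x) (T A' x)"
      unfolding N[OF u] N[OF A'] offset_conn_offset using K by (simp add: sum_nonneg)
  qed
  fix A assume "minimum_point \<A> g J T A"
  then have A: "unitary_connection \<A> g J A"
    and le: "\<And>x. tensor_norm (g x) (T A x) \<le> tensor_norm (g x) (T (conn_offset m) x)"
    unfolding minimum_point_def using u by blast+
  show "A = conn_offset m"
  proof (rule eq_conn_offset[OF A m])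
    fix x j
    obtain C K where K: "K > 0" and N: "\<And>A. unitary_connection \<A> g J A \<Longrightarrow> tensor_norm (g x) (T A x) =
        sqrt (C + K * (\<Sum>j\<in>UNIV. (offset A x (frame x j) - m x (frame x j))\<^sup>2))"
      using prof unfolding norm_profile_def by blast
    let ?S = "\<Sum>j\<in>UNIV. (offset A x (frame x j) - m x (frame x j))\<^sup>2"
    \<comment> \<open>\<open>sqrt\<close> is strictly increasing on all of the reals, negative
      arguments included, so the radicands compare whatever the sign of \<open>C\<close>.\<close>
    have "K * ?S \<le> 0" using le[of x] unfolding N[OF u] N[OF A] offset_conn_offset by simp
    then have "?S \<le> 0" using K by (simp add: mult_le_0_iff)
    then have "?S = 0" by (simp add: antisym sum_nonneg)
    then show "offset A x (frame x j) = m x (frame x j)" by (simp add: sum_nonneg_eq_0_iff)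
  qed
qed

lemma dirac_vanishing_unique: "is_unique (vanishing_point \<A> g J (dirac \<A> g J D \<phi>)) (conn_offset sigma)"
  unfolding is_unique_def vanishing_point_def
  using norm_profiles_and_dirac(4) unitary_conn_offset[OF sigma_one_form] eq_conn_offset[OF _ sigma_one_form] offset_conn_offset by metis

text \<open>The vertices \<open>- sigma / 5\<close>, \<open>sigma / 3\<close> and
  \<open>sigma\<close> are -3, 5 and 15 times \<open>sigma / 15\<close>; the numerator 2 turns
  offsets into differences of connections.\<close>

definition xi_form :: "'a \<Rightarrow> real^4 \<Rightarrow> real" where "xi_form x v = 2 / 15 * sigma x v"

lemma xi_form_one_form: "one_form \<A> xi_form"
  unfolding xi_form_def[abs_def] by (rule one_form_scale[OF sigma_one_form])

definition line_conn :: "real \<Rightarrow> 'a kconn" where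
  "line_conn k = conn_offset (\<lambda>x v. k / 2 * xi_form x v)"

lemma line_conn_add: "add_i \<A> J (line_conn 0) (\<lambda>x v. k * \<eta> x v) = conn (\<lambda>x v. 2 * offset_J x v + k * \<eta> x v)"
  by (simp add: line_conn_def conn_offset_def add_i_conn)

lemma line_conn_line: "add_i \<A> J (line_conn 0) (\<lambda>x v. k * xi_form x v) = line_conn k"
  unfolding line_conn_add by (simp add: line_conn_def conn_offset_def)

lemma unitary_line_conn: "unitary_connection \<A> g J (line_conn k)"
  unfolding line_conn_def by (intro unitary_conn_offset one_form_scale xi_form_one_form)

lemma line_conn_unique:
  "is_unique (minimum_point \<A> g J (spinB \<A> g J D \<phi>)) (line_conn 0)"
  "is_unique (minimum_point \<A> g J (\<lambda>A x. Sym (spinB \<A> g J D \<phi> A x))) (line_conn (-3))"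
  "is_unique (minimum_point \<A> g J (\<lambda>A x. Alt (spinB \<A> g J D \<phi> A x))) (line_conn 5)"
  "is_unique (vanishing_point \<A> g J (dirac \<A> g J D \<phi>)) (line_conn 15)"
proof -
  have "line_conn 0 = conn_offset (\<lambda>x v. 0)" "line_conn (-3) = conn_offset (\<lambda>x v. - 1 / 5 * sigma x v)" "line_conn 5 = conn_offset (\<lambda>x v. 1 / 3 * sigma x v)"
    "line_conn 15 = conn_offset sigma"
    by (simp_all add: line_conn_def xi_form_def)
  then show "is_unique (minimum_point \<A> g J (spinB \<A> g J D \<phi>)) (line_conn 0)"
    "is_unique (minimum_point \<A> g J (\<lambda>A x. Sym (spinB \<A> g J D \<phi> A x))) (line_conn (-3))"
    "is_unique (minimum_point \<A> g J (\<lambda>A x. Alt (spinB \<A> g J D \<phi> A x))) (line_conn 5)"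
    "is_unique (vanishing_point \<A> g J (dirac \<A> g J D \<phi>)) (line_conn 15)"
    using minimum_point_unique[OF norm_profiles_and_dirac(1)] one_form_scale[OF sigma_one_form, of 0]
      minimum_point_unique[OF norm_profiles_and_dirac(2) one_form_scale[OF sigma_one_form]]
      minimum_point_unique[OF norm_profiles_and_dirac(3) one_form_scale[OF sigma_one_form]]
      dirac_vanishing_unique
    by simp_all
qed

text \<open>Offsets determine connections, so different parameters can give the same connection only
  when the direction vanishes identically, and then the whole family collapses. With the distinct
  parameters 0, -3, 5 and 15 this is the all-or-nothing coincidence of the theorem.\<close>

lemma line_conn_eq_iff: "line_conn k = line_conn l \<longleftrightarrow> k = l \<or> (\<forall>x v. xi_form x v = 0)"
proof
  assume "line_conn k = line_conn l"
  then have "k / 2 * xi_form x v = l / 2 * xi_form x v" for x v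
    unfolding line_conn_def using conn_offset_inj by metis
  then show "k = l \<or> (\<forall>x v. xi_form x v = 0)" by fastforce
qed (auto simp: line_conn_def)

lemma line_conn_on_line: "\<exists>\<L>. is_affine_line \<A> g J \<L> \<and> range line_conn \<subseteq> \<L>"
proof (cases "\<exists>x v. xi_form x v \<noteq> 0")
  case True
  have "is_affine_line \<A> g J (range line_conn)"
    unfolding is_affine_line_def
    by (rule exI[of _ "line_conn 0"], rule exI[of _ xi_form]) (simp add: unitary_line_conn xi_form_one_form True line_conn_line)
  then show ?thesis by blast
next
  \<comment> \<open>All \<open>line_conn k\<close> now agree, and any one-form that is nonzero
    somewhere gives a line through their common value.\<close>
  case False
  obtain \<eta> where \<eta>: "one_form \<A> \<eta>" "\<exists>x v. \<eta> x v \<noteq> 0" using ex_nonzero_one_form by blast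
  let ?L = "range (\<lambda>t::real. add_i \<A> J (line_conn 0) (\<lambda>x v. t * \<eta> x v))"
  have "is_affine_line \<A> g J ?L"
    unfolding is_affine_line_def using unitary_line_conn \<eta> by blast
  moreover have "line_conn k \<in> ?L" for k
  proof (rule range_eqI[of _ _ 0])
    have "line_conn k = line_conn 0" using False line_conn_eq_iff by blast
    then show "line_conn k = add_i \<A> J (line_conn 0) (\<lambda>x v. 0 * \<eta> x v)"
      unfolding line_conn_add by (simp add: line_conn_def conn_offset_def)
  qed
  ultimately show ?thesis by blast
qed

end

theorem theorem3p7:
  fixes \<A> :: "'a::t2_space chart set"
    and g :: "'a metric" and J :: "'a acs" and D :: "'a tconn"
    and \<phi> :: "'a \<Rightarrow> real^4 \<Rightarrow> real^4"
  assumes "closed_oriented_4manifold \<A>"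
    and "riemannian_metric \<A> g"
    and "almost_complex_structure \<A> J"
    and "compatible g J"
    and "levi_civita \<A> g D"
    and "selfdual_spinor_field \<A> g \<phi>"
    and "\<forall>x. \<phi> x \<noteq> (\<lambda>v. 0)"
  defines "\<B> \<equiv> spinB \<A> g J D \<phi>"
  defines "minB \<equiv> minimum_point \<A> g J \<B>"
    and "minSym \<equiv> minimum_point \<A> g J (\<lambda>A x. Sym (\<B> A x))"
    and "minAlt \<equiv> minimum_point \<A> g J (\<lambda>A x. Alt (\<B> A x))"
    and "vanD \<equiv> vanishing_point \<A> g J (dirac \<A> g J D \<phi>)"
  shows "(\<exists>!p. case p of (A0, \<xi>) \<Rightarrow>
            unitary_connection \<A> g J A0 \<and> one_form \<A> \<xi> \<and>
            is_unique minB A0 \<and>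
            is_unique minSym (add_i \<A> J A0 (\<lambda>x v. - 3 * \<xi> x v)) \<and>
            is_unique minAlt (add_i \<A> J A0 (\<lambda>x v. 5 * \<xi> x v)) \<and>
            is_unique vanD (add_i \<A> J A0 (\<lambda>x v. 15 * \<xi> x v)))
    \<and> (\<forall>A1 A2 A3 A4. minB A1 \<and> minSym A2 \<and> minAlt A3 \<and> vanD A4 \<longrightarrow>
          (\<exists>\<L>. is_affine_line \<A> g J \<L> \<and> {A1, A2, A3, A4} \<subseteq> \<L>) \<and>
          (A1 = A2 \<or> A1 = A3 \<or> A1 = A4 \<or> A2 = A3 \<or> A2 = A4 \<or> A3 = A4 \<longrightarrow>
             A1 = A2 \<and> A2 = A3 \<and> A3 = A4))"
proof -
  interpret self_dual_spinor \<A> g J D \<phi>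
    by unfold_locales (use assms in auto)
  note U = line_conn_unique[folded \<B>_def, folded minB_def minSym_def minAlt_def vanD_def]
  show ?thesis
  proof (intro conjI allI impI)
    show "\<exists>!p. case p of (A0, \<xi>) \<Rightarrow>
            unitary_connection \<A> g J A0 \<and> one_form \<A> \<xi> \<and>
            is_unique minB A0 \<and>
            is_unique minSym (add_i \<A> J A0 (\<lambda>x v. - 3 * \<xi> x v)) \<and>
            is_unique minAlt (add_i \<A> J A0 (\<lambda>x v. 5 * \<xi> x v)) \<and>
            is_unique vanD (add_i \<A> J A0 (\<lambda>x v. 15 * \<xi> x v))"
    proof (rule ex1I[of _ "(line_conn 0, xi_form)"], unfold case_prod_conv line_conn_line, intro conjI unitary_line_conn xi_form_one_form U)
      fix p
      assume p: "case p of (A0, \<xi>) \<Rightarrow>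
            unitary_connection \<A> g J A0 \<and> one_form \<A> \<xi> \<and>
            is_unique minB A0 \<and>
            is_unique minSym (add_i \<A> J A0 (\<lambda>x v. - 3 * \<xi> x v)) \<and>
            is_unique minAlt (add_i \<A> J A0 (\<lambda>x v. 5 * \<xi> x v)) \<and>
            is_unique vanD (add_i \<A> J A0 (\<lambda>x v. 15 * \<xi> x v))"
      obtain B \<eta> where B\<eta>: "p = (B, \<eta>)" by (cases p)
      have B: "B = line_conn 0" using p U(1) unfolding B\<eta> is_unique_def by auto
      \<comment> \<open>With the base connection already identified, the vanishing point of the
        Dirac operator alone determines the one-form: \<open>beta\<close> recovers 15 times
        it.\<close>
      have "add_i \<A> J (line_conn 0) (\<lambda>x v. 15 * \<eta> x v) = line_conn 15"
        using p U(4) unfolding B\<eta> B is_unique_def by auto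
      then have "beta (add_i \<A> J (line_conn 0) (\<lambda>x v. 15 * \<eta> x v)) x v = beta (line_conn 15) x v" for x v
        by simp
      then have "\<eta> x v = xi_form x v" for x v
        unfolding line_conn_add unfolding line_conn_def conn_offset_def beta_conn by simp
      then show "p = (line_conn 0, xi_form)" unfolding B\<eta> B by (simp add: fun_eq_iff)
    qed
  next
    fix A1 A2 A3 A4
    assume "minB A1 \<and> minSym A2 \<and> minAlt A3 \<and> vanD A4"
    then have A: "A1 = line_conn 0" "A2 = line_conn (-3)" "A3 = line_conn 5" "A4 = line_conn 15"
      using U unfolding is_unique_def by blast+
    show "\<exists>\<L>. is_affine_line \<A> g J \<L> \<and> {A1, A2, A3, A4} \<subseteq> \<L>"
      using line_conn_on_line unfolding A by blast
    assume "A1 = A2 \<or> A1 = A3 \<or> A1 = A4 \<or> A2 = A3 \<or> A2 = A4 \<or> A3 = A4"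
    then have "\<forall>x v. xi_form x v = 0" unfolding A line_conn_eq_iff by auto
    then show "A1 = A2" "A2 = A3" "A3 = A4" unfolding A line_conn_eq_iff by blast+
  qed
qed

end
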